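(* Let $d\ge4$ be an integer and $c_*=2-\sqrt3$. Suppose that $a_{d,0}\ge0$, $a_{d,d-1}\ge0$, and $S_{d,r}(c_* )\ge0$ for every $1\le r\le d-2$. Then $H_d(t)$ has only real negative zeros.
   Context: $P_d=P_d(132,213)\subset\mathbb R^d$ is the convex hull of the points $(\pi_1,\ldots,\pi_d)$ over all permutations $\pi$ of $\{1,\ldots,d\}$ avoiding both patterns $132$ and $213$, and $H_d(t)$ is defined by $\sum_{m\ge0}|mP_d\cap\mathbb Z^d|t^m=H_d(t)/(1-t)^d$. Let $K(u,y)=\sum_{d\ge1}u^d\,[u^d]K(u,y)$ be the formal power series in $u$ with coefficients polynomial in $y$ given by $$[u^d]K(u,y)=\frac1{d^2}\sum_{h\mid d}\varphi(h)\binom{(1+y)d/h-1}{d/h-1},$$ where $\varphi$ is Euler's totient and, with $n=d/h$, $\binom{(1+y)n-1}{n-1}=\frac1{(n-1)!}\prod_{q=1}^{n-1}(ny+q)$. Define $C_{d,q}$ by $\exp K(u,y)=\sum_{d,q\ge0}C_{d,q}u^dy^q$. The refined Eulerian coordinates are $$a_{d,j}=\sum_{q=0}^j(-1)^{j-q}\binom{d-1-q}{j-q}2^qC_{d,q}\qquad(0\le j\le d-1),$$ and the repaired tails are $S_{d,r}(c_* )=\sum_{j=r}^{d-2}c_*^{\,j-r}a_{d,j}$ for $1\le r\le d-2$. *)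

theory Defs
  imports
    "HOL-Analysis.Analysis"
    "HOL-Computational_Algebra.Computational_Algebra"
    "HOL-Number_Theory.Totient"
begin

section \<open>Pattern-avoiding permutations and their polytope\<close>

text \<open>
  The space $\mathbb{R}^d$ is \<^typ>\<open>real ^ 'n\<close> with $d$ the cardinality of \<open>'n\<close>; the linear order on
  \<open>'n\<close> is the left-to-right order of the positions.  The value \<open>p i\<close> is the entry of the
  permutation at position \<open>i\<close>.
\<close>

definition is_permutation :: "('n::{finite,linorder} \<Rightarrow> nat) \<Rightarrow> bool" where
  "is_permutation p \<longleftrightarrow> bij_betw p UNIV {1..CARD('n)}"

text \<open>Patterns are given in one-line notation, e.g. \<open>[1, 3, 2]\<close>.\<close>

definition contains_pattern :: "('n::{finite,linorder} \<Rightarrow> nat) \<Rightarrow> nat list \<Rightarrow> bool" where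
  "contains_pattern p s \<longleftrightarrow>
     (\<exists>is. length is = length s \<and> sorted_wrt (<) is \<and>
        (\<forall>a < length s. \<forall>b < length s. p (is ! a) < p (is ! b) \<longleftrightarrow> s ! a < s ! b))"

definition avoiding_permutations :: "nat list set \<Rightarrow> ('n::{finite,linorder} \<Rightarrow> nat) set" where
  "avoiding_permutations S = {p. is_permutation p \<and> (\<forall>s\<in>S. \<not> contains_pattern p s)}"

definition pattern_polytope :: "nat list set \<Rightarrow> (real ^ 'n::{finite,linorder}) set" where
  "pattern_polytope S = convex hull ((\<lambda>p. \<chi> i. real (p i)) ` avoiding_permutations S)"

section \<open>Ehrhart series\<close>

definition lattice_count :: "(real ^ 'n) set \<Rightarrow> nat \<Rightarrow> nat" where
  "lattice_count P m = card {x \<in> (\<lambda>v. real m *\<^sub>R v) ` P. \<forall>i. x $ i \<in> \<int>}"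

definition ehrhart_series :: "(real ^ 'n) set \<Rightarrow> real fps" where
  "ehrhart_series P = Abs_fps (\<lambda>m. real (lattice_count P m))"

text \<open>
  The exponent is the dimension of the ambient space.  For the polytopes above, which lie in a
  hyperplane, this is one more than the dimension of \<open>P\<close> when \<open>P\<close> has codimension one.
  The definite description is meaningful only if a polynomial with this property exists; it is
  then unique (\<open>hstar_poly_eqI\<close>).
\<close>

definition hstar_poly :: "(real ^ 'n) set \<Rightarrow> real poly" where
  "hstar_poly P = (THE H. fps_of_poly H = (1 - fps_X) ^ CARD('n) * ehrhart_series P)"

lemma hstar_poly_eqI:
  fixes P :: "(real ^ 'n) set"
  assumes "fps_of_poly H = (1 - fps_X) ^ CARD('n) * ehrhart_series P"
  shows "hstar_poly P = H"
  unfolding hstar_poly_def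
  by (rule the_equality) (use assms in \<open>auto simp flip: fps_of_poly_eq_iff\<close>)

section \<open>The series $K$ and the coordinates derived from it\<close>

text \<open>The polynomial $\binom{(1+y)n-1}{n-1}$ in $y$.\<close>

definition binom_poly :: "nat \<Rightarrow> real poly" where
  "binom_poly n = smult (1 / fact (n - 1)) (\<Prod>q = 1..n - 1. [:of_nat q, of_nat n:])"

lemma poly_binom_poly:
  assumes "n \<ge> 1"
  shows "poly (binom_poly n) y = ((1 + y) * of_nat n - 1) gchoose (n - 1)"
proof -
  have "(\<Prod>q = 1..n - 1. real q + y * real n)
      = (\<Prod>i = 0..<n - 1. (1 + y) * real n - 1 - real i)"
    by (rule prod.reindex_bij_witness[where i = "\<lambda>i. n - 1 - i" and j = "\<lambda>q. n - 1 - q"])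
       (use assms in \<open>auto simp: of_nat_diff algebra_simps\<close>)
  thus ?thesis
    by (simp add: binom_poly_def poly_prod gbinomial_prod_rev mult.commute)
qed

definition K_series :: "real poly fps" where
  "K_series = Abs_fps (\<lambda>d. if d = 0 then 0
         else smult (1 / (real d)\<^sup>2)
                (\<Sum>h | h dvd d. smult (real (totient h)) (binom_poly (d div h))))"

text \<open>
  The formal exponential $\sum_k F^k / k!$, for \<open>F\<close> without constant term, written as a
  composition because \<open>fps_exp\<close> requires coefficients in a field.
\<close>

definition fps_formal_exp :: "real poly fps \<Rightarrow> real poly fps" where
  "fps_formal_exp F = Abs_fps (\<lambda>k. [:1 / fact k:]) oo F"

definition C_coeff :: "nat \<Rightarrow> nat \<Rightarrow> real" where
  "C_coeff d q = coeff (fps_nth (fps_formal_exp K_series) d) q"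

definition eulerian_coord :: "nat \<Rightarrow> nat \<Rightarrow> real" where
  "eulerian_coord d j =
     (\<Sum>q = 0..j. (-1) ^ (j - q) * real ((d - 1 - q) choose (j - q)) * 2 ^ q * C_coeff d q)"

definition repaired_tail :: "nat \<Rightarrow> nat \<Rightarrow> real \<Rightarrow> real" where
  "repaired_tail d r c = (\<Sum>j = r..d - 2. c ^ (j - r) * eulerian_coord d j)"

section \<open>Zeros\<close>

definition only_real_negative_zeros :: "real poly \<Rightarrow> bool" where
  "only_real_negative_zeros p \<longleftrightarrow>
     (\<forall>z::complex. poly (map_poly of_real p) z = 0 \<longrightarrow> z \<in> \<real> \<and> Re z < 0)"

end

theory Submission
  imports Defs
begin

text \<open>
  The vertices of the polytope are the decreasing sequences of increasing runs.  Subtracting a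
  lattice point of its \<open>m\<close>-th dilate from \<open>m\<close> times the decreasing permutation gives an integer
  sequence with nonnegative prefix sums, total \<open>0\<close> and steps at least \<open>-2m\<close>: an excursion.  By the
  cycle lemma excursions are counted by the exponential of the generating function of cyclic
  sequences (bridges), which roots of unity identify with \<open>K\<close> at \<open>y = 2m\<close>.  Hence the Ehrhart
  polynomial is \<open>\<Sum>j. a_j m^j (m + 1)^(d - 1 - j)\<close>.

  With \<open>x = 1 / (1 - t)\<close> and \<open>D = x (x - 1) d/dx\<close> the Ehrhart series is the polynomial
  \<open>\<Sum>j. a_j D^j (D + 1)^(d - 1 - j) x\<close>, and all its zeros must be shown to lie in \<open>[0, 1]\<close>.  Dividing by
  \<open>(D + 1)^(d - 1) x\<close> and expanding in partial fractions reduces this, in the manner of Gauss--Lucas,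
  to the positivity of the residues.  At a zero of \<open>(D + 1)^(d - 1) x\<close> the values
  \<open>g_j = D^j (D + 1)^(d - 1 - j) x\<close> have a common sign and are log-concave by a Laguerre inequality for
  \<open>D\<close>, and the last ratio \<open>g_{d-2} / g_{d-3}\<close> is at least \<open>2 - sqrt 3\<close> by the ordinary Laguerre
  inequality; hence so are all ratios, and summation by parts against the tails gives the sign.
\<close>

section \<open>The coefficients of the formal exponential\<close>

text \<open>The constant comes from the last ratio. At an interior zero put
  \<open>F = D^(d-3) x\<close>, \<open>u = F\<close> and \<open>v = D F\<close>. There
  \<open>D (D F)\<close> vanishes, so \<open>g_{d-2} = v\<close> and
  \<open>g_{d-3} = u + 2 v\<close>. The Laguerre inequality gives \<open>u^2 <= 3 v^2\<close>, hence
  a ratio of at least \<open>1 / (2 + sqrt 3) = 2 - sqrt 3\<close>. Log-concavity makes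
  \<open>g_r / g_{r-1}\<close> decrease in \<open>r\<close>, so the last ratio bounds all of them,
  and the tails are the weights of the differences \<open>g_r - c g_{r-1}\<close>. The end
  coordinates stay outside this scheme. The polynomials \<open>(D + 1)^(d-1) x\<close> and
  \<open>D^(d-1) x\<close> are \<open>x^2\<close> and \<open>x (x - 1)\<close> times one common
  factor, so \<open>g_0\<close> and \<open>g_{d-1}\<close> vanish at every interior zero;
  \<open>a_0\<close> and \<open>a_{d-1}\<close> only appear as residues at the poles 1 and 0. On the
  counting side the bound \<open>-2m\<close> arises because an increasing run climbs by one where
  the decreasing permutation falls by one. The exponential enters through its differential equation:
  \<open>k [u^k] K\<close> counts bridges of length \<open>k\<close>, and
  \<open>(exp K)' = exp K K'\<close> is matched by marking a position in an excursion.\<close>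

definition C_poly :: "nat \<Rightarrow> real poly" where
  "C_poly d = fps_nth (fps_formal_exp K_series) d"

lemma fps_deriv_formal_exp:
  assumes "fps_nth F 0 = 0"
  shows "fps_deriv (fps_formal_exp F) = fps_formal_exp F * fps_deriv F"
proof -
  have "fps_deriv (Abs_fps (\<lambda>k. [:1 / fact k:] :: real poly)) = Abs_fps (\<lambda>k. [:1 / fact k:])"
    by (rule fps_ext) (simp add: of_nat_poly del: of_nat_Suc)
  then show ?thesis
    by (simp add: fps_formal_exp_def fps_compose_deriv assms)
qed

lemma K_series_0: "fps_nth K_series 0 = 0"
  by (simp add: K_series_def)

lemma C_poly_0: "C_poly 0 = 1"
  by (simp add: C_poly_def fps_formal_exp_def one_pCons)

text \<open>Coefficient comparison in \<open>(exp K)' = exp K K'\<close>. The number of excursions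
  is later shown to obey this same recurrence.\<close>

lemma C_poly_rec: "of_nat d * C_poly d = (\<Sum>i<d. C_poly i * (of_nat (d - i) * fps_nth K_series (d - i)))"
proof (cases d)
  case (Suc n)
  have "of_nat d * C_poly d = fps_nth (fps_deriv (fps_formal_exp K_series)) n"
    by (simp add: C_poly_def Suc)
  also have "\<dots> = (\<Sum>i=0..n. C_poly i * (of_nat (d - i) * fps_nth K_series (d - i)))"
    unfolding fps_deriv_formal_exp[OF K_series_0] fps_mult_nth
    by (rule sum.cong) (auto simp: C_poly_def Suc Suc_diff_le)
  finally show ?thesis by (simp add: Suc lessThan_Suc_atMost atLeast0AtMost)
qed simp

text \<open>Each term is determined by the earlier ones, so a count that satisfies the recurrence at
  one fixed \<open>y\<close> is already identified; no generating function of the counts has to be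
  formed.\<close>

lemma C_poly_unique:
  assumes "e 0 = 1"
    and "\<And>d. d \<ge> 1 \<Longrightarrow> real d * e d = (\<Sum>i<d. e i * (real (d - i) * poly (fps_nth K_series (d - i)) y))"
  shows "e d = poly (C_poly d) y"
proof (induction d rule: less_induct)
  case (less d)
  show ?case
  proof (cases "d = 0")
    case False
    have "real d * e d = poly (of_nat d * C_poly d) y"
      unfolding C_poly_rec poly_sum using False by (simp add: assms(2) less)
    then show ?thesis using False by simp
  qed (simp add: assms(1) C_poly_0)
qed

lemma degree_binom_poly: "degree (binom_poly n) \<le> n - 1"
proof -
  have "degree (\<Prod>q=1..n - 1. [:real q, real n:]) \<le> sum (degree \<circ> (\<lambda>q. [:real q, real n:])) {1..n - 1}"
    by (rule degree_prod_sum_le) simp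
  also have "\<dots> \<le> (\<Sum>q=1..n - 1. 1)" by (intro sum_mono) auto
  finally show ?thesis unfolding binom_poly_def by (auto intro: order.trans[OF degree_smult_le])
qed

lemma degree_K_series: "degree (fps_nth K_series d) \<le> d - 1"
proof -
  have "degree (binom_poly (d div h)) \<le> d - 1" for h
    using degree_binom_poly[of "d div h"] div_le_dividend[of d h] by linarith
  then show ?thesis
    unfolding K_series_def
    by (auto intro!: order.trans[OF degree_smult_le] degree_sum_le simp del: degree_smult_eq)
qed

text \<open>This bound is what allows an expansion in the \<open>d\<close> polynomials
  \<open>x^j (x + 1)^(d - 1 - j)\<close>.\<close>

lemma degree_C_poly: "degree (C_poly d) \<le> d - 1"
proof (induction d rule: less_induct)
  case (less d)
  show ?case
  proof (cases "d = 0")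
    case False
    have "C_poly d = smult (1 / real d) (of_nat d * C_poly d)"
      using False by (simp add: of_nat_poly)
    also have "degree \<dots> \<le> d - 1"
      unfolding C_poly_rec
    proof (intro order.trans[OF degree_smult_le] degree_sum_le)
      fix i assume "i \<in> {..<d}"
      have "degree (C_poly i * (of_nat (d - i) * fps_nth K_series (d - i)))
          \<le> degree (C_poly i) + (degree (of_nat (d - i) :: real poly) + degree (fps_nth K_series (d - i)))"
        by (rule order.trans[OF degree_mult_le]) (intro add_left_mono degree_mult_le)
      \<comment> \<open>For \<open>i = 0\<close> the truncated \<open>i - 1\<close> is
        \<open>0\<close>, and the second summand alone reaches \<open>d - 1\<close>.\<close>
      also have "\<dots> \<le> (i - 1) + (0 + (d - i - 1))"
        using less[of i] degree_K_series[of "d - i"] \<open>i \<in> {..<d}\<close>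
        by (intro add_mono) (auto simp del: of_nat_diff)
      also have "\<dots> \<le> d - 1" using \<open>i \<in> {..<d}\<close> by auto
      finally show "degree (C_poly i * (of_nat (d - i) * fps_nth K_series (d - i))) \<le> d - 1" .
    qed simp
    finally show ?thesis .
  qed (simp add: C_poly_0)
qed

text \<open>Binomial theorem for \<open>(- x + (x + 1))^N\<close>; it undoes the alternating
  binomials in \<open>eulerian_coord\<close>.\<close>

lemma binomial_collapse: "(\<Sum>i\<le>N. (-1) ^ i * real (N choose i) * (x ^ i * (x + 1) ^ (N - i))) = 1"
proof -
  have "(\<Sum>i\<le>N. (-1) ^ i * real (N choose i) * (x ^ i * (x + 1) ^ (N - i)))
      = (\<Sum>i\<le>N. of_nat (N choose i) * (- x) ^ i * (x + 1) ^ (N - i))"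
    by (rule sum.cong) (simp_all add: power_minus[of x])
  also have "\<dots> = (- x + (x + 1)) ^ N" by (rule binomial_ring[symmetric])
  finally show ?thesis by simp
qed

text \<open>Multiplying \<open>x^q\<close> by \<open>((x + 1) - x)^(n - q) = 1\<close> expands it in
  the basis \<open>x^j (x + 1)^(n - j)\<close>. The powers of two in the coordinates come from the
  argument \<open>2 * x\<close>.\<close>

lemma poly_C_poly_eulerian_coord:
  assumes "d = Suc n"
  shows "poly (C_poly d) (2 * x) = (\<Sum>j\<le>n. eulerian_coord d j * (x ^ j * (x + 1) ^ (n - j)))"
proof -
  define t where "t q = 2 ^ q * C_coeff d q" for q
  have "(\<Sum>j\<le>n. eulerian_coord d j * (x ^ j * (x + 1) ^ (n - j)))
      = (\<Sum>j\<le>n. \<Sum>q\<le>j. (-1) ^ (j - q) * real ((n - q) choose (j - q)) * t q * (x ^ j * (x + 1) ^ (n - j)))"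
    by (simp add: eulerian_coord_def assms t_def sum_distrib_right atLeast0AtMost mult.assoc)
  also have "\<dots> = (\<Sum>q\<le>n. \<Sum>j=q..n. (-1) ^ (j - q) * real ((n - q) choose (j - q)) * t q * (x ^ j * (x + 1) ^ (n - j)))"
    by (subst sum.Sigma, simp, simp, subst sum.Sigma, simp, simp,
        rule sum.reindex_bij_witness[where i = "\<lambda>(q, j). (j, q)" and j = "\<lambda>(j, q). (q, j)"]) auto
  also have "\<dots> = (\<Sum>q\<le>n. t q * x ^ q)"
  proof (rule sum.cong)
    fix q assume q: "q \<in> {..n}"
    have "(\<Sum>j=q..n. (-1) ^ (j - q) * real ((n - q) choose (j - q)) * t q * (x ^ j * (x + 1) ^ (n - j)))
        = (\<Sum>i\<le>n - q. (-1) ^ i * real ((n - q) choose i) * t q * (x ^ (q + i) * (x + 1) ^ (n - q - i)))"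
      by (rule sum.reindex_bij_witness[where i = "\<lambda>i. q + i" and j = "\<lambda>j. j - q"]) (use q in auto)
    also have "\<dots> = t q * x ^ q * (\<Sum>i\<le>n - q. (-1) ^ i * real ((n - q) choose i) * (x ^ i * (x + 1) ^ (n - q - i)))"
      by (simp add: sum_distrib_left power_add mult_ac)
    finally show "(\<Sum>j=q..n. (-1) ^ (j - q) * real ((n - q) choose (j - q)) * t q * (x ^ j * (x + 1) ^ (n - j))) = t q * x ^ q"
      unfolding binomial_collapse by simp
  qed simp
  also have "\<dots> = (\<Sum>q\<le>n. coeff (C_poly d) q * (2 * x) ^ q)"
    by (simp add: t_def C_coeff_def C_poly_def power_mult_distrib mult_ac)
  also have "\<dots> = (\<Sum>q\<le>degree (C_poly d). coeff (C_poly d) q * (2 * x) ^ q)"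
    using degree_C_poly[of d] assms
    by (intro sum.mono_neutral_right) (auto simp: coeff_eq_0)
  finally show ?thesis by (simp add: poly_altdef)
qed

section \<open>Complex evaluation of real polynomials\<close>

abbreviation cpoly :: "real poly \<Rightarrow> complex \<Rightarrow> complex" where
  "cpoly p z \<equiv> poly (map_poly of_real p) z"

lemma cpoly_pCons [simp]: "cpoly (pCons a p) z = of_real a + z * cpoly p z"
  by (cases "p = 0 \<and> a = 0") (auto simp: map_poly_pCons)

lemma cpoly_add [simp]: "cpoly (p + q) z = cpoly p z + cpoly q z"
proof (induction p arbitrary: q)
  case (pCons a p)
  show ?case
  proof (cases q)
    case (pCons b q')
    then show ?thesis using pCons.IH[of q'] by (simp add: algebra_simps)
  qed
qed simp

lemma cpoly_uminus [simp]: "cpoly (- p) z = - cpoly p z"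
  by (induction p) auto

lemma cpoly_diff [simp]: "cpoly (p - q) z = cpoly p z - cpoly q z"
  using cpoly_add[of p "- q" z] by simp

lemma cpoly_smult [simp]: "cpoly (smult c p) z = of_real c * cpoly p z"
  by (induction p) (auto simp: algebra_simps)

lemma cpoly_mult [simp]: "cpoly (p * q) z = cpoly p z * cpoly q z"
  by (induction p) (auto simp: algebra_simps)

lemma cpoly_power [simp]: "cpoly (p ^ n) z = cpoly p z ^ n"
  by (induction n) (auto simp: map_poly_1)

lemma cpoly_sum [simp]: "cpoly (\<Sum>i\<in>A. f i) z = (\<Sum>i\<in>A. cpoly (f i) z)"
  by (induction A rule: infinite_finite_induct) auto

lemma cpoly_of_real [simp]: "cpoly p (of_real x) = of_real (poly p x)"
  by (induction p) auto

section \<open>Polynomials with all roots in the unit interval\<close>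

declare mult_pCons_left [simp del] mult_pCons_right [simp del]

text \<open>Built from linear factors so that logarithmic derivatives and Laguerre forms can be
  treated one root at a time; \<open>unit_rootedI\<close> leads back from a statement on complex
  zeros.\<close>

inductive unit_rooted :: "real poly \<Rightarrow> bool" where
  const: "c \<noteq> 0 \<Longrightarrow> unit_rooted [:c:]"
| linear: "0 \<le> r \<Longrightarrow> r \<le> 1 \<Longrightarrow> unit_rooted p \<Longrightarrow> unit_rooted ([:- r, 1:] * p)"

lemma unit_rooted_nonzero: "unit_rooted p \<Longrightarrow> p \<noteq> 0"
  by (induction rule: unit_rooted.induct) auto

lemma unit_rooted_cpoly_roots:
  assumes "unit_rooted p" "cpoly p z = 0"
  shows "z \<in> of_real ` {0..1}"
  using assms
proof (induction rule: unit_rooted.induct)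
  case (linear r p)
  then show ?case by (auto simp: image_iff)
qed auto

lemma unit_rootedI:
  assumes "p \<noteq> 0" "\<And>z. cpoly p z = 0 \<Longrightarrow> z \<in> of_real ` {0..1}"
  shows "unit_rooted p"
  using assms
proof (induction "degree p" arbitrary: p)
  case 0
  then obtain c where "p = [:c:]" by (metis degree_0_id)
  with 0 show ?case by (auto intro: unit_rooted.const)
next
  case (Suc n)
  have "degree (map_poly complex_of_real p) = degree p"
    by (rule degree_map_poly) auto
  then have "\<not> constant (poly (map_poly complex_of_real p))"
    using Suc.hyps by (simp add: constant_degree)
  then obtain z where z: "cpoly p z = 0"
    using fundamental_theorem_of_algebra by blast
  from Suc.prems(2)[OF z] obtain r where r: "z = of_real r" "0 \<le> r" "r \<le> 1" by auto
  with z have "poly p r = 0" by simp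
  then obtain q where q: "p = [:- r, 1:] * q"
    by (auto simp: poly_eq_0_iff_dvd elim: dvdE)
  with Suc.prems have "q \<noteq> 0" by auto
  have "n = degree q"
    using Suc.hyps(2) \<open>q \<noteq> 0\<close> unfolding q by (subst (asm) degree_mult_eq) auto
  then have "unit_rooted q"
    using Suc.prems(2) \<open>q \<noteq> 0\<close> by (intro Suc.hyps(1)) (auto simp: q)
  then show ?case unfolding q using r by (intro unit_rooted.linear) auto
qed

text \<open>The Gauss--Lucas argument for the interval \<open>[0, 1]\<close>: all the terms \<open>1 / (z - r)\<close> of the
  logarithmic derivative lie in a common open half plane.\<close>

lemma half_plane_direction:
  assumes "z \<notin> of_real ` {0..1}"
  obtains u where "\<And>r. 0 \<le> r \<Longrightarrow> r \<le> 1 \<Longrightarrow> Re (u / (z - of_real r)) > 0"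
proof -
  have *: "\<exists>u. \<forall>r. 0 \<le> r \<and> r \<le> 1 \<longrightarrow> Re (u * cnj (z - of_real r)) > 0"
  proof (cases "Im z = 0")
    case True
    then have "z = of_real (Re z)" by (simp add: complex_eq_iff)
    with assms have "Re z < 0 \<or> Re z > 1" by (metis atLeastAtMost_iff image_eqI not_less)
    then show ?thesis
    proof
      assume "Re z < 0"
      then show ?thesis by (intro exI[of _ "-1"]) auto
    next
      assume "Re z > 1"
      then show ?thesis by (intro exI[of _ 1]) auto
    qed
  next
    case False
    \<comment> \<open>With \<open>z = x + i y\<close> the product \<open>i y (x - r - i y)\<close>
      has real part \<open>y^2\<close>, whatever \<open>r\<close> is.\<close>
    then show ?thesis
      by (intro exI[of _ "\<i> * of_real (Im z)"]) (auto simp flip: power2_eq_square)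
  qed
  then obtain u where u: "\<And>r. 0 \<le> r \<Longrightarrow> r \<le> 1 \<Longrightarrow> Re (u * cnj (z - of_real r)) > 0" by blast
  have "Re (u / (z - of_real r)) > 0" if "0 \<le> r" "r \<le> 1" for r
  proof -
    have "z - of_real r \<noteq> 0" using assms that by (auto simp: image_iff)
    then have "(cmod (z - of_real r))\<^sup>2 > 0" by simp
    then show ?thesis
      using u[OF that] by (subst complex_div_cnj) (simp only: Re_divide_of_real zero_less_divide_iff; simp)
  qed
  then show ?thesis using that by blast
qed

lemma log_deriv_half_plane:
  assumes "unit_rooted p" "z \<notin> of_real ` {0..1}"
    and "\<And>r. 0 \<le> r \<Longrightarrow> r \<le> 1 \<Longrightarrow> Re (u / (z - of_real r)) > 0"
  shows "Re (u * cpoly (pderiv p) z / cpoly p z) \<ge> 0 \<and>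
    (degree p > 0 \<longrightarrow> Re (u * cpoly (pderiv p) z / cpoly p z) > 0)"
  using assms(1)
proof (induction rule: unit_rooted.induct)
  case (const c)
  then show ?case by simp
next
  case (linear r p)
  have nz: "cpoly p z \<noteq> 0" using unit_rooted_cpoly_roots linear assms(2) by blast
  have nz2: "z - of_real r \<noteq> 0" using linear assms(2) by (auto simp: image_iff)
  have "u * cpoly (pderiv ([:- r, 1:] * p)) z / cpoly ([:- r, 1:] * p) z
      = u * cpoly (pderiv p) z / cpoly p z + u / (z - of_real r)"
    using nz nz2 by (simp only: pderiv_mult cpoly_add cpoly_mult)
      (simp add: pderiv_pCons field_simps)
  moreover have "Re (u / (z - of_real r)) > 0" using assms(3) linear by auto
  ultimately show ?case using linear.IH by (simp only: plus_complex.simps) linarith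
qed

lemma unit_rooted_pderiv:
  assumes "unit_rooted p" "degree p > 0"
  shows "unit_rooted (pderiv p)"
proof (rule unit_rootedI)
  show "pderiv p \<noteq> 0" using assms by (simp add: pderiv_eq_0_iff)
next
  fix z assume z: "cpoly (pderiv p) z = 0"
  show "z \<in> of_real ` {0..1}"
  proof (rule ccontr)
    assume n: "z \<notin> of_real ` {0..1}"
    then obtain u where "\<And>r. 0 \<le> r \<Longrightarrow> r \<le> 1 \<Longrightarrow> Re (u / (z - of_real r)) > 0"
      using half_plane_direction by blast
    from log_deriv_half_plane[OF assms(1) n this] assms(2) z show False by simp
  qed
qed

text \<open>In the coordinate \<open>x = 1 / (1 - t)\<close> the operator \<open>t d/dt\<close> becomes \<open>x (x - 1) d/dx\<close>.\<close>

definition xder :: "real poly \<Rightarrow> real poly" where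
  "xder p = [:0, -1, 1:] * pderiv p"

lemma xder_add: "xder (p + q) = xder p + xder q"
  by (simp add: xder_def pderiv_add algebra_simps)

lemma xder_mult: "xder (p * q) = p * xder q + q * xder p"
  by (simp add: xder_def pderiv_mult algebra_simps)

lemma poly_xder: "poly (xder p) x = x * (x - 1) * poly (pderiv p) x"
  by (simp add: xder_def algebra_simps)

lemma coeff_xder_top:
  assumes "degree p \<le> k"
  shows "coeff (xder p) (Suc k) = real k * coeff p k"
proof -
  have "xder p = pCons 0 (pCons 0 (pderiv p)) - pCons 0 (pderiv p)"
    by (simp add: xder_def mult_pCons_left)
  then show ?thesis
    using assms by (cases k) (auto simp: coeff_pderiv coeff_eq_0)
qed

lemma unit_rooted_xder:
  assumes "unit_rooted p" "degree p > 0"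
  shows "unit_rooted (xder p)"
proof -
  have "unit_rooted ([:- 0, 1:] * ([:- 1, 1:] * pderiv p))"
    using unit_rooted_pderiv[OF assms] by (intro unit_rooted.linear) auto
  then show ?thesis
    by (simp add: xder_def mult_pCons_left algebra_simps)
qed

section \<open>Laguerre inequalities\<close>

text \<open>For a derivation \<open>D\<close> this is \<open>- p^2 D (D p / p)\<close>. Logarithmic
  derivatives add over products, which is the source of the product rule below.\<close>

definition laguerre_form :: "(real poly \<Rightarrow> real poly) \<Rightarrow> real poly \<Rightarrow> real poly" where
  "laguerre_form D p = (D p)\<^sup>2 - p * D (D p)"

lemma laguerre_form_mult:
  assumes "\<And>p q. D (p * q) = p * D q + q * D p" "\<And>p q. D (p + q) = D p + D q"
  shows "laguerre_form D (p * q) = p\<^sup>2 * laguerre_form D q + q\<^sup>2 * laguerre_form D p"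
  by (simp add: laguerre_form_def assms power2_eq_square algebra_simps)

lemmas laguerre_form_pderiv_mult =
  laguerre_form_mult[of pderiv, OF pderiv_mult pderiv_add]

lemmas laguerre_form_xder_mult =
  laguerre_form_mult[of xder, OF xder_mult xder_add]

lemma laguerre_pderiv:
  assumes "unit_rooted p"
  shows "poly (laguerre_form pderiv p) x \<ge> 0"
  using assms
proof (induction rule: unit_rooted.induct)
  case (const c)
  then show ?case by (simp add: laguerre_form_def)
next
  case (linear r p)
  have "poly (laguerre_form pderiv [:- r, 1:]) x = 1"
    by (simp add: laguerre_form_def pderiv_pCons)
  then show ?case
    using linear by (simp add: laguerre_form_pderiv_mult)
qed

text \<open>The contribution of one root. Its sign on \<open>0 < x < 1\<close> uses
  \<open>r (1 - r) >= 0\<close>, that is, a root in the unit interval.\<close>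

lemma laguerre_xder_linear:
  "poly (laguerre_form xder [:- r, 1:]) x = x * (1 - x) * ((x - r)\<^sup>2 + r * (1 - r))"
  by (simp add: laguerre_form_def xder_def pderiv_pCons pderiv_mult power2_eq_square algebra_simps)

lemma laguerre_xder:
  assumes "unit_rooted p" "0 < x" "x < 1"
  shows "poly (laguerre_form xder p) x \<ge> 0"
  using assms(1)
proof (induction rule: unit_rooted.induct)
  case (const c)
  then show ?case by (simp add: laguerre_form_def xder_def)
next
  case (linear r p)
  have "poly (laguerre_form xder [:- r, 1:]) x \<ge> 0"
    unfolding laguerre_xder_linear using assms linear by auto
  then show ?case
    using linear by (simp add: laguerre_form_xder_mult)
qed

text \<open>A single root \<open>r\<close> different from \<open>x\<close> contributes a positive
  amount, and the cofactor cannot cancel it.\<close>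

lemma laguerre_xder_strict:
  assumes "unit_rooted p" "0 < x" "x < 1" "degree p > 0" "poly p x \<noteq> 0"
  shows "poly (laguerre_form xder p) x > 0"
  using assms(1,4,5)
proof (cases rule: unit_rooted.cases)
  case (linear r q)
  with assms(5) have nz: "poly q x \<noteq> 0" "x \<noteq> r" by auto
  have "poly (laguerre_form xder [:- r, 1:]) x > 0"
    unfolding laguerre_xder_linear using assms linear nz
    by (intro mult_pos_pos add_pos_nonneg) auto
  then have "0 < (poly q x)\<^sup>2 * poly (laguerre_form xder [:- r, 1:]) x"
    using nz by simp
  moreover have "0 \<le> (x - r)\<^sup>2 * poly (laguerre_form xder q) x"
    using laguerre_xder linear assms by simp
  ultimately show ?thesis
    unfolding linear laguerre_form_xder_mult by (simp add: add_nonneg_pos power2_commute)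
qed simp

text \<open>Common zeros of \<open>D p\<close> and \<open>D (D p)\<close> annihilate the Laguerre
  form and so descend to \<open>p\<close>; this drives the induction that separates the zeros of
  consecutive \<open>mixed_eulerian\<close> polynomials.\<close>

lemma no_common_zero_xder:
  assumes "unit_rooted p" "0 < x" "x < 1" "degree p > 0"
    and "poly (xder p) x = 0" "poly (xder (xder p)) x = 0"
  shows "poly p x = 0"
  using laguerre_xder_strict[OF assms(1-4)] assms(5,6)
  by (auto simp: laguerre_form_def)

text \<open>The ordinary Laguerre inequality for the cofactor of \<open>x (x - 1)\<close> in \<open>p\<close>.\<close>

lemma laguerre_inflection:
  assumes "p = [:0, -1, 1:] * q" "unit_rooted q" "0 < x" "x < 1"
    and "poly (xder (xder p)) x = 0"
  shows "(poly p x)\<^sup>2 \<le> 3 * (poly (xder p) x)\<^sup>2"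
proof -
  define f m u v where "f = x * (x - 1)" "m = 2 * x - 1" "u = poly p x" "v = poly (xder p) x"
  note defs = this
  define G where "G = poly q x"
  have fnz: "f \<noteq> 0" using assms by (simp add: defs)
  have uG: "u = f * G" by (simp add: defs G_def assms(1) algebra_simps)
  have v: "v = f * poly (pderiv p) x" by (simp add: defs poly_xder)
  have "poly (xder (xder p)) x = f * (m * poly (pderiv p) x + f * poly (pderiv (pderiv p)) x)"
    by (simp add: xder_def defs pderiv_mult pderiv_pCons algebra_simps)
  with assms(5) fnz have w: "f * poly (pderiv (pderiv p)) x = - m * poly (pderiv p) x" by simp
  \<comment> \<open>The extra factor \<open>x (x - 1)\<close> strengthens the inequality:
    \<open>m^2 - 2 f\<close> equals \<open>(1 + m^2) / 2\<close> because
    \<open>4 f = m^2 - 1\<close>.\<close>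
  have "poly (laguerre_form pderiv [:0, -1, 1:]) x = (1 + m\<^sup>2) / 2"
    by (simp add: laguerre_form_def pderiv_pCons defs power2_eq_square field_simps)
  then have "poly (laguerre_form pderiv p) x = f\<^sup>2 * poly (laguerre_form pderiv q) x + G\<^sup>2 * ((1 + m\<^sup>2) / 2)"
    unfolding assms(1) laguerre_form_pderiv_mult
    by (simp only: poly_add poly_mult poly_power) (simp add: defs G_def algebra_simps)
  then have "poly (laguerre_form pderiv p) x \<ge> G\<^sup>2 * ((1 + m\<^sup>2) / 2)"
    using laguerre_pderiv[OF assms(2), of x] by simp
  then have "f\<^sup>2 * (G\<^sup>2 * ((1 + m\<^sup>2) / 2)) \<le> f\<^sup>2 * poly (laguerre_form pderiv p) x"
    by (intro mult_left_mono) auto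
  also have "\<dots> = v\<^sup>2 - u * f * (f * poly (pderiv (pderiv p)) x)"
    by (simp add: laguerre_form_def v defs(3) power2_eq_square algebra_simps)
  also have "\<dots> = v\<^sup>2 + m * u * v"
    unfolding w v by simp
  finally have "u\<^sup>2 * (1 + m\<^sup>2) \<le> 2 * v\<^sup>2 + 2 * (m * u * v)"
    unfolding uG by (simp add: power_mult_distrib)
  \<comment> \<open>The mixed term is absorbed so that \<open>m^2 u^2\<close> cancels; what remains
    is the factor 3, independent of \<open>x\<close>.\<close>
  also have "2 * (m * u * v) \<le> (m * u)\<^sup>2 + v\<^sup>2"
    using sum_squares_bound[of "m * u" v] by (simp add: mult.assoc)
  finally have "u\<^sup>2 \<le> 3 * v\<^sup>2" by (simp add: power_mult_distrib algebra_simps)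
  then show ?thesis by (simp add: defs)
qed

section \<open>The polynomials with generating coefficients \<open>m ^ a * (m + 1) ^ b\<close>\<close>

definition xder1 :: "real poly \<Rightarrow> real poly" where
  "xder1 p = xder p + p"

text \<open>The seed \<open>[:0, 1:]\<close> stands for \<open>1 / (1 - t)\<close>, all of whose
  coefficients are 1; the two operators multiply the \<open>m\<close>-th coefficient by
  \<open>m\<close> and by \<open>m + 1\<close>.\<close>

definition mixed_eulerian :: "nat \<Rightarrow> nat \<Rightarrow> real poly" where
  "mixed_eulerian a b = (xder ^^ a) ((xder1 ^^ b) [:0, 1:])"

text \<open>The Eulerian polynomial in the coordinate \<open>x\<close>: after
  \<open>x = 1 / (1 - t)\<close> it is \<open>A(t) / (1 - t)^k\<close> with
  \<open>t A(t) / (1 - t)^(k + 2)\<close> the series of \<open>m^(k + 1) t^m\<close>. It is the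
  common factor of the two ends of a row, \<open>D^(k + 1) x\<close> and
  \<open>(D + 1)^(k + 1) x\<close>.\<close>

primrec eulerian_core :: "nat \<Rightarrow> real poly" where
  "eulerian_core 0 = 1"
| "eulerian_core (Suc k) = pderiv ([:0, -1, 1:] * eulerian_core k)"

lemma unit_rooted_x_x1: "unit_rooted p \<Longrightarrow> unit_rooted ([:0, -1, 1:] * p)"
  using unit_rooted.linear[of 0, OF _ _ unit_rooted.linear[of 1 p]]
  by (simp add: mult_pCons_left algebra_simps)

lemma degree_x_x1:
  fixes p :: "real poly"
  shows "p \<noteq> 0 \<Longrightarrow> degree ([:0, -1, 1:] * p) = Suc (Suc (degree p))"
  by (subst degree_mult_eq) auto

lemma eulerian_core:
  shows unit_rooted_eulerian_core: "unit_rooted (eulerian_core k)"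
    and degree_eulerian_core: "degree (eulerian_core k) = k"
proof -
  have "unit_rooted (eulerian_core k) \<and> degree (eulerian_core k) = k"
  proof (induction k)
    case 0
    then show ?case using unit_rooted.const[of 1] by (simp add: one_pCons)
  next
    case (Suc k)
    then have "degree ([:0, -1, 1:] * eulerian_core k) = Suc (Suc k)"
      using degree_x_x1[OF unit_rooted_nonzero] by simp
    moreover have "unit_rooted ([:0, -1, 1:] * eulerian_core k)"
      using Suc unit_rooted_x_x1 by blast
    ultimately show ?case
      by (simp only: eulerian_core.simps degree_pderiv) (simp add: unit_rooted_pderiv)
  qed
  then show "unit_rooted (eulerian_core k)" "degree (eulerian_core k) = k" by auto
qed

lemma poly_eulerian_core_0_1: "poly (eulerian_core k) 0 \<noteq> 0" "poly (eulerian_core k) 1 \<noteq> 0"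
proof -
  have "poly (eulerian_core k) 0 = (- 1) ^ k \<and> poly (eulerian_core k) 1 = 1"
    by (induction k) (simp_all add: pderiv_mult pderiv_pCons power_commutes)
  then show "poly (eulerian_core k) 0 \<noteq> 0" "poly (eulerian_core k) 1 \<noteq> 0" by auto
qed

lemma xder_power_X: "(xder ^^ Suc k) [:0, 1:] = [:0, -1, 1:] * eulerian_core k"
proof (induction k)
  case (Suc k)
  have "(xder ^^ Suc (Suc k)) [:0, 1:] = xder ((xder ^^ Suc k) [:0, 1:])" by simp
  also have "\<dots> = [:0, -1, 1:] * eulerian_core (Suc k)" unfolding Suc by (simp add: xder_def)
  finally show ?case .
qed (simp add: xder_def pderiv_pCons)

lemma xder1_power_X: "(xder1 ^^ Suc k) [:0, 1:] = [:0, 0, 1:] * eulerian_core k"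
proof (induction k)
  case (Suc k)
  have *: "xder1 ([:0, 0, 1:] * q) = [:0, 0, 1:] * pderiv ([:0, -1, 1:] * q)" for q
    by (rule poly_ext) (simp add: xder1_def xder_def pderiv_mult pderiv_pCons algebra_simps)
  have "(xder1 ^^ Suc (Suc k)) [:0, 1:] = xder1 ((xder1 ^^ Suc k) [:0, 1:])" by simp
  then show ?case unfolding Suc * eulerian_core.simps(2) .
qed (simp add: xder1_def xder_def pderiv_pCons mult_pCons_left)

lemma mixed_eulerian_0_0 [simp]: "mixed_eulerian 0 0 = [:0, 1:]"
  by (simp add: mixed_eulerian_def)

lemma mixed_eulerian_Suc_left: "mixed_eulerian (Suc a) b = xder (mixed_eulerian a b)"
  by (simp add: mixed_eulerian_def)

lemma mixed_eulerian_Suc_right: "mixed_eulerian a (Suc b) = xder1 (mixed_eulerian a b)"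
proof -
  have "(xder ^^ a) (xder1 p) = xder1 ((xder ^^ a) p)" for p
    by (induction a) (simp_all add: xder1_def xder_add)
  then show ?thesis by (simp add: mixed_eulerian_def)
qed

lemma mixed_eulerian_diff:
  "mixed_eulerian a (Suc b) - mixed_eulerian (Suc a) b = mixed_eulerian a b"
  by (simp add: mixed_eulerian_Suc_left mixed_eulerian_Suc_right xder1_def)

lemma mixed_eulerian_Suc_0: "mixed_eulerian (Suc k) 0 = [:0, -1, 1:] * eulerian_core k"
  using xder_power_X[of k] by (simp only: mixed_eulerian_def funpow_0)

lemma mixed_eulerian_0_Suc: "mixed_eulerian 0 (Suc k) = [:0, 0, 1:] * eulerian_core k"
  using xder1_power_X[of k] by (simp only: mixed_eulerian_def funpow_0)

lemma mixed_eulerian: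
  shows unit_rooted_mixed_eulerian: "unit_rooted (mixed_eulerian a b)"
    and degree_mixed_eulerian: "degree (mixed_eulerian a b) = Suc (a + b)"
proof -
  have "unit_rooted (mixed_eulerian a b) \<and> degree (mixed_eulerian a b) = Suc (a + b)"
  proof (induction a)
    case 0
    show ?case
    proof (cases b)
      case 0
      have "unit_rooted ([:- 0, 1:] * [:1:])"
        by (intro unit_rooted.intros) auto
      then show ?thesis using 0 by (simp add: mult_pCons_left)
    next
      case (Suc k)
      have "unit_rooted ([:- 0, 1:] * ([:- 0, 1:] * eulerian_core k))"
        by (intro unit_rooted.linear unit_rooted_eulerian_core) auto
      moreover have "[:- 0, 1:] * ([:- 0, 1:] * eulerian_core k) = [:0, 0, 1:] * eulerian_core k"
        by (simp add: mult_pCons_left)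
      ultimately have "unit_rooted ([:0, 0, 1:] * eulerian_core k)" by (simp only:)
      moreover have "degree ([:0, 0, 1:] * eulerian_core k) = Suc (Suc k)"
        using unit_rooted_nonzero[OF unit_rooted_eulerian_core, of k]
        by (subst degree_mult_eq) (auto simp: degree_eulerian_core)
      ultimately show ?thesis unfolding Suc mixed_eulerian_0_Suc by simp
    qed
  next
    case (Suc a)
    have "pderiv (mixed_eulerian a b) \<noteq> 0"
      using Suc by (simp add: pderiv_eq_0_iff)
    then have "degree (xder (mixed_eulerian a b)) = Suc (Suc a + b)"
      unfolding xder_def by (subst degree_x_x1) (use Suc in \<open>auto simp: degree_pderiv\<close>)
    then show ?case
      using Suc unit_rooted_xder[of "mixed_eulerian a b"] by (simp add: mixed_eulerian_Suc_left)
  qed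
  then show "unit_rooted (mixed_eulerian a b)" "degree (mixed_eulerian a b) = Suc (a + b)" by auto
qed

text \<open>Applied to a multiple of \<open>x^2\<close>, the operator \<open>D\<close> supplies the
  factor \<open>x - 1\<close>; afterwards it preserves divisibility by
  \<open>x^2 (x - 1)\<close>.\<close>

lemma dvd_mixed_eulerian: "[:0, 0, -1, 1:] dvd mixed_eulerian (Suc a) (Suc b)"
proof (induction a)
  case 0
  have "xder ([:0, 0, 1:] * q) = [:0, 0, -1, 1:] * (smult 2 q + [:0, 1:] * pderiv q)" for q
    by (rule poly_ext) (simp add: xder_def pderiv_mult pderiv_pCons algebra_simps)
  then show ?case
    unfolding mixed_eulerian_Suc_left[of 0] mixed_eulerian_0_Suc by (metis dvd_triv_left)
next
  case (Suc a)
  have "xder ([:0, 0, -1, 1:] * q) = [:0, 0, -1, 1:] * ([:-2, 3:] * q + [:0, -1, 1:] * pderiv q)" for q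
    by (rule poly_ext) (simp add: xder_def pderiv_mult pderiv_pCons algebra_simps)
  then show ?case
    using Suc unfolding mixed_eulerian_Suc_left[of "Suc a"] by (metis dvdE dvd_triv_left)
qed

text \<open>Common zeros descend in \<open>a\<close>, down to \<open>a = 0\<close>. There a common
  zero is a double zero of \<open>eulerian_core k\<close>, hence also of \<open>x (x - 1)\<close>
  times it, and this is the already excluded case \<open>b = 0\<close>.\<close>

lemma mixed_eulerian_no_common_zero:
  assumes "0 < x" "x < 1"
  shows "\<not> (poly (mixed_eulerian a b) x = 0 \<and> poly (mixed_eulerian (Suc a) b) x = 0)"
proof -
  have step: "\<not> (poly (mixed_eulerian (Suc a) b) x = 0 \<and> poly (mixed_eulerian (Suc (Suc a)) b) x = 0)"
    if "\<not> (poly (mixed_eulerian a b) x = 0 \<and> poly (mixed_eulerian (Suc a) b) x = 0)" for a b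
    using no_common_zero_xder[OF unit_rooted_mixed_eulerian[of a b] assms] that
    by (auto simp: degree_mixed_eulerian mixed_eulerian_Suc_left)
  have zero: "\<not> (poly (mixed_eulerian a 0) x = 0 \<and> poly (mixed_eulerian (Suc a) 0) x = 0)" for a
    by (induction a) (use step assms in auto)
  show ?thesis
  proof (induction a)
    case 0
    show ?case
    proof (cases b)
      case 0
      then show ?thesis using assms by simp
    next
      case (Suc k)
      show ?thesis
      proof
        assume *: "poly (mixed_eulerian 0 b) x = 0 \<and> poly (mixed_eulerian (Suc 0) b) x = 0"
        then have k0: "poly (eulerian_core k) x = 0"
          using assms by (simp add: Suc mixed_eulerian_0_Suc)
        have "poly (xder ([:0, 0, 1:] * eulerian_core k)) x = 0"
          using * by (simp add: Suc mixed_eulerian_Suc_left mixed_eulerian_0_Suc)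
        then have "poly (pderiv (eulerian_core k)) x = 0"
          using k0 assms by (simp add: poly_xder pderiv_mult)
        then have "poly (xder ([:0, -1, 1:] * eulerian_core k)) x = 0"
          using k0 by (simp add: poly_xder pderiv_mult)
        then have "poly (mixed_eulerian (Suc (Suc k)) 0) x = 0"
          using mixed_eulerian_Suc_left[of "Suc k" 0] unfolding mixed_eulerian_Suc_0[of k] by simp
        moreover have "poly (mixed_eulerian (Suc k) 0) x = 0"
          using k0 by (simp add: mixed_eulerian_Suc_0)
        ultimately show False using zero by blast
      qed
    qed
  qed (use step in auto)
qed

lemma laguerre_mixed_eulerian:
  assumes "0 < x" "x < 1"
  shows "poly (laguerre_form xder (mixed_eulerian a b)) x > 0"
proof (cases "poly (mixed_eulerian a b) x = 0")
  case True
  then have "poly (xder (mixed_eulerian a b)) x \<noteq> 0"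
    using mixed_eulerian_no_common_zero[OF assms, of a b] by (simp add: mixed_eulerian_Suc_left)
  with True show ?thesis by (simp add: laguerre_form_def)
next
  case False
  then show ?thesis
    using laguerre_xder_strict[OF unit_rooted_mixed_eulerian assms] by (simp add: degree_mixed_eulerian)
qed

text \<open>With \<open>p = mixed_eulerian a b\<close> the three values are those of
  \<open>(D + 1)^2 p\<close>, \<open>D (D + 1) p\<close> and \<open>D^2 p\<close>; the discriminant
  does not change under the shift by 1 and is the Laguerre form of \<open>p\<close>.\<close>

lemma mixed_eulerian_log_concave:
  assumes "0 < x" "x < 1"
  shows "poly (mixed_eulerian a (Suc (Suc b))) x * poly (mixed_eulerian (Suc (Suc a)) b) x
    < (poly (mixed_eulerian (Suc a) (Suc b)) x)\<^sup>2"
  using laguerre_mixed_eulerian[OF assms, of a b]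
  by (simp add: laguerre_form_def mixed_eulerian_Suc_left mixed_eulerian_Suc_right xder1_def xder_add
      power2_eq_square algebra_simps)

section \<open>Sign changes\<close>

text \<open>Zeros count for either sign, and \<open>k = 0\<close> or \<open>k > n\<close> describes
  a sequence without any change.\<close>

definition one_sign_change :: "(nat \<Rightarrow> real) \<Rightarrow> nat \<Rightarrow> bool" where
  "one_sign_change f n \<longleftrightarrow> (\<exists>s k. (s = 1 \<or> s = -1) \<and>
     (\<forall>j\<le>n. (j < k \<longrightarrow> s * f j \<ge> 0) \<and> (k \<le> j \<longrightarrow> s * f j \<le> 0)))"

lemma decreasing_stepsD:
  fixes f :: "nat \<Rightarrow> real"
  assumes "a \<le> b" "\<And>j. a \<le> j \<Longrightarrow> j < b \<Longrightarrow> f (Suc j) \<le> f j"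
  shows "f b \<le> f a"
  using assms
proof (induction rule: dec_induct)
  case (step n)
  then show ?case using order.trans[of "f (Suc n)" "f n" "f a"] by auto
qed simp

text \<open>A discrete Rolle argument: \<open>h\<close> is the negated difference of
  \<open>g\<close>, so one sign change of \<open>h\<close> makes \<open>g\<close>, up to sign, fall
  until \<open>k\<close> and rise afterwards.\<close>

lemma sum_sign_pattern:
  assumes "one_sign_change h n" "\<And>j. j \<le> n \<Longrightarrow> g j - g (Suc j) = h j"
  shows "\<exists>s k. (s = 1 \<or> s = -1) \<and>
    (\<forall>i j. i \<le> j \<longrightarrow> j \<le> k \<longrightarrow> j \<le> Suc n \<longrightarrow> s * g j \<le> s * g i) \<and>
    (\<forall>i j. k \<le> i \<longrightarrow> i \<le> j \<longrightarrow> j \<le> Suc n \<longrightarrow> s * g i \<le> s * g j)"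
proof -
  obtain s k where s: "s = 1 \<or> s = -1"
    and h: "\<And>j. j \<le> n \<Longrightarrow> j < k \<Longrightarrow> s * h j \<ge> 0" "\<And>j. j \<le> n \<Longrightarrow> k \<le> j \<Longrightarrow> s * h j \<le> 0"
    using assms(1) unfolding one_sign_change_def by auto
  have g: "s * g (Suc j) = s * g j - s * h j" if "j \<le> n" for j
    using assms(2)[OF that] by (simp flip: right_diff_distrib)
  have "s * g j \<le> s * g i" if "i \<le> j" "j \<le> k" "j \<le> Suc n" for i j
    using that(1) by (rule decreasing_stepsD) (use that h(1) g in auto)
  moreover have "- (s * g j) \<le> - (s * g i)" if "k \<le> i" "i \<le> j" "j \<le> Suc n" for i j
    using that(2) by (rule decreasing_stepsD[where f = "\<lambda>j. - (s * g j)"]) (use that h(2) g in auto)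
  ultimately show ?thesis using s by (intro exI[of _ s] exI[of _ k]) auto
qed

text \<open>A valley could cross zero twice; end values of opposite weak sign leave room for one
  crossing only.\<close>

lemma one_sign_change_step:
  assumes "one_sign_change h n" "\<And>j. j \<le> n \<Longrightarrow> g j - g (Suc j) = h j"
    and "g (Suc n) = - y * g 0" "y \<ge> 0"
  shows "one_sign_change g (Suc n)"
proof -
  from sum_sign_pattern[of h n g, OF assms(1,2)] obtain s k where s: "s = 1 \<or> s = -1"
    and dec': "\<forall>i j. i \<le> j \<longrightarrow> j \<le> k \<longrightarrow> j \<le> Suc n \<longrightarrow> s * g j \<le> s * g i"
    and inc': "\<forall>i j. k \<le> i \<longrightarrow> i \<le> j \<longrightarrow> j \<le> Suc n \<longrightarrow> s * g i \<le> s * g j"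
    by blast
  note dec = dec'[rule_format] and inc = inc'[rule_format]
  have last: "s * g (Suc n) = - (y * (s * g 0))" using assms(3) by simp
  show ?thesis
  proof (cases "s * g 0 \<ge> 0")
    case True
    with last assms(4) have l: "s * g (Suc n) \<le> 0" by simp
    define k' where "k' = (LEAST j. s * g j \<le> 0)"
    have k': "s * g k' \<le> 0" "k' \<le> Suc n"
      using LeastI[of "\<lambda>j. s * g j \<le> 0", OF l] Least_le[of "\<lambda>j. s * g j \<le> 0", OF l]
      by (auto simp: k'_def)
    have "s * g j \<ge> 0" if "j < k'" for j
      using not_less_Least[of j "\<lambda>j. s * g j \<le> 0"] that by (auto simp: k'_def)
    \<comment> \<open>Beyond \<open>k'\<close> the sequence either still falls from a value below
      zero or already rises towards the last one, which is not positive.\<close>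
    moreover have "s * g j \<le> 0" if "k' \<le> j" "j \<le> Suc n" for j
      using dec[of k' j] inc[of j "Suc n"] that k' l by linarith
    ultimately show ?thesis unfolding one_sign_change_def using s by blast
  next
    case False
    then have neg: "s * g 0 < 0" by simp
    then have l: "s * g (Suc n) \<ge> 0"
      unfolding last using mult_nonneg_nonpos[OF assms(4), of "s * g 0"] by simp
    define k' where "k' = (LEAST j. s * g j \<ge> 0)"
    have k': "s * g k' \<ge> 0" "k' \<le> Suc n"
      using LeastI[of "\<lambda>j. s * g j \<ge> 0", OF l] Least_le[of "\<lambda>j. s * g j \<ge> 0", OF l]
      by (auto simp: k'_def)
    have "s * g j \<le> 0" if "j < k'" for j
      using not_less_Least[of j "\<lambda>j. s * g j \<ge> 0"] that by (auto simp: k'_def)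
    \<comment> \<open>Falling from a negative start keeps the sequence negative, so zero is reached
      only on the rising part.\<close>
    moreover have "k < k'" using dec[of 0 k'] k' neg by fastforce
    then have "s * g j \<ge> 0" if "k' \<le> j" "j \<le> Suc n" for j
      using inc[of k' j] that k' by linarith
    ultimately show ?thesis unfolding one_sign_change_def
      by (intro exI[of _ "- s"] exI[of _ k']) (use s in auto)
  qed
qed

text \<open>A valley between two zeros stays below zero.\<close>

lemma one_sign_step:
  assumes "one_sign_change h n" "\<And>j. j \<le> n \<Longrightarrow> g j - g (Suc j) = h j"
    and "g 0 = 0" "g (Suc n) = 0"
  obtains s :: real where "s = 1 \<or> s = -1" "\<And>j. j \<le> Suc n \<Longrightarrow> s * g j \<ge> 0"
proof -
  from sum_sign_pattern[of h n g, OF assms(1,2)] obtain s k where s: "s = 1 \<or> s = -1"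
    and dec': "\<forall>i j. i \<le> j \<longrightarrow> j \<le> k \<longrightarrow> j \<le> Suc n \<longrightarrow> s * g j \<le> s * g i"
    and inc': "\<forall>i j. k \<le> i \<longrightarrow> i \<le> j \<longrightarrow> j \<le> Suc n \<longrightarrow> s * g i \<le> s * g j"
    by blast
  note dec = dec'[rule_format] and inc = inc'[rule_format]
  have "- s * g j \<ge> 0" if "j \<le> Suc n" for j
    using dec[of 0 j] inc[of j "Suc n"] that assms(3,4) by (cases "j \<le> k") auto
  then show ?thesis using that[of "- s"] s by auto
qed

lemma mixed_eulerian_one_sign_change:
  assumes "0 < x" "x < 1"
  shows "one_sign_change (\<lambda>j. poly (mixed_eulerian j (n - j)) x) n"
proof (induction n)
  case 0
  show ?case unfolding one_sign_change_def
    by (intro exI[of _ 1]) (use assms in auto)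
next
  case (Suc n)
  show ?case
  \<comment> \<open>The ends of the row are \<open>x (x - 1)\<close> and \<open>x^2\<close> times
    the same core; their quotient gives the factor \<open>(1 - x) / x\<close>.\<close>
  proof (rule one_sign_change_step[OF Suc, of _ "(1 - x) / x"])
    show "poly (mixed_eulerian j (Suc n - j)) x - poly (mixed_eulerian (Suc j) (Suc n - Suc j)) x =
      poly (mixed_eulerian j (n - j)) x" if "j \<le> n" for j
      using that mixed_eulerian_diff[of j "n - j"]
      by (simp add: Suc_diff_le flip: poly_diff)
    show "poly (mixed_eulerian (Suc n) (Suc n - Suc n)) x =
      - ((1 - x) / x) * poly (mixed_eulerian 0 (Suc n - 0)) x"
      using assms by (simp add: mixed_eulerian_Suc_0 mixed_eulerian_0_Suc field_simps)
    show "(1 - x) / x \<ge> 0" using assms by simp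
  qed
qed

section \<open>Interior values at the zeros of the Eulerian polynomial\<close>

text \<open>Here \<open>n\<close> plays the role of \<open>d - 2\<close>, since
  \<open>(D + 1)^(n + 1) x\<close> is \<open>x^2\<close> times
  \<open>eulerian_core n\<close>.\<close>

locale eulerian_zero =
  fixes n :: nat and \<alpha> :: real
  assumes n: "n \<ge> 1" and root: "poly (eulerian_core n) \<alpha> = 0"
begin

lemma root_bounds: "0 < \<alpha>" "\<alpha> < 1"
proof -
  have "cpoly (eulerian_core n) (of_real \<alpha>) = 0" using root by simp
  then have "complex_of_real \<alpha> \<in> of_real ` {0..1}"
    by (rule unit_rooted_cpoly_roots[OF unit_rooted_eulerian_core])
  then have "0 \<le> \<alpha>" "\<alpha> \<le> 1" by auto
  moreover have "\<alpha> \<noteq> 0" "\<alpha> \<noteq> 1" using root poly_eulerian_core_0_1 by auto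
  ultimately show "0 < \<alpha>" "\<alpha> < 1" by auto
qed

definition g :: "nat \<Rightarrow> real" where
  "g j = poly (mixed_eulerian j (Suc n - j)) \<alpha>"

lemma g_0 [simp]: "g 0 = 0"
  by (simp add: g_def mixed_eulerian_0_Suc root)

lemma g_last [simp]: "g (Suc n) = 0"
  by (simp add: g_def mixed_eulerian_Suc_0 root)

lemma g_log_concave:
  assumes "1 \<le> r" "r \<le> n"
  shows "g (r - 1) * g (Suc r) < (g r)\<^sup>2"
proof -
  obtain a where a: "r = Suc a" using assms by (cases r) auto
  define b where "b = n - r"
  have "n = Suc (a + b)" using assms a by (simp add: b_def)
  then show ?thesis
    using mixed_eulerian_log_concave[OF root_bounds, of a b]
    unfolding g_def by (simp add: a Suc_diff_le)
qed

lemma poly_mixed_eulerian_n: "poly (xder (mixed_eulerian n 0)) \<alpha> = 0"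
  using mixed_eulerian_Suc_0[of n] root by (simp add: mixed_eulerian_Suc_left)

lemma g_n: "g n = poly (mixed_eulerian n 0) \<alpha>"
  using poly_mixed_eulerian_n by (simp add: g_def mixed_eulerian_Suc_right xder1_def)

text \<open>For \<open>p = D^n x\<close> the zero means \<open>D p = 0\<close>, so the Laguerre form
  gives \<open>p D^2 p < 0\<close>, and \<open>D^2 p\<close> is a positive multiple of the
  derivative of the core. This ties the sign of the \<open>g j\<close> to the denominator of the
  residue, and the zero is seen to be simple.\<close>

lemma g_n_sign: "g n * poly (pderiv (eulerian_core n)) \<alpha> < 0"
proof -
  have "poly (xder (xder (mixed_eulerian n 0))) \<alpha>
      = \<alpha>\<^sup>2 * (\<alpha> - 1)\<^sup>2 * poly (pderiv (eulerian_core n)) \<alpha>"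
    unfolding mixed_eulerian_Suc_left[symmetric] mixed_eulerian_Suc_0[of n] mixed_eulerian_Suc_left[of "Suc n"]
    by (simp add: poly_xder pderiv_mult root power2_eq_square algebra_simps)
  moreover have "g n * poly (xder (xder (mixed_eulerian n 0))) \<alpha> < 0"
    using laguerre_mixed_eulerian[OF root_bounds, of n 0] poly_mixed_eulerian_n
    by (simp add: laguerre_form_def g_n)
  ultimately have "(\<alpha>\<^sup>2 * (\<alpha> - 1)\<^sup>2) * (g n * poly (pderiv (eulerian_core n)) \<alpha>) < 0"
    by (simp add: mult_ac)
  then show ?thesis by (simp add: mult_less_0_iff zero_less_mult_iff)
qed

lemma simple_root: "poly (pderiv (eulerian_core n)) \<alpha> \<noteq> 0"
  using g_n_sign by auto

text \<open>The vanishing ends give a common weak sign. An interior zero \<open>g j = 0\<close>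
  would contradict the strict log-concavity, as the product of its neighbours is not
  negative.\<close>

lemma g_positive:
  obtains s :: real where "s = 1 \<or> s = -1" "\<And>j. 1 \<le> j \<Longrightarrow> j \<le> n \<Longrightarrow> s * g j > 0"
proof -
  have "g j - g (Suc j) = poly (mixed_eulerian j (n - j)) \<alpha>" if "j \<le> n" for j
    using that mixed_eulerian_diff[of j "n - j"]
    by (simp add: g_def Suc_diff_le flip: poly_diff)
  then obtain s :: real where s: "s = 1 \<or> s = -1" "\<And>j. j \<le> Suc n \<Longrightarrow> s * g j \<ge> 0"
    using one_sign_step[OF mixed_eulerian_one_sign_change[OF root_bounds], of n g] g_0 g_last by blast
  have "s * g j > 0" if j: "1 \<le> j" "j \<le> n" for j
  proof -
    have "0 \<le> (s * g (j - 1)) * (s * g (Suc j))"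
      by (rule mult_nonneg_nonneg; rule s(2)) (use j in auto)
    also have "\<dots> = g (j - 1) * g (Suc j)" using s(1) by auto
    also have "\<dots> < (g j)\<^sup>2" by (rule g_log_concave[OF j])
    finally have "s * g j \<noteq> 0" using s(1) by auto
    moreover have "s * g j \<ge> 0" using s(2) j by auto
    ultimately show ?thesis by linarith
  qed
  with s(1) show ?thesis using that by blast
qed

lemma last_ratio:
  assumes "n \<ge> 2" "s = 1 \<or> s = -1" "s * g n > 0" "s * g (n - 1) > 0"
  shows "s * g n \<ge> (2 - sqrt 3) * (s * g (n - 1))"
proof -
  obtain k where k: "n = Suc (Suc k)" using assms(1) by (metis Suc_le_D numeral_2_eq_2 Suc_le_mono)
  define F where "F = mixed_eulerian (Suc k) 0"
  define u v where "u = s * poly F \<alpha>" and "v = s * poly (xder F) \<alpha>"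
  have w: "poly (xder (xder F)) \<alpha> = 0"
    using poly_mixed_eulerian_n by (simp add: F_def k mixed_eulerian_Suc_left)
  have "mixed_eulerian n 0 = xder F" by (simp only: k F_def mixed_eulerian_Suc_left)
  then have gn: "s * g n = v" by (simp only: g_n v_def)
  have "g (n - 1) = poly (mixed_eulerian (Suc k) (Suc (Suc 0))) \<alpha>"
    unfolding g_def by (simp add: k Suc_diff_le)
  also have "\<dots> = 2 * poly (xder F) \<alpha> + poly F \<alpha>"
    using w by (simp add: mixed_eulerian_Suc_right xder1_def xder_add flip: F_def)
  finally have gn1: "s * g (n - 1) = 2 * v + u" by (simp add: u_def v_def algebra_simps)
  have "(poly F \<alpha>)\<^sup>2 \<le> 3 * (poly (xder F) \<alpha>)\<^sup>2"
    by (rule laguerre_inflection[OF _ unit_rooted_eulerian_core root_bounds w])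
      (simp only: F_def mixed_eulerian_Suc_0)
  then have "u\<^sup>2 \<le> 3 * v\<^sup>2" using assms(2) by (auto simp: u_def v_def)
  then have "sqrt (u\<^sup>2) \<le> sqrt (3 * v\<^sup>2)" by (rule real_sqrt_le_mono)
  then have "u \<le> sqrt 3 * v" using assms(3) gn by (simp add: real_sqrt_mult)
  moreover have "2 - sqrt 3 \<ge> 0" by (simp add: real_le_lsqrt)
  ultimately have "(2 - sqrt 3) * (2 * v + u) \<le> (2 - sqrt 3) * (2 * v + sqrt 3 * v)"
    by (intro mult_left_mono) auto
  also have "\<dots> = (4 - (sqrt 3)\<^sup>2) * v" by (simp add: power2_eq_square algebra_simps)
  also have "\<dots> = v" by simp
  finally show ?thesis unfolding gn gn1 .
qed

text \<open>Log-concavity carries a lower bound on the ratio at \<open>r + 1\<close> down to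
  \<open>r\<close>. The products avoid a division by \<open>g 0 = 0\<close>.\<close>

lemma ratios:
  assumes "s = 1 \<or> s = -1" "\<And>j. 1 \<le> j \<Longrightarrow> j \<le> n \<Longrightarrow> s * g j > 0"
    and "1 \<le> r" "r \<le> n"
  shows "s * g r \<ge> (2 - sqrt 3) * (s * g (r - 1))"
  using assms(4,3)
proof (induction rule: inc_induct)
  case base
  show ?case
  proof (cases "n - 1 = 0")
    case True
    show ?thesis unfolding True g_0 using assms(2)[OF n order.refl] by simp
  next
    case False
    then show ?thesis using n assms(2)[of n] assms(2)[of "n - 1"] by (intro last_ratio assms(1)) auto
  qed
next
  case (step r)
  define f where "f j = s * g j" for j
  have IH: "(2 - sqrt 3) * f r \<le> f (Suc r)" using step by (simp add: f_def)
  have pos: "f r > 0" using assms(2)[of r] step by (simp add: f_def)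
  have nonneg: "f (r - 1) \<ge> 0"
  proof (cases "r - 1 = 0")
    case True
    show ?thesis unfolding True f_def by simp
  next
    case False
    then show ?thesis using assms(2)[of "r - 1"] step by (simp add: f_def less_imp_le)
  qed
  have "f r * ((2 - sqrt 3) * f (r - 1)) = f (r - 1) * ((2 - sqrt 3) * f r)" by simp
  also have "\<dots> \<le> f (r - 1) * f (Suc r)" by (rule mult_left_mono[OF IH nonneg])
  also have "\<dots> = g (r - 1) * g (Suc r)" using assms(1) by (auto simp: f_def)
  also have "\<dots> \<le> (g r)\<^sup>2" using g_log_concave[of r] step by simp
  also have "\<dots> = f r * f r" using assms(1) by (auto simp: f_def power2_eq_square)
  finally have "(2 - sqrt 3) * f (r - 1) \<le> f r" using pos by (simp only: mult_le_cancel_left_pos)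
  then show ?case by (simp only: f_def)
qed

end

text \<open>Abel summation turns the sum into that of \<open>S r * (f r - c * f (r - 1))\<close>;
  the conditions at \<open>0\<close> and \<open>Suc m\<close> remove the boundary terms.\<close>

lemma tail_summation_nonneg:
  fixes S f :: "nat \<Rightarrow> real"
  assumes "\<And>r. 1 \<le> r \<Longrightarrow> r \<le> m \<Longrightarrow> S r \<ge> 0" "S (Suc m) = 0" "f 0 = 0"
    and "\<And>r. 1 \<le> r \<Longrightarrow> r \<le> m \<Longrightarrow> f r \<ge> c * f (r - 1)"
  shows "(\<Sum>j=1..m. (S j - c * S (Suc j)) * f j) \<ge> 0"
proof -
  have "(\<Sum>j=1..k. (S j - c * S (Suc j)) * f j)
      = (\<Sum>r=1..k. S r * (f r - c * f (r - 1))) - c * S (Suc k) * f k" for k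
    by (induction k) (auto simp: assms(3) algebra_simps)
  moreover have "(\<Sum>r=1..m. S r * (f r - c * f (r - 1))) \<ge> 0"
    using assms by (intro sum_nonneg mult_nonneg_nonneg) auto
  ultimately show ?thesis using assms(2) by simp
qed

definition tail_sum :: "real \<Rightarrow> (nat \<Rightarrow> real) \<Rightarrow> nat \<Rightarrow> nat \<Rightarrow> real" where
  "tail_sum c a m r = (\<Sum>j=r..m. c ^ (j - r) * a j)"

lemma tail_sum_rec:
  assumes "r \<le> m"
  shows "a r = tail_sum c a m r - c * tail_sum c a m (Suc r)"
proof -
  have "(\<Sum>j=Suc r..m. c ^ (j - r) * a j) = c * tail_sum c a m (Suc r)"
    unfolding tail_sum_def sum_distrib_left
    by (rule sum.cong) (auto simp: Suc_diff_Suc simp flip: power_Suc mult.assoc)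
  then show ?thesis
    using sum.atLeast_Suc_atMost[OF assms, of "\<lambda>j. c ^ (j - r) * a j"] by (simp add: tail_sum_def)
qed

lemma tail_sum_summation_nonneg:
  assumes "\<And>r. 1 \<le> r \<Longrightarrow> r \<le> m \<Longrightarrow> tail_sum c a m r \<ge> 0" "f 0 = 0"
    and "\<And>r. 1 \<le> r \<Longrightarrow> r \<le> m \<Longrightarrow> f r \<ge> c * f (r - 1)"
  shows "(\<Sum>j=1..m. a j * f j) \<ge> 0"
proof -
  have "(\<Sum>j=1..m. a j * f j) = (\<Sum>j=1..m. (tail_sum c a m j - c * tail_sum c a m (Suc j)) * f j)"
    by (intro sum.cong) (auto simp flip: tail_sum_rec)
  also have "\<dots> \<ge> 0"
    by (intro tail_summation_nonneg assms) (auto simp: tail_sum_def)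
  finally show ?thesis .
qed

text \<open>The derivative of the core has the sign opposite to that of the \<open>g j\<close>, and
  the negative factor \<open>\<alpha> - 1\<close> restores it.\<close>

lemma (in eulerian_zero) interior_combination_sign:
  assumes "\<And>r. 1 \<le> r \<Longrightarrow> r \<le> n \<Longrightarrow> tail_sum (2 - sqrt 3) a n r \<ge> 0"
  shows "(\<Sum>j=1..n. a j * g j) / ((\<alpha> - 1) * poly (pderiv (eulerian_core n)) \<alpha>) \<ge> 0"
proof -
  obtain s :: real where s: "s = 1 \<or> s = -1" and pos: "\<And>j. 1 \<le> j \<Longrightarrow> j \<le> n \<Longrightarrow> s * g j > 0"
    using g_positive by blast
  have "(\<Sum>j=1..n. a j * (s * g j)) \<ge> 0"
    by (intro tail_sum_summation_nonneg[where c = "2 - sqrt 3"] assms ratios s pos) auto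
  then have num: "s * (\<Sum>j=1..n. a j * g j) \<ge> 0"
    by (simp add: sum_distrib_left mult_ac)
  have "s * poly (pderiv (eulerian_core n)) \<alpha> < 0"
  proof -
    have "(s * g n) * (s * poly (pderiv (eulerian_core n)) \<alpha>) < 0" using g_n_sign s by auto
    then show ?thesis
      using pos[OF n order.refl] by (metis mult_less_0_iff not_less_iff_gr_or_eq)
  qed
  then have "(\<alpha> - 1) * (s * poly (pderiv (eulerian_core n)) \<alpha>) > 0"
    using root_bounds by (intro mult_neg_neg) auto
  then have "(s * (\<Sum>j=1..n. a j * g j)) / ((\<alpha> - 1) * (s * poly (pderiv (eulerian_core n)) \<alpha>)) \<ge> 0"
    by (rule divide_nonneg_pos[OF num])
  also have "(s * (\<Sum>j=1..n. a j * g j)) / ((\<alpha> - 1) * (s * poly (pderiv (eulerian_core n)) \<alpha>))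
      = (\<Sum>j=1..n. a j * g j) / ((\<alpha> - 1) * poly (pderiv (eulerian_core n)) \<alpha>)"
    using s by auto
  finally show ?thesis .
qed

section \<open>Partial fractions\<close>

lemma card_roots_unit_rooted:
  assumes "unit_rooted p" "\<And>x. poly p x = 0 \<Longrightarrow> poly (pderiv p) x \<noteq> 0"
  shows "card {x. poly p x = 0} = degree p"
  using assms
proof (induction rule: unit_rooted.induct)
  case (linear r p)
  have nz: "p \<noteq> 0" using unit_rooted_nonzero linear by auto
  have "poly (pderiv ([:- r, 1:] * p)) r = poly p r" by (simp add: pderiv_mult pderiv_pCons)
  then have r: "poly p r \<noteq> 0" using linear.prems[of r] by simp
  have "poly (pderiv p) x \<noteq> 0" if "poly p x = 0" for x
    using linear.prems[of x] that by (simp add: pderiv_mult pderiv_pCons)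
  then have IH: "card {x. poly p x = 0} = degree p" using linear.IH by blast
  have "{x. poly ([:- r, 1:] * p) x = 0} = insert r {x. poly p x = 0}" by auto
  moreover have "degree ([:- r, 1:] * p) = Suc (degree p)"
    using nz by (subst degree_mult_eq) auto
  ultimately show ?case using r IH poly_roots_finite[OF nz] by simp
qed simp

text \<open>Lagrange interpolation of \<open>K\<close> at the simple real zeros of \<open>P\<close>,
  divided by \<open>P\<close>.\<close>

lemma partial_fractions_cpoly:
  fixes P K :: "real poly"
  assumes "card {x. poly P x = 0} = degree P" "P \<noteq> 0"
    and "\<And>x. poly P x = 0 \<Longrightarrow> poly (pderiv P) x \<noteq> 0"
    and "degree K < degree P" "cpoly P z \<noteq> 0"
  shows "cpoly K z / cpoly P z =
    (\<Sum>x | poly P x = 0. of_real (poly K x / poly (pderiv P) x) / (z - of_real x))"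
proof -
  define A where "A = {x. poly P x = 0}"
  define Q where "Q x = P div [:- x, 1:]" for x
  have fin: "finite A" unfolding A_def by (rule poly_roots_finite[OF assms(2)])
  have Q: "P = [:- x, 1:] * Q x" if "x \<in> A" for x
    using that by (simp add: A_def Q_def poly_eq_0_iff_dvd)
  have Q_self: "poly (Q x) x = poly (pderiv P) x" if "x \<in> A" for x
  proof -
    have "pderiv P = pderiv ([:- x, 1:] * Q x)" using Q[OF that] by simp
    then show ?thesis by (simp add: pderiv_mult pderiv_pCons)
  qed
  have Q_other: "poly (Q x) y = 0" if "x \<in> A" "y \<in> A" "x \<noteq> y" for x y
  proof -
    have "poly P y = (y - x) * poly (Q x) y" by (subst Q[OF that(1)]) simp
    then show ?thesis using that by (auto simp: A_def)
  qed
  have degQ: "degree (Q x) < degree P" if "x \<in> A" for x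
  proof -
    have "Q x \<noteq> 0" using Q[OF that] assms(2) by auto
    then have "degree ([:- x, 1:] * Q x) = Suc (degree (Q x))" by (subst degree_mult_eq) auto
    then show ?thesis using Q[OF that] by simp
  qed
  have "K = (\<Sum>x\<in>A. smult (poly K x / poly (pderiv P) x) (Q x))"
  proof (rule poly_eqI_degree[where A = A])
    fix y assume y: "y \<in> A"
    have "poly (\<Sum>x\<in>A. smult (poly K x / poly (pderiv P) x) (Q x)) y
        = (\<Sum>x\<in>A. if x = y then poly K y else 0)"
      unfolding poly_sum
      by (rule sum.cong) (use y Q_self Q_other assms(3) in \<open>auto simp: A_def\<close>)
    then show "poly K y = poly (\<Sum>x\<in>A. smult (poly K x / poly (pderiv P) x) (Q x)) y"
      using fin y by simp
  next
    show "degree K < card A" using assms by (simp add: A_def)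
    show "degree (\<Sum>x\<in>A. smult (poly K x / poly (pderiv P) x) (Q x)) < card A"
      using assms(1,4) degQ le_less_trans[OF degree_smult_le degQ]
      by (intro degree_sum_less) (auto simp flip: A_def)
  qed
  then have "cpoly K z = (\<Sum>x\<in>A. of_real (poly K x / poly (pderiv P) x) * cpoly (Q x) z)"
    by (metis (no_types, lifting) cpoly_smult cpoly_sum sum.cong)
  moreover have "cpoly (Q x) z = cpoly P z / (z - of_real x)" if "x \<in> A" for x
  proof -
    have "cpoly P z = (z - of_real x) * cpoly (Q x) z" by (subst Q[OF that]) simp
    then show ?thesis using assms(5) by auto
  qed
  ultimately have "cpoly K z = (\<Sum>x\<in>A. of_real (poly K x / poly (pderiv P) x) * (cpoly P z / (z - of_real x)))"
    by simp
  then show ?thesis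
    using assms(5) by (simp add: A_def sum_divide_distrib)
qed

section \<open>Combinations with nonnegative tails\<close>

definition mixed_combination :: "(nat \<Rightarrow> real) \<Rightarrow> nat \<Rightarrow> real poly" where
  "mixed_combination a n = (\<Sum>j\<le>n. smult (a j) (mixed_eulerian j (n - j)))"

lemma degree_mixed_combination: "degree (mixed_combination a n) \<le> Suc n"
  unfolding mixed_combination_def
  by (intro degree_sum_le) (auto intro: order.trans[OF degree_smult_le] simp: degree_mixed_eulerian)

lemma sum_split_ends:
  fixes f :: "nat \<Rightarrow> 'a::comm_monoid_add"
  shows "(\<Sum>j\<le>Suc n. f j) = f 0 + f (Suc n) + (\<Sum>j=1..n. f j)"
proof -
  have "{..Suc n} = insert 0 (insert (Suc n) {1..n})" by auto
  then show ?thesis by (simp add: add.assoc)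
qed

text \<open>The interior terms share the factor \<open>x^2 (x - 1)\<close>, the end terms share the
  core. Removing a factor of degree 3 from degree \<open>n + 2\<close> leaves a degree below
  \<open>n\<close>, as partial fractions over the core require.\<close>

lemma mixed_combination_split:
  assumes "n \<ge> 1"
  obtains K where "(\<Sum>j=1..n. smult (a j) (mixed_eulerian j (Suc n - j))) = [:0, 0, -1, 1:] * K"
    "degree K < n"
    "mixed_combination a (Suc n) = smult (a 0) ([:0, 0, 1:] * eulerian_core n)
      + smult (a (Suc n)) ([:0, -1, 1:] * eulerian_core n) + [:0, 0, -1, 1:] * K"
proof -
  define I where "I = (\<Sum>j=1..n. smult (a j) (mixed_eulerian j (Suc n - j)))"
  have "[:0, 0, -1, 1:] dvd I"
    unfolding I_def
  proof (intro dvd_sum dvd_smult)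
    fix j assume "j \<in> {1..n}"
    then obtain i where "j = Suc i" "Suc n - j = Suc (n - j)" by (cases j) (auto simp: Suc_diff_le)
    then show "[:0, 0, -1, 1:] dvd mixed_eulerian j (Suc n - j)"
      using dvd_mixed_eulerian by metis
  qed
  then obtain K where K: "I = [:0, 0, -1, 1:] * K" by (rule dvdE)
  have "degree I \<le> n + 2"
    unfolding I_def
    by (intro degree_sum_le) (auto intro: order.trans[OF degree_smult_le] simp: degree_mixed_eulerian)
  then have "degree K < n"
  proof (cases "K = 0")
    case False
    then have "degree ([:0, 0, -1, 1:] * K) = 3 + degree K"
      by (subst degree_mult_eq) auto
    then show ?thesis using K \<open>degree I \<le> n + 2\<close> by simp
  qed (use assms in simp)
  moreover have "mixed_combination a (Suc n) = smult (a 0) ([:0, 0, 1:] * eulerian_core n)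
      + smult (a (Suc n)) ([:0, -1, 1:] * eulerian_core n) + I"
    unfolding mixed_combination_def sum_split_ends I_def
    by (simp add: mixed_eulerian_0_Suc mixed_eulerian_Suc_0)
  ultimately show ?thesis using that[of K] K by (simp add: I_def)
qed

text \<open>After division by \<open>z\<^sup>2 (z - 1)\<close> times the Eulerian polynomial, the combination becomes a sum of
  nonnegative multiples of \<open>1 / (z - r)\<close> with \<open>0 \<le> r \<le> 1\<close>, which vanishes nowhere off \<open>[0, 1]\<close>.\<close>

lemma mixed_combination_nonzero:
  assumes "n \<ge> 1" "a 0 > 0" "a (Suc n) \<ge> 0"
    and "\<And>r. 1 \<le> r \<Longrightarrow> r \<le> n \<Longrightarrow> tail_sum (2 - sqrt 3) a n r \<ge> 0"
    and z: "z \<notin> of_real ` {0..1}"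
  shows "cpoly (mixed_combination a (Suc n)) z \<noteq> 0"
proof
  assume zero: "cpoly (mixed_combination a (Suc n)) z = 0"
  define P where "P = eulerian_core n"
  obtain K where K: "(\<Sum>j=1..n. smult (a j) (mixed_eulerian j (Suc n - j))) = [:0, 0, -1, 1:] * K"
    "degree K < n"
    "mixed_combination a (Suc n) = smult (a 0) ([:0, 0, 1:] * P)
      + smult (a (Suc n)) ([:0, -1, 1:] * P) + [:0, 0, -1, 1:] * K"
    using mixed_combination_split[OF assms(1), of a] unfolding P_def by blast
  have loc: "eulerian_zero n x" if "poly P x = 0" for x
    using that assms(1) by unfold_locales (auto simp: P_def)
  have simple: "poly (pderiv P) x \<noteq> 0" if "poly P x = 0" for x
    using eulerian_zero.simple_root[OF loc[OF that]] by (simp add: P_def)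
  have bounds: "0 < x \<and> x < 1" if "poly P x = 0" for x
    using eulerian_zero.root_bounds[OF loc[OF that]] by simp
  have P: "unit_rooted P" "degree P = n"
    by (simp_all add: P_def unit_rooted_eulerian_core degree_eulerian_core)
  have Pz: "cpoly P z \<noteq> 0" using unit_rooted_cpoly_roots[OF P(1)] z by blast
  have z01: "z \<noteq> 0" "z \<noteq> 1" using z by (auto simp: image_iff intro: bexI[of _ 0] bexI[of _ 1])
  define \<kappa> where "\<kappa> x = poly K x / poly (pderiv P) x" for x
  have \<kappa>: "\<kappa> x \<ge> 0" if "poly P x = 0" for x
  proof -
    interpret eulerian_zero n x by (rule loc[OF that])
    have "poly ([:0, 0, -1, 1:] * K) x = (\<Sum>j=1..n. a j * g j)"
      unfolding K(1)[symmetric] poly_sum g_def by simp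
    then have "(\<Sum>j=1..n. a j * g j) = x\<^sup>2 * ((x - 1) * poly K x)"
      by (simp add: power2_eq_square algebra_simps)
    \<comment> \<open>Up to the positive factor \<open>x^2\<close>, the residue is the quotient
      whose sign comes from the tails.\<close>
    then have "0 \<le> x\<^sup>2 * ((x - 1) * poly K x) / ((x - 1) * poly (pderiv P) x)"
      using interior_combination_sign[of a] assms(4) by (simp add: P_def)
    also have "\<dots> = x\<^sup>2 * \<kappa> x"
      using bounds[OF that] by (simp add: \<kappa>_def)
    finally show ?thesis using bounds[OF that] by (simp add: zero_le_mult_iff)
  qed
  have pf: "cpoly K z / cpoly P z = (\<Sum>x | poly P x = 0. of_real (\<kappa> x) / (z - of_real x))"
    unfolding \<kappa>_def using card_roots_unit_rooted[OF P(1) simple] P unit_rooted_nonzero[OF P(1)] simple K(2) Pz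
    by (intro partial_fractions_cpoly) auto
  have "0 = cpoly (mixed_combination a (Suc n)) z / (z\<^sup>2 * (z - 1) * cpoly P z)"
    using zero by simp
  also have "cpoly (mixed_combination a (Suc n)) z
      = of_real (a 0) * z\<^sup>2 * cpoly P z + of_real (a (Suc n)) * z * (z - 1) * cpoly P z
        + z\<^sup>2 * (z - 1) * cpoly K z"
    unfolding K(3) by (simp add: power2_eq_square algebra_simps)
  also have "\<dots> / (z\<^sup>2 * (z - 1) * cpoly P z)
      = of_real (a 0) / (z - 1) + of_real (a (Suc n)) / z + cpoly K z / cpoly P z"
    using z01 Pz by (simp add: field_simps power2_eq_square)
  finally have sum0: "of_real (a 0) / (z - 1) + of_real (a (Suc n)) / z
      + (\<Sum>x | poly P x = 0. of_real (\<kappa> x) / (z - of_real x)) = 0"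
    unfolding pf by simp
  obtain u where u: "\<And>r. 0 \<le> r \<Longrightarrow> r \<le> 1 \<Longrightarrow> Re (u / (z - of_real r)) > 0"
    using half_plane_direction[OF z] by blast
  have term_eq: "Re (u * (of_real c / (z - of_real r))) = c * Re (u / (z - of_real r))" for c r
  proof -
    have "u * (of_real c / (z - of_real r)) = of_real c * (u / (z - of_real r))" by simp
    then show ?thesis by (simp only: times_complex.sel Re_complex_of_real Im_complex_of_real mult_zero_left diff_zero)
  qed
  have "0 = Re (u * (of_real (a 0) / (z - of_real 1) + of_real (a (Suc n)) / (z - of_real 0)
      + (\<Sum>x | poly P x = 0. of_real (\<kappa> x) / (z - of_real x))))"
    using sum0 by simp
  also have "\<dots> = a 0 * Re (u / (z - of_real 1)) + a (Suc n) * Re (u / (z - of_real 0))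
      + (\<Sum>x | poly P x = 0. \<kappa> x * Re (u / (z - of_real x)))"
    by (simp only: distrib_left sum_distrib_left plus_complex.sel Re_sum term_eq)
  \<comment> \<open>Strictness comes from the pole at 1, because \<open>a 0 > 0\<close>.\<close>
  also have "\<dots> > 0"
  proof (intro add_pos_nonneg mult_pos_pos mult_nonneg_nonneg sum_nonneg)
    fix x assume "x \<in> {x. poly P x = 0}"
    then show "\<kappa> x \<ge> 0" "Re (u / (z - of_real x)) \<ge> 0"
      using \<kappa>[of x] u[of x] bounds[of x] by auto
  qed (use assms u[of 1] u[of 0] in auto)
  finally show False by simp
qed

section \<open>The numerator of the Ehrhart series\<close>

text \<open>Substitutes the series \<open>1 / (1 - t)\<close> for \<open>x\<close>; as its constant
  term is not zero, this is evaluation of a polynomial and not composition of series.\<close>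

definition fps_eval :: "real poly \<Rightarrow> real fps" where
  "fps_eval p = poly (map_poly fps_const p) (inverse (1 - fps_X))"

lemma fps_eval_pCons [simp]:
  "fps_eval (pCons a p) = fps_const a + inverse (1 - fps_X) * fps_eval p"
  by (cases "p = 0 \<and> a = 0") (auto simp: fps_eval_def map_poly_pCons)

lemma fps_eval_0 [simp]: "fps_eval 0 = 0"
  by (simp add: fps_eval_def)

lemma fps_eval_add [simp]: "fps_eval (p + q) = fps_eval p + fps_eval q"
proof (induction p arbitrary: q)
  case (pCons a p)
  show ?case
  proof (cases q)
    case (pCons b q')
    then show ?thesis using pCons.IH[of q'] by (simp add: algebra_simps flip: fps_const_add)
  qed
qed simp

lemma fps_eval_smult [simp]: "fps_eval (smult c p) = fps_const c * fps_eval p"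
  by (induction p) (auto simp: algebra_simps simp flip: fps_const_mult)

lemma fps_eval_sum [simp]: "fps_eval (\<Sum>i\<in>A. f i) = (\<Sum>i\<in>A. fps_eval (f i))"
  by (induction A rule: infinite_finite_induct) auto

lemma fps_eval_mult [simp]: "fps_eval (p * q) = fps_eval p * fps_eval q"
  by (induction p) (auto simp: mult_pCons_left distrib_right mult.assoc)

lemma fps_eval_xder: "fps_eval (xder p) = fps_X * fps_deriv (fps_eval p)"
proof (induction p)
  case (pCons a p)
  define G :: "real fps" where "G = inverse (1 - fps_X)"
  have inv: "(1 - fps_X) * G = 1" unfolding G_def by (rule inverse_mult_eq_1') simp
  then have XG: "fps_X * G = G - 1" by (simp add: algebra_simps)
  have "fps_deriv G = G\<^sup>2"
    unfolding G_def by (subst fps_inverse_deriv) (simp_all add: power2_eq_square)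
  then have XdG: "fps_X * fps_deriv G = G * (G - 1)"
    using XG by (simp add: power2_eq_square mult.commute flip: mult.assoc)
  have xd: "fps_eval (xder q) = G * (G - 1) * fps_eval (pderiv q)" for q
    by (simp add: xder_def G_def algebra_simps flip: fps_const_neg)
  have "fps_X * fps_deriv (fps_eval (pCons a p))
      = (fps_X * fps_deriv G) * fps_eval p + G * (fps_X * fps_deriv (fps_eval p))"
    by (simp add: algebra_simps flip: G_def)
  also have "\<dots> = G * (G - 1) * (fps_eval p + G * fps_eval (pderiv p))"
    unfolding XdG pCons.IH[symmetric] xd by (simp add: algebra_simps)
  also have "\<dots> = fps_eval (xder (pCons a p))"
    unfolding xd by (simp add: pderiv_pCons flip: G_def)
  finally show ?case ..
qed (simp add: xder_def)

lemma fps_nth_mixed_eulerian: "fps_nth (fps_eval (mixed_eulerian a b)) m = real m ^ a * (real m + 1) ^ b"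
proof -
  have D: "fps_nth (fps_eval (xder p)) m = real m * fps_nth (fps_eval p) m" for p
    by (cases m) (simp_all add: fps_eval_xder)
  have G: "inverse (1 - fps_X :: real fps) = Abs_fps (\<lambda>_. 1)"
    by (rule fps_inverse_unique) (simp add: fps_eq_iff left_diff_distrib)
  have "fps_nth (fps_eval (mixed_eulerian 0 b)) m = (real m + 1) ^ b"
    by (induction b) (simp_all add: G mixed_eulerian_Suc_right xder1_def D algebra_simps)
  then show ?thesis
    by (induction a) (simp_all add: mixed_eulerian_Suc_left D)
qed

text \<open>This is \<open>(1 - t)^D p(1 / (1 - t))\<close> with the denominators cleared, hence a
  polynomial in \<open>t\<close>.\<close>

definition reversed_numerator :: "nat \<Rightarrow> real poly \<Rightarrow> real poly" where
  "reversed_numerator D p = (\<Sum>i\<le>D. smult (coeff p i) ([:1, -1:] ^ (D - i)))"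

lemma poly_altdef_le:
  fixes p :: "'a::comm_semiring_1 poly"
  assumes "degree p \<le> D"
  shows "poly p x = (\<Sum>i\<le>D. coeff p i * x ^ i)"
  unfolding poly_altdef using assms
  by (intro sum.mono_neutral_left) (auto simp: coeff_eq_0)

lemma fps_of_poly_reversed_numerator:
  assumes "degree p \<le> D"
  shows "fps_of_poly (reversed_numerator D p) = (1 - fps_X) ^ D * fps_eval p"
proof -
  define G :: "real fps" where "G = inverse (1 - fps_X)"
  have inv: "(1 - fps_X) * G = 1" unfolding G_def by (rule inverse_mult_eq_1') simp
  have lin: "fps_of_poly [:1, -1:] = (1 - fps_X :: real fps)"
    by (rule fps_ext) (auto simp: coeff_pCons split: nat.split)
  have "degree (map_poly fps_const p) \<le> D"
    using assms by (simp add: degree_map_poly)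
  then have "fps_eval p = (\<Sum>i\<le>D. fps_const (coeff p i) * G ^ i)"
    unfolding fps_eval_def G_def by (subst poly_altdef_le) (simp_all add: coeff_map_poly)
  moreover have "(1 - fps_X) ^ D * G ^ i = (1 - fps_X) ^ (D - i)" if "i \<le> D" for i
  proof -
    have "(1 - fps_X) ^ D * G ^ i = (1 - fps_X) ^ (D - i) * ((1 - fps_X) * G) ^ i"
      using that by (simp add: power_mult_distrib flip: mult.assoc power_add)
    then show ?thesis by (simp add: inv)
  qed
  ultimately show ?thesis
    by (simp add: reversed_numerator_def fps_of_poly_sum fps_of_poly_smult fps_of_poly_power lin
        sum_distrib_left mult.left_commute)
qed

lemma cpoly_reversed_numerator:
  assumes "degree p \<le> D" "t \<noteq> 1"
  shows "cpoly (reversed_numerator D p) t = (1 - t) ^ D * cpoly p (1 / (1 - t))"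
proof -
  have "degree (map_poly complex_of_real p) \<le> D"
    using assms by (simp add: degree_map_poly)
  then have "cpoly p (1 / (1 - t)) = (\<Sum>i\<le>D. of_real (coeff p i) * (1 / (1 - t)) ^ i)"
    by (subst poly_altdef_le) (simp_all add: coeff_map_poly)
  moreover have "(1 - t) ^ D * (1 / (1 - t)) ^ i = (1 - t) ^ (D - i)" if "i \<le> D" for i
    using assms(2) that by (simp add: power_diff power_divide)
  ultimately show ?thesis
    by (simp add: reversed_numerator_def sum_distrib_left mult.left_commute)
qed

text \<open>The point \<open>t = 1\<close> corresponds to \<open>x\<close> at infinity, where only
  the top coefficient survives.\<close>

lemma cpoly_reversed_numerator_1: "cpoly (reversed_numerator D p) 1 = of_real (coeff p D)"
proof -
  have "cpoly (reversed_numerator D p) 1 = (\<Sum>i\<le>D. if i = D then of_real (coeff p i) else 0)"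
    unfolding reversed_numerator_def cpoly_sum by (rule sum.cong) auto
  then show ?thesis by simp
qed

lemma coeff_mixed_eulerian_top: "coeff (mixed_eulerian a b) (Suc (a + b)) = fact (a + b)"
proof -
  have top: "coeff (xder (mixed_eulerian a b)) (Suc (Suc (a + b))) =
      real (Suc (a + b)) * coeff (mixed_eulerian a b) (Suc (a + b))" for a b
    by (rule coeff_xder_top) (simp add: degree_mixed_eulerian)
  have "coeff (mixed_eulerian 0 b) (Suc b) = fact b"
  proof (induction b)
    case (Suc b)
    then show ?case using top[of 0 b]
      by (simp add: mixed_eulerian_Suc_right xder1_def coeff_eq_0 degree_mixed_eulerian)
  qed simp
  then show ?thesis
    by (induction a) (use top in \<open>simp_all add: mixed_eulerian_Suc_left\<close>)
qed

lemma coeff_mixed_combination_top: "coeff (mixed_combination a n) (Suc n) = fact n * (\<Sum>j\<le>n. a j)"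
proof -
  have "coeff (mixed_combination a n) (Suc n) = (\<Sum>j\<le>n. a j * fact n)"
    unfolding mixed_combination_def coeff_sum
  proof (rule sum.cong)
    fix j assume "j \<in> {..n}"
    then have "j + (n - j) = n" by simp
    with coeff_mixed_eulerian_top[of j "n - j"]
    show "coeff (smult (a j) (mixed_eulerian j (n - j))) (Suc n) = a j * fact n" by simp
  qed simp
  then show ?thesis by (simp add: sum_distrib_left mult.commute)
qed

text \<open>The point \<open>x = 1\<close> is \<open>t = 0\<close>; the value there excludes the
  zero \<open>t = 0\<close>.\<close>

lemma poly_mixed_combination_1:
  assumes "n \<ge> 1"
  shows "poly (mixed_combination a (Suc n)) 1 = a 0 * poly (eulerian_core n) 1"
proof -
  obtain K where "mixed_combination a (Suc n) = smult (a 0) ([:0, 0, 1:] * eulerian_core n)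
      + smult (a (Suc n)) ([:0, -1, 1:] * eulerian_core n) + [:0, 0, -1, 1:] * K"
    by (rule mixed_combination_split[OF assms, of a])
  then show ?thesis by simp
qed

theorem only_real_negative_zeros_hstar_poly:
  fixes P :: "(real ^ 'n) set"
  assumes "CARD('n) = n + 2" "n \<ge> 1" "a 0 > 0" "a (Suc n) \<ge> 0"
    and "\<And>r. 1 \<le> r \<Longrightarrow> r \<le> n \<Longrightarrow> tail_sum (2 - sqrt 3) a n r \<ge> 0"
    and "\<And>m. real (lattice_count P m) = (\<Sum>j\<le>Suc n. a j * (real m ^ j * (real m + 1) ^ (Suc n - j)))"
  shows "only_real_negative_zeros (hstar_poly P)"
proof -
  define p where "p = mixed_combination a (Suc n)"
  define H where "H = reversed_numerator (n + 2) p"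
  have deg: "degree p \<le> n + 2" using degree_mixed_combination[of a "Suc n"] by (simp add: p_def)
  have "ehrhart_series P = fps_eval p"
    unfolding fps_eq_iff p_def mixed_combination_def ehrhart_series_def
    by (simp add: assms(6) fps_sum_nth fps_nth_mixed_eulerian del: sum.atMost_Suc)
  then have H: "hstar_poly P = H"
    by (intro hstar_poly_eqI) (simp only: assms(1) H_def fps_of_poly_reversed_numerator[OF deg])
  \<comment> \<open>Summation by parts with constant weights, set to 0 at index 0, is admissible
    since \<open>2 - sqrt 3 <= 1\<close>. It makes the sum of all coefficients, and so the value of
    \<open>H\<close> at 1, nonzero.\<close>
  have "(\<Sum>j=1..n. a j * (if j = 0 then 0 else 1)) \<ge> 0"
    using assms(5) by (rule tail_sum_summation_nonneg) (auto simp: real_le_rsqrt)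
  then have "(\<Sum>j=1..n. a j) \<ge> 0" by (simp cong: sum.cong_simp)
  then have "(\<Sum>j\<le>Suc n. a j) > 0" unfolding sum_split_ends using assms(3,4) by simp
  then have "coeff p (n + 2) > 0"
    using coeff_mixed_combination_top[of a "Suc n"] by (simp add: p_def del: fact_Suc sum.atMost_Suc)
  then have H1: "cpoly H 1 \<noteq> 0" by (simp add: H_def cpoly_reversed_numerator_1)
  show ?thesis
    unfolding only_real_negative_zeros_def H
  proof (intro allI impI)
    fix t assume t: "cpoly H t = 0"
    with H1 have t1: "t \<noteq> 1" by auto
    have "cpoly p (1 / (1 - t)) = 0"
      using t cpoly_reversed_numerator[OF deg t1] t1 by (simp add: H_def)
    then have "1 / (1 - t) \<in> of_real ` {0..1}"
      using mixed_combination_nonzero[of n a "1 / (1 - t)"] assms by (auto simp: p_def)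
    then obtain x where x: "1 / (1 - t) = of_real x" "0 \<le> x" "x \<le> 1" by auto
    have "x \<noteq> 0" using x t1 by auto
    moreover have "x \<noteq> 1"
    proof
      assume "x = 1"
      then have "poly p 1 = 0"
        using \<open>cpoly p (1 / (1 - t)) = 0\<close> cpoly_of_real[of p 1] x by simp
      then show False using poly_mixed_combination_1[OF assms(2)] poly_eulerian_core_0_1 assms(3) by (simp add: p_def)
    qed
    ultimately have x01: "0 < x" "x < 1" using x by auto
    have "t = 1 - 1 / of_real x" using x t1 \<open>x \<noteq> 0\<close> by (simp add: field_simps)
    then have "t = of_real (1 - 1 / x)" by simp
    moreover have "1 - 1 / x < 0" using x01 by simp
    ultimately show "t \<in> \<real> \<and> Re t < 0" by simp
  qed
qed

section \<open>Weighted compositions and roots of unity\<close>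

definition primitive_root :: "nat \<Rightarrow> complex \<Rightarrow> bool" where
  "primitive_root k \<omega> \<longleftrightarrow> (\<forall>w. \<omega> ^ w = 1 \<longleftrightarrow> k dvd w)"

lemma primitive_root_exists:
  assumes "k \<ge> 1"
  obtains \<omega> where "primitive_root k \<omega>"
proof -
  define \<omega> where "\<omega> = exp (2 * of_real pi * \<i> * of_nat 1 / of_nat k)"
  have "\<omega> ^ w = exp (2 * of_real pi * \<i> * of_nat w / of_nat k)" for w
    unfolding \<omega>_def exp_of_nat_mult[symmetric] by (simp add: field_simps)
  then have "primitive_root k \<omega>"
    unfolding primitive_root_def using complex_root_unity_eq_1[OF assms] by simp
  then show ?thesis using that by blast
qed

lemma primitive_root_power:
  assumes "primitive_root k \<omega>" "k \<ge> 1"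
  shows "primitive_root (k div gcd s k) (\<omega> ^ s)"
  unfolding primitive_root_def
proof
  fix w
  define g where "g = gcd s k"
  have g: "g > 0" using assms(2) by (simp add: g_def)
  obtain s' k' where sk: "s = s' * g" "k = k' * g" "coprime s' k'"
    using gcd_coprime_exists[of s k] g unfolding g_def by auto
  have "(\<omega> ^ s) ^ w = 1 \<longleftrightarrow> k dvd s * w"
    using assms(1) by (simp add: primitive_root_def flip: power_mult)
  also have "\<dots> \<longleftrightarrow> k' * g dvd (s' * w) * g" by (simp add: sk mult_ac)
  also have "\<dots> \<longleftrightarrow> k' dvd s' * w" using g by simp
  also have "\<dots> \<longleftrightarrow> k' dvd w" using sk(3) by (simp add: coprime_commute coprime_dvd_mult_right_iff)
  also have "k' = k div g" using g sk(2) by simp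
  finally show "(\<omega> ^ s) ^ w = 1 \<longleftrightarrow> k div gcd s k dvd w"
    unfolding g_def .
qed

lemma sum_powers_primitive_root:
  assumes "primitive_root k \<omega>"
  shows "(\<Sum>s\<in>{0<..k}. (\<omega> ^ s) ^ w) = (if k dvd w then of_nat k else 0)"
proof -
  have eq: "(\<omega> ^ s) ^ w = (\<omega> ^ w) ^ s" for s by (simp add: mult.commute flip: power_mult)
  show ?thesis
  proof (cases "k dvd w")
    case True
    then have "\<omega> ^ w = 1" using assms by (simp add: primitive_root_def)
    then show ?thesis using True by (simp add: eq)
  next
    case False
    then have ne: "\<omega> ^ w \<noteq> 1" using assms by (simp add: primitive_root_def)
    have "(\<omega> ^ w) ^ k = 1" using assms by (simp add: primitive_root_def flip: power_mult)
    then have "(\<Sum>s<k. (\<omega> ^ w) ^ s) = 0" using geometric_sum[OF ne, of k] by simp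
    moreover have "(\<Sum>s\<in>{0<..k}. (\<omega> ^ w) ^ s) = \<omega> ^ w * (\<Sum>s<k. (\<omega> ^ w) ^ s)"
      unfolding sum_distrib_left
      by (rule sum.reindex_bij_witness[where i = Suc and j = "\<lambda>s. s - 1"])
        (auto simp flip: power_Suc)
    ultimately show ?thesis using False by (simp add: eq)
  qed
qed

lemma prod_primitive_root:
  assumes "primitive_root h \<zeta>" "h \<ge> 1"
  shows "(\<Prod>j<h. 1 - fps_const (\<zeta> ^ j) * fps_X) = 1 - fps_X ^ h"
proof -
  have one: "\<zeta> ^ w = 1 \<longleftrightarrow> h dvd w" for w using assms(1) by (simp add: primitive_root_def)
  then have nz: "\<zeta> \<noteq> 0" using assms(2) by (metis dvd_refl not_one_le_zero power_0_left zero_neq_one)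
  have inj: "inj_on (\<lambda>i. \<zeta> ^ i) {..<h}"
  proof (rule linorder_inj_onI')
    fix i j assume ij: "i \<in> {..<h}" "j \<in> {..<h}" "i < j"
    then have "\<not> h dvd (j - i)" by (auto dest: dvd_imp_le)
    then have "\<zeta> ^ (j - i) \<noteq> 1" using one by simp
    moreover have "\<zeta> ^ j = \<zeta> ^ i * \<zeta> ^ (j - i)" using ij by (simp flip: power_add)
    ultimately show "\<zeta> ^ i \<noteq> \<zeta> ^ j" using nz by simp
  qed
  \<comment> \<open>Two polynomials of degree at most \<open>h\<close> need \<open>h + 1\<close>
    common values; the point 0 joins the \<open>h\<close> roots of unity.\<close>
  define A where "A = insert 0 ((\<lambda>i. \<zeta> ^ i) ` {..<h})"
  have card: "card A = Suc h" using inj nz by (simp add: A_def card_image image_iff)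
  have "(\<Prod>j<h. [:1, - (\<zeta> ^ j):]) = 1 - monom 1 h"
  proof (rule poly_eqI_degree[where A = A])
    fix x assume "x \<in> A"
    then consider "x = 0" | i where "i < h" "x = \<zeta> ^ i" by (auto simp: A_def)
    then show "poly (\<Prod>j<h. [:1, - (\<zeta> ^ j):]) x = poly (1 - monom 1 h) x"
    proof cases
      case 1
      then show ?thesis using assms(2) by (simp add: poly_prod poly_monom)
    next
      case 2
      \<comment> \<open>The exponent of the inverse of \<open>\<zeta>^i\<close>; the remainder keeps
        it below \<open>h\<close> when \<open>i = 0\<close>.\<close>
      define j where "j = (h - i) mod h"
      have "h dvd (j + i)" unfolding j_def using 2 by (cases "i = 0") auto
      then have "1 - \<zeta> ^ j * \<zeta> ^ i = 0" using one by (simp flip: power_add)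
      moreover have "j < h" using assms(2) by (simp add: j_def)
      ultimately have "(\<Prod>j<h. 1 - \<zeta> ^ j * \<zeta> ^ i) = 0" by (intro prod_zero) auto
      moreover have "(\<zeta> ^ i) ^ h = 1" using one by (simp flip: power_mult)
      ultimately show ?thesis using 2 by (simp add: poly_prod poly_monom mult.commute)
    qed
  next
    have "degree (\<Prod>j<h. [:1, - (\<zeta> ^ j):]) \<le> sum (degree \<circ> (\<lambda>j. [:1, - (\<zeta> ^ j):])) {..<h}"
      by (rule degree_prod_sum_le) simp
    also have "\<dots> \<le> (\<Sum>j<h. 1)" by (intro sum_mono) auto
    finally show "degree (\<Prod>j<h. [:1, - (\<zeta> ^ j):]) < card A" by (simp add: card)
    show "degree (1 - monom 1 h :: complex poly) < card A"
      by (simp add: card degree_diff_le degree_monom_le le_imp_less_Suc)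
  qed
  then have "fps_of_poly (\<Prod>j<h. [:1, - (\<zeta> ^ j):]) = fps_of_poly (1 - monom 1 h)" by simp
  moreover have "fps_of_poly [:1, - c:] = 1 - fps_const c * fps_X" for c :: complex
    by (rule fps_ext) (auto simp: coeff_pCons split: nat.split)
  moreover have "fps_of_poly (1 - monom 1 h) = (1 - fps_X ^ h :: complex fps)"
    by (simp add: fps_of_poly_diff fps_of_poly_monom)
  ultimately show ?thesis by (simp add: fps_of_poly_prod)
qed

lemma prod_primitive_root_multiple:
  assumes "primitive_root h \<zeta>" "h \<ge> 1"
  shows "(\<Prod>j<q * h. 1 - fps_const (\<zeta> ^ j) * fps_X) = (1 - fps_X ^ h) ^ q"
proof -
  have one: "\<zeta> ^ (m * h) = 1" for m using assms(1) by (simp add: primitive_root_def)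
  have sub: "\<zeta> ^ (a - m * h) = \<zeta> ^ a" if "m * h \<le> a" for a m
  proof -
    have "\<zeta> ^ a = \<zeta> ^ (m * h + (a - m * h))" using that by simp
    then show ?thesis unfolding power_add one by simp
  qed
  have "(\<Prod>j\<in>{m * h..<m * h + h}. 1 - fps_const (\<zeta> ^ j) * fps_X) = 1 - fps_X ^ h" for m
    unfolding prod_primitive_root[OF assms, symmetric]
    by (rule prod.reindex_bij_witness[where i = "\<lambda>j. m * h + j" and j = "\<lambda>j. j - m * h"])
      (auto simp: power_add one sub)
  then show ?thesis by (simp flip: prod.nat_group)
qed

text \<open>The series is \<open>1 / (1 - X^h)\<close>, whose power counts lists of multiples of
  \<open>h\<close>; dividing the entries by \<open>h\<close> leaves stars and bars.\<close>

lemma fps_nth_multiples_power: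
  assumes "h \<ge> 1" "h dvd N" "q \<ge> 1"
  shows "fps_nth (Abs_fps (\<lambda>n. if h dvd n then 1 else 0 :: complex) ^ q) N
    = of_nat ((N div h + q - 1) choose (N div h))"
proof -
  have "fps_nth (Abs_fps (\<lambda>n. if h dvd n then 1 else 0 :: complex) ^ q) N
      = (\<Sum>v\<in>natpermute N q. \<Prod>j\<in>{0..q - 1}. if h dvd v ! j then 1 else 0)"
    using assms(3) by (simp add: fps_power_nth)
  also have "\<dots> = (\<Sum>v\<in>natpermute N q. if \<forall>x\<in>set v. h dvd x then 1 else 0)"
  proof (rule sum.cong)
    fix v assume "v \<in> natpermute N q"
    then have "length v = q" by (simp add: natpermute_def)
    then have "(\<forall>x\<in>set v. h dvd x) \<longleftrightarrow> (\<forall>j\<in>{0..q - 1}. h dvd v ! j)"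
      using assms(3) by (auto simp: all_set_conv_all_nth)
    then show "(\<Prod>j\<in>{0..q - 1}. if h dvd v ! j then 1 else 0)
        = (if \<forall>x\<in>set v. h dvd x then 1 else 0 :: complex)"
      by (auto intro: prod_zero)
  qed simp
  also have "\<dots> = of_nat (card {v \<in> natpermute N q. \<forall>x\<in>set v. h dvd x})"
    by (subst sum.If_cases) (auto simp: natpermute_finite Int_def)
  also have "card {v \<in> natpermute N q. \<forall>x\<in>set v. h dvd x} = card {l::nat list. length l = q \<and> sum_list l = N div h}"
  proof (rule bij_betw_same_card[symmetric], rule bij_betw_byWitness[where f' = "map (\<lambda>x. x div h)"])
    have sum_mult: "sum_list (map ((*) h) l) = h * sum_list l" for l
      by (induction l) (auto simp: algebra_simps)
    show "\<forall>l\<in>{l. length l = q \<and> sum_list l = N div h}. map (\<lambda>x. x div h) (map ((*) h) l) = l"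
      using assms(1) by (auto simp: map_idI)
    have id: "map ((*) h) (map (\<lambda>x. x div h) v) = v" if "\<forall>x\<in>set v. h dvd x" for v
      using that by (auto intro!: map_idI)
    then show "\<forall>v\<in>{v \<in> natpermute N q. \<forall>x\<in>set v. h dvd x}. map ((*) h) (map (\<lambda>x. x div h) v) = v"
      by blast
    show "map ((*) h) ` {l. length l = q \<and> sum_list l = N div h} \<subseteq> {v \<in> natpermute N q. \<forall>x\<in>set v. h dvd x}"
      using assms by (auto simp: natpermute_def sum_mult)
    show "map (\<lambda>x. x div h) ` {v \<in> natpermute N q. \<forall>x\<in>set v. h dvd x} \<subseteq> {l. length l = q \<and> sum_list l = N div h}"
    proof clarify
      fix v assume v: "v \<in> natpermute N q" "\<forall>x\<in>set v. h dvd x"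
      have "h * sum_list (map (\<lambda>x. x div h) v) = N"
        using sum_mult[of "map (\<lambda>x. x div h) v"] id[OF v(2)] v(1) by (simp add: natpermute_def)
      then show "length (map (\<lambda>x. x div h) v) = q \<and> sum_list (map (\<lambda>x. x div h) v) = N div h"
        using v(1) assms(1) by (auto simp: natpermute_def)
    qed
  qed
  finally show ?thesis by (simp add: card_length_sum_list)
qed

text \<open>The sum is the \<open>N\<close>-th coefficient of the product of
  \<open>1 / (1 - \<zeta>^j X)\<close> over \<open>j < k\<close>, where
  \<open>\<zeta> = \<omega>^s\<close> has order \<open>h = k / gcd s k\<close>. The factors run
  \<open>gcd s k\<close> times through all \<open>h\<close>-th roots of unity.\<close>

lemma character_sum_compositions:
  assumes "primitive_root k \<omega>" "k \<ge> 1" "k dvd N"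
  shows "(\<Sum>z\<in>natpermute N k. (\<omega> ^ s) ^ (\<Sum>j<k. j * z ! j))
    = of_nat ((N div (k div gcd s k) + gcd s k - 1) choose (N div (k div gcd s k)))"
proof -
  define \<zeta> q h where "\<zeta> = \<omega> ^ s" and "q = gcd s k" and "h = k div gcd s k"
  note defs = this
  have q: "q \<ge> 1" using assms(2) by (simp add: defs Suc_le_eq)
  have k: "k = q * h" by (simp add: defs)
  have h: "h \<ge> 1" using k assms(2) by (cases "h = 0") auto
  have prim: "primitive_root h \<zeta>" unfolding defs using assms by (intro primitive_root_power)
  have "h dvd N" using assms(3) k by (meson dvd_mult_right)
  define G where "G c = Abs_fps (\<lambda>n. c ^ n)" for c :: complex
  define M where "M = Abs_fps (\<lambda>n. if h dvd n then 1 else 0 :: complex)"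
  have G: "G c * (1 - fps_const c * fps_X) = 1" for c
  proof (rule fps_ext)
    fix n show "fps_nth (G c * (1 - fps_const c * fps_X)) n = fps_nth 1 n"
      by (cases n) (simp_all add: G_def right_diff_distrib flip: mult.assoc)
  qed
  have M: "M * (1 - fps_X ^ h) = 1"
  proof (rule fps_ext)
    fix n
    have "fps_nth (M * (1 - fps_X ^ h)) n = fps_nth M n - (if n < h then 0 else fps_nth M (n - h))"
      by (simp add: right_diff_distrib fps_X_power_mult_right_nth)
    also have "\<dots> = fps_nth 1 n"
      using h by (auto simp: M_def dvd_minus_self dest: dvd_imp_le)
    finally show "fps_nth (M * (1 - fps_X ^ h)) n = fps_nth 1 n" .
  qed
  have "(\<Prod>j<k. G (\<zeta> ^ j)) * (1 - fps_X ^ h) ^ q = 1"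
    unfolding prod_primitive_root_multiple[OF prim h, symmetric] k by (simp add: G flip: prod.distrib)
  moreover have "M ^ q * (1 - fps_X ^ h) ^ q = 1" by (simp add: M flip: power_mult_distrib)
  moreover have "A = C" if "A * B = 1" "C * B = 1" for A B C :: "complex fps"
  proof -
    have "A * (C * B) = C * (A * B)" by (simp only: mult_ac)
    then show ?thesis by (simp add: that)
  qed
  ultimately have prodG: "(\<Prod>j<k. G (\<zeta> ^ j)) = M ^ q" by blast
  obtain m where m: "k = Suc m" using assms(2) by (cases k) auto
  have "(\<Sum>z\<in>natpermute N k. \<zeta> ^ (\<Sum>j<k. j * z ! j)) = fps_nth (\<Prod>j\<in>{0..m}. G (\<zeta> ^ j)) N"
    unfolding fps_prod_nth
    by (simp add: m G_def power_sum atLeast0AtMost lessThan_Suc_atMost power_mult)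
  also have "{0..m} = {..<k}" using m by auto
  also have "fps_nth (\<Prod>j<k. G (\<zeta> ^ j)) N = of_nat ((N div h + q - 1) choose (N div h))"
    unfolding prodG M_def using h \<open>h dvd N\<close> q by (intro fps_nth_multiples_power)
  finally show ?thesis by (simp add: defs)
qed

text \<open>Divisibility by \<open>k\<close> is detected by averaging over the \<open>k\<close>-th
  roots of unity; the summand depends on \<open>s\<close> only through \<open>gcd s k\<close>, and
  grouping by it produces the totients.\<close>

theorem card_weighted_compositions:
  assumes "k \<ge> 1" "k dvd N"
  shows "k * card {z \<in> natpermute N k. k dvd (\<Sum>j<k. j * z ! j)}
    = (\<Sum>h | h dvd k. totient h * ((N div h + k div h - 1) choose (N div h)))"
proof -
  obtain \<omega> where \<omega>: "primitive_root k \<omega>" using primitive_root_exists assms(1) by blast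
  define c where "c g = (N div (k div g) + g - 1) choose (N div (k div g))" for g
  have "complex_of_nat (k * card {z \<in> natpermute N k. k dvd (\<Sum>j<k. j * z ! j)})
      = (\<Sum>z\<in>natpermute N k. if k dvd (\<Sum>j<k. j * z ! j) then of_nat k else 0)"
    by (subst sum.If_cases) (auto simp: natpermute_finite Int_def)
  also have "\<dots> = (\<Sum>z\<in>natpermute N k. \<Sum>s\<in>{0<..k}. (\<omega> ^ s) ^ (\<Sum>j<k. j * z ! j))"
    by (simp add: sum_powers_primitive_root[OF \<omega>])
  also have "\<dots> = (\<Sum>s\<in>{0<..k}. \<Sum>z\<in>natpermute N k. (\<omega> ^ s) ^ (\<Sum>j<k. j * z ! j))"
    by (rule sum.swap)
  also have "\<dots> = of_nat (\<Sum>s\<in>{0<..k}. c (gcd s k))"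
    unfolding of_nat_sum c_def by (intro sum.cong character_sum_compositions \<omega> assms refl)
  finally have "k * card {z \<in> natpermute N k. k dvd (\<Sum>j<k. j * z ! j)} = (\<Sum>s\<in>{0<..k}. c (gcd s k))"
    by (simp only: of_nat_eq_iff)
  also have "\<dots> = (\<Sum>g | g dvd k. \<Sum>s | s \<in> {0<..k} \<and> gcd s k = g. c (gcd s k))"
    using assms(1) by (intro sum.group[symmetric]) auto
  also have "\<dots> = (\<Sum>g | g dvd k. totient (k div g) * c g)"
  proof (rule sum.cong)
    fix g assume "g \<in> {g. g dvd k}"
    then have "card {s \<in> {0<..k}. gcd s k = g} = totient (k div g)"
      using assms(1) by (intro card_gcd_eq_totient) auto
    then show "(\<Sum>s | s \<in> {0<..k} \<and> gcd s k = g. c (gcd s k)) = totient (k div g) * c g" by simp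
  qed simp
  also have "\<dots> = (\<Sum>h | h dvd k. totient h * c (k div h))"
    using assms(1) by (intro sum.reindex_bij_witness[of _ "(div) k" "(div) k"]) (auto elim: dvdE)
  also have "\<dots> = (\<Sum>h | h dvd k. totient h * ((N div h + k div h - 1) choose (N div h)))"
    using assms(1) by (intro sum.cong) (auto simp: c_def elim!: dvdE)
  finally show ?thesis .
qed

section \<open>Bridges and excursions\<close>

definition cyclic_steps :: "int \<Rightarrow> int list \<Rightarrow> bool" where
  "cyclic_steps y xs \<longleftrightarrow>
     successively (\<lambda>u v. u - y \<le> v) xs \<and> (xs \<noteq> [] \<longrightarrow> last xs - y \<le> hd xs)"

definition bridges :: "int \<Rightarrow> nat \<Rightarrow> int list set" where
  "bridges y k = {xs. length xs = k \<and> sum_list xs = 0 \<and> cyclic_steps y xs}"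

definition excursions :: "int \<Rightarrow> nat \<Rightarrow> int list set" where
  "excursions y d = {xs. length xs = d \<and> sum_list xs = 0 \<and>
     (\<forall>i\<le>d. sum_list (take i xs) \<ge> 0) \<and> successively (\<lambda>u v. u - y \<le> v) xs}"

lemma cyclic_steps_nth:
  "cyclic_steps y xs \<longleftrightarrow> (\<forall>i<length xs. xs ! i - y \<le> xs ! (Suc i mod length xs))"
proof (cases "xs = []")
  case False
  then obtain n where n: "length xs = Suc n" by (cases xs) auto
  have "(\<forall>i<Suc n. P i) \<longleftrightarrow> (\<forall>i. Suc i < Suc n \<longrightarrow> P i) \<and> P n" for P
    using less_Suc_eq by auto
  then show ?thesis
    using False n by (simp add: cyclic_steps_def successively_conv_nth last_conv_nth hd_conv_nth)
qed (simp add: cyclic_steps_def)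

lemma cyclic_steps_append_commute: "cyclic_steps y (u @ v) \<longleftrightarrow> cyclic_steps y (v @ u)"
  by (cases "u = []"; cases "v = []") (auto simp: cyclic_steps_def successively_append_iff)

text \<open>These signs make the junction of two excursions, and the closing step of a single one,
  weakly ascending, so the step bound is automatic there.\<close>

lemma excursion_ends:
  assumes "xs \<in> excursions y d" "xs \<noteq> []"
  shows "hd xs \<ge> 0" "last xs \<le> 0"
proof -
  have d: "d \<ge> 1" "length xs = d" using assms by (auto simp: excursions_def Suc_le_eq)
  have pos: "sum_list (take i xs) \<ge> 0" if "i \<le> d" for i using assms(1) that by (simp add: excursions_def)
  show "hd xs \<ge> 0" using pos[of 1] d assms(2) by (cases xs) auto
  have "sum_list (take (d - 1) xs) + last xs = sum_list (butlast xs @ [last xs])"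
    using d by (simp add: butlast_conv_take)
  also have "\<dots> = 0" using assms by (simp add: excursions_def)
  finally show "last xs \<le> 0" using pos[of "d - 1"] by simp
qed

lemma excursions_subset_bridges:
  assumes "y \<ge> 0"
  shows "excursions y d \<subseteq> bridges y d"
proof
  fix xs assume xs: "xs \<in> excursions y d"
  have "last xs - y \<le> hd xs" if "xs \<noteq> []"
    using excursion_ends[OF xs that] assms by simp
  then show "xs \<in> bridges y d" using xs by (simp add: excursions_def bridges_def cyclic_steps_def)
qed

lemma summation_by_parts_cyclic:
  fixes X :: "nat \<Rightarrow> int"
  assumes "X k = X 0"
  shows "(\<Sum>j<k. int j * (X (Suc j) - X j)) = int k * X 0 - (\<Sum>j<k. X j)"
proof -
  have "(\<Sum>j<n. int j * (X (Suc j) - X j)) = int n * X n - (\<Sum>j<n. X (Suc j))" for n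
    by (induction n) (auto simp: algebra_simps)
  moreover have "(\<Sum>j<k. X (Suc j)) = (\<Sum>j<k. X j)"
    using sum.lessThan_Suc_shift[of X k] assms by simp
  ultimately show ?thesis using assms by simp
qed

lemma sum_index_times_const: "(\<Sum>j<k. int j * (2 * c)) = c * (int k * (int k - 1))"
  by (induction k) (auto simp: algebra_simps)

text \<open>A bridge is encoded by its shifted cyclic differences; the starting value is recovered from
  their weighted sum, which is therefore divisible by the length.\<close>

lemma bridges_bij:
  assumes "k \<ge> 1"
  shows "bij_betw (\<lambda>xs. map (\<lambda>i. nat (xs ! (Suc i mod k) - xs ! i + 2 * int m)) [0..<k])
    (bridges (2 * int m) k) {z \<in> natpermute (2 * m * k) k. k dvd (\<Sum>j<k. j * z ! j)}"
    (is "bij_betw ?f ?A ?B")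
proof -
  \<comment> \<open>Cyclic summation by parts with total 0 gives the weighted sum
    \<open>k (x_0 + m (k - 1))\<close>; this solves for the first entry \<open>x_0\<close>.\<close>
  define start where "start z = (\<Sum>j<k. int j * int (z ! j)) div int k - int m * (int k - 1)" for z
  define X where "X z i = start z + (\<Sum>j<i. int (z ! j) - 2 * int m)" for z i
  define g where "g z = map (X z) [0..<k]" for z
  have f: "length (?f xs) = k" "\<And>i. i < k \<Longrightarrow> int (?f xs ! i) = xs ! (Suc i mod k) - xs ! i + 2 * int m"
    "(\<Sum>j<k. int (?f xs ! j)) = int (2 * m * k)"
    "(\<Sum>j<k. int j * int (?f xs ! j)) = int k * (xs ! 0 + int m * (int k - 1))"
    if xs: "xs \<in> ?A" for xs
  proof -
    define Y where "Y i = xs ! (i mod k)" for i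
    have len: "length xs = k" and s0: "(\<Sum>j<k. Y j) = 0"
      using xs by (auto simp: bridges_def Y_def sum_list_sum_nth atLeast0LessThan)
    show "length (?f xs) = k" by simp
    show fi: "int (?f xs ! i) = xs ! (Suc i mod k) - xs ! i + 2 * int m" if "i < k" for i
      using that xs len by (auto simp: bridges_def cyclic_steps_nth)
    have fY: "int (?f xs ! j) = (Y (Suc j) - Y j) + 2 * int m" if "j < k" for j
      using fi[OF that] that by (simp add: Y_def)
    have Yk: "Y k = Y 0" by (simp add: Y_def)
    have "(\<Sum>j<k. int (?f xs ! j)) = (\<Sum>j<k. (Y (Suc j) - Y j) + 2 * int m)"
      by (rule sum.cong) (auto simp only: fY lessThan_iff)
    also have "\<dots> = int (2 * m * k)" using Yk by (simp add: sum.distrib sum_lessThan_telescope)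
    finally show "(\<Sum>j<k. int (?f xs ! j)) = int (2 * m * k)" .
    have "(\<Sum>j<k. int j * int (?f xs ! j)) = (\<Sum>j<k. int j * ((Y (Suc j) - Y j) + 2 * int m))"
      by (rule sum.cong) (auto simp only: fY lessThan_iff)
    also have "\<dots> = (\<Sum>j<k. int j * (Y (Suc j) - Y j)) + (\<Sum>j<k. int j * (2 * int m))"
      by (simp only: distrib_left sum.distrib)
    also have "\<dots> = int k * (xs ! 0 + int m * (int k - 1))"
      unfolding summation_by_parts_cyclic[where X = Y and k = k, OF Yk] sum_index_times_const s0
      by (simp add: Y_def algebra_simps)
    finally show "(\<Sum>j<k. int j * int (?f xs ! j)) = int k * (xs ! 0 + int m * (int k - 1))" .
  qed
  have gz: "sum_list (g z) = 0" "X z k = X z 0" if z: "z \<in> ?B" for z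
  proof -
    have sz: "(\<Sum>j<k. int (z ! j)) = int (2 * m * k)"
      using z by (auto simp: natpermute_def sum_list_sum_nth atLeast0LessThan simp flip: of_nat_sum)
    then show Xk: "X z k = X z 0" by (simp add: X_def sum_subtractf)
    have "int (\<Sum>j<k. j * z ! j) = int k * (int (\<Sum>j<k. j * z ! j) div int k)"
      using z by (metis (no_types, lifting) dvd_mult_div_cancel int_dvd_int_iff mem_Collect_eq)
    then have W: "(\<Sum>j<k. int j * int (z ! j)) = int k * (start z + int m * (int k - 1))"
      by (simp add: start_def)
    have "(\<Sum>j<k. int j * (X z (Suc j) - X z j))
        = (\<Sum>j<k. int j * int (z ! j)) - (\<Sum>j<k. int j * (2 * int m))"
    proof -
      have "X z (Suc j) - X z j = int (z ! j) - 2 * int m" for j by (simp add: X_def)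
      then show ?thesis by (simp only: right_diff_distrib sum_subtractf)
    qed
    also have "\<dots> = int k * start z"
      unfolding W sum_index_times_const by (simp add: algebra_simps)
    finally have "(\<Sum>j<k. X z j) = 0"
      unfolding summation_by_parts_cyclic[where X = "X z" and k = k, OF Xk] by (simp add: X_def)
    then show "sum_list (g z) = 0"
      by (simp add: g_def sum_list_sum_nth atLeast0LessThan)
  qed
  have gstep: "g z ! (Suc i mod k) = g z ! i + int (z ! i) - 2 * int m" if z: "z \<in> ?B" and "i < k" for z i
  proof (cases "Suc i = k")
    case True
    then have "X z 0 = X z i + int (z ! i) - 2 * int m" using gz(2)[OF z] by (auto simp: X_def)
    then show ?thesis using True \<open>i < k\<close> by (simp add: g_def)
  next
    case False
    then show ?thesis using \<open>i < k\<close> by (simp add: g_def X_def)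
  qed
  show ?thesis
  proof (rule bij_betw_byWitness[where f' = g])
    show "\<forall>xs\<in>?A. g (?f xs) = xs"
    proof
      fix xs assume xs: "xs \<in> ?A"
      then have len: "length xs = k" by (simp add: bridges_def)
      have "start (?f xs) = xs ! 0" unfolding start_def f(4)[OF xs] using assms by simp
      have "X (?f xs) i = xs ! i" if "i < k" for i
        using that
      proof (induction i)
        case 0
        then show ?case using \<open>start (?f xs) = xs ! 0\<close> by (simp add: X_def)
      next
        case (Suc i)
        have "X (?f xs) (Suc i) = X (?f xs) i + (int (?f xs ! i) - 2 * int m)"
          by (simp only: X_def sum.lessThan_Suc add.assoc)
        also have "\<dots> = xs ! i + (int (?f xs ! i) - 2 * int m)"
          using Suc by (simp only: Suc_lessD)
        also have "\<dots> = xs ! Suc i" using Suc.prems by (subst f(2)[OF xs]) auto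
        finally show ?case .
      qed
      then show "g (?f xs) = xs" unfolding g_def using len by (intro nth_equalityI) auto
    qed
    show "\<forall>z\<in>?B. ?f (g z) = z"
    proof
      fix z assume z: "z \<in> ?B"
      then have "length z = k" by (simp add: natpermute_def)
      then show "?f (g z) = z" by (intro nth_equalityI) (simp_all add: gstep[OF z])
    qed
    show "?f ` ?A \<subseteq> ?B"
    proof (rule image_subsetI)
      fix xs assume xs: "xs \<in> ?A"
      have "int (sum_list (?f xs)) = int (2 * m * k)"
        using f(1,3)[OF xs] by (simp only: sum_list_sum_nth atLeast0LessThan of_nat_sum)
      moreover have "int (\<Sum>j<k. j * ?f xs ! j) = int k * (xs ! 0 + int m * (int k - 1))"
        using f(4)[OF xs] by (simp only: of_nat_sum of_nat_mult)
      then have "int k dvd int (\<Sum>j<k. j * ?f xs ! j)" by (simp only: dvd_triv_left)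
      ultimately show "?f xs \<in> ?B"
        using f(1)[OF xs] by (simp only: natpermute_def of_nat_eq_iff int_dvd_int_iff mem_Collect_eq)
    qed
    show "g ` ?B \<subseteq> ?A"
    proof (rule image_subsetI)
      fix z assume z: "z \<in> ?B"
      have "length (g z) = k" by (simp add: g_def)
      then show "g z \<in> ?A" using gz(1)[OF z] by (auto simp: bridges_def cyclic_steps_nth gstep[OF z])
    qed
  qed
qed

lemma finite_bridges: "finite (bridges (2 * int m) k)"
proof (cases "k = 0")
  case True
  have "bridges (2 * int m) k \<subseteq> {[]}" using True by (auto simp: bridges_def)
  then show ?thesis by (rule finite_subset) simp
next
  case False
  then have "k \<ge> 1" by simp
  show ?thesis
    by (subst bij_betw_finite[OF bridges_bij[OF \<open>k \<ge> 1\<close>]]) (simp add: natpermute_finite)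
qed

lemma finite_excursions: "finite (excursions (2 * int m) k)"
  using finite_bridges excursions_subset_bridges[of "2 * int m" k] by (meson finite_subset of_nat_0_le_iff mult_nonneg_nonneg zero_le_numeral)

text \<open>The \<open>1 / d^2\<close> in \<open>K\<close> splits in two: one factor comes from
  averaging over roots of unity, the other from the logarithmic derivative.\<close>

lemma card_bridges:
  assumes "k \<ge> 1"
  shows "real (card (bridges (2 * int m) k)) = real k * poly (fps_nth K_series k) (2 * real m)"
proof -
  have nat_eq: "k * card (bridges (2 * int m) k)
      = (\<Sum>h | h dvd k. totient h * ((2 * m * k div h + k div h - 1) choose (2 * m * k div h)))"
    using bij_betw_same_card[OF bridges_bij[OF assms, of m]]
      card_weighted_compositions[OF assms, of "2 * m * k"] by simp
  have "real (k * card (bridges (2 * int m) k)) = (\<Sum>h | h dvd k. real (totient h) * poly (binom_poly (k div h)) (2 * real m))"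
    unfolding nat_eq of_nat_sum
  proof (rule sum.cong)
    fix h assume "h \<in> {h. h dvd k}"
    then obtain n where n: "k = h * n" by auto
    with assms have hn: "h \<ge> 1" "n \<ge> 1" by (auto simp: Suc_le_eq)
    have "2 * m * k div h = 2 * m * n" "k div h = n" using n hn by auto
    moreover have "poly (binom_poly n) (2 * real m) = ((1 + 2 * real m) * real n - 1) gchoose (n - 1)"
      by (rule poly_binom_poly[OF hn(2)])
    moreover have "(1 + 2 * real m) * real n - 1 = real (2 * m * n + n - 1)"
      using hn by (simp add: of_nat_diff algebra_simps)
    moreover have "(2 * m * n + n - 1) choose (2 * m * n) = (2 * m * n + n - 1) choose (n - 1)"
      using hn by (subst binomial_symmetric) auto
    ultimately show "real (totient h * (2 * m * k div h + k div h - 1 choose (2 * m * k div h)))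
        = real (totient h) * poly (binom_poly (k div h)) (2 * real m)"
      by (simp only: of_nat_mult binomial_gbinomial)
  qed simp
  then have "real k * real (card (bridges (2 * int m) k))
      = (\<Sum>h | h dvd k. real (totient h) * poly (binom_poly (k div h)) (2 * real m))"
    by simp
  moreover have "poly (fps_nth K_series k) (2 * real m)
      = (\<Sum>h | h dvd k. real (totient h) * poly (binom_poly (k div h)) (2 * real m)) / (real k)\<^sup>2"
    using assms by (simp add: K_series_def poly_sum)
  ultimately have "real k * real (card (bridges (2 * int m) k))
      = real k * (real k * poly (fps_nth K_series k) (2 * real m))"
    using assms by (simp add: power2_eq_square)
  then show ?thesis using assms by simp
qed

section \<open>Rotations and the cycle lemma\<close>

lemma sum_list_take_drop:
  fixes xs :: "int list"
  shows "sum_list (take l (drop j xs)) = sum_list (take (j + l) xs) - sum_list (take j xs)"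
  by (simp add: take_add)

lemma sum_list_take_rotated:
  fixes xs :: "int list"
  assumes "length xs = k" "sum_list xs = 0" "j \<le> k" "l \<le> k"
  shows "sum_list (take l (drop j xs @ take j xs)) =
    (if l \<le> k - j then sum_list (take (j + l) xs) else sum_list (take (l - (k - j)) xs))
      - sum_list (take j xs)"
proof (cases "l \<le> k - j")
  case True
  then show ?thesis using assms by (simp add: sum_list_take_drop)
next
  case False
  have "sum_list (take j xs) + sum_list (drop j xs) = 0"
    using assms(2) by (metis append_take_drop_id sum_list_append)
  then show ?thesis using False assms by (simp add: min_def)
qed

text \<open>Position 0 is left out because on a cycle of total 0 it coincides with the full length;
  choosing the last minimum makes it unique.\<close>

definition last_minimum :: "int list \<Rightarrow> nat \<Rightarrow> bool" where
  "last_minimum xs p \<longleftrightarrow> 1 \<le> p \<and> p \<le> length xs \<and>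
     (\<forall>l. 1 \<le> l \<and> l \<le> length xs \<longrightarrow> sum_list (take p xs) \<le> sum_list (take l xs) \<and>
       (p < l \<longrightarrow> sum_list (take p xs) < sum_list (take l xs)))"

lemma last_minimum_unique: "last_minimum xs p \<Longrightarrow> last_minimum xs q \<Longrightarrow> p = q"
  unfolding last_minimum_def by (metis linorder_neqE_nat not_less)

lemma last_minimum_exists:
  assumes "xs \<noteq> []"
  obtains p where "last_minimum xs p"
proof -
  define M where "M = Min ((\<lambda>l. sum_list (take l xs)) ` {1..length xs})"
  define L where "L = {l \<in> {1..length xs}. sum_list (take l xs) = M}"
  have ne: "{1..length xs} \<noteq> {}" using assms by (simp add: Suc_le_eq)
  then have "M \<in> (\<lambda>l. sum_list (take l xs)) ` {1..length xs}"
    unfolding M_def by (intro Min_in) auto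
  then have L: "L \<noteq> {}" "finite L" by (auto simp: L_def)
  then have p: "Max L \<in> L" by (rule Max_in[rotated])
  have min: "M \<le> sum_list (take l xs)" if "1 \<le> l" "l \<le> length xs" for l
    unfolding M_def using that by (intro Min_le) auto
  have "M < sum_list (take l xs)" if "1 \<le> l" "l \<le> length xs" "Max L < l" for l
  proof -
    have "l \<notin> L" using that(3) L(2) Max_ge leD by blast
    then show ?thesis using min[OF that(1,2)] that by (auto simp: L_def)
  qed
  then have "last_minimum xs (Max L)"
    using p min unfolding last_minimum_def by (auto simp: L_def)
  then show ?thesis using that by blast
qed

text \<open>\<open>j\<close> is where the rotation cuts. Positivity up to \<open>j\<close> puts the
  cut before the first return to 0, so that the start of the excursion is the last minimum of the
  rotated list and not merely one of several.\<close>

definition rooted_excursions :: "int \<Rightarrow> nat \<Rightarrow> (int list \<times> nat) set" where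
  "rooted_excursions y k = {(f, j). f \<in> excursions y k \<and> j < k \<and>
     (\<forall>l. 1 \<le> l \<and> l \<le> j \<longrightarrow> sum_list (take l f) > 0)}"

text \<open>The cycle lemma: a bridge is a rotation of an excursion started at the last minimum of its
  prefix sums.\<close>

lemma last_minimum_rotated_excursion:
  assumes "(f, j) \<in> rooted_excursions y k"
  shows "last_minimum (drop j f @ take j f) (k - j)"
proof -
  have f: "length f = k" "sum_list f = 0" "j < k" "\<And>i. i \<le> k \<Longrightarrow> sum_list (take i f) \<ge> 0"
    "\<And>l. 1 \<le> l \<Longrightarrow> l \<le> j \<Longrightarrow> sum_list (take l f) > 0"
    using assms by (auto simp: rooted_excursions_def excursions_def)
  have rot: "sum_list (take l (drop j f @ take j f)) =
    (if l \<le> k - j then sum_list (take (j + l) f) else sum_list (take (l - (k - j)) f))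
      - sum_list (take j f)" if "l \<le> k" for l
    using f that by (intro sum_list_take_rotated) auto
  have "sum_list (take (k - j) (drop j f @ take j f)) = - sum_list (take j f)"
    using rot[of "k - j"] f(1-3) by simp
  moreover have "sum_list (take l (drop j f @ take j f)) \<ge> - sum_list (take j f)
      \<and> (k - j < l \<longrightarrow> sum_list (take l (drop j f @ take j f)) > - sum_list (take j f))"
    if "1 \<le> l" "l \<le> k" for l
  proof (cases "l \<le> k - j")
    case True
    then show ?thesis using rot[OF that(2)] f(4)[of "j + l"] f(3) by simp
  next
    case False
    then have "sum_list (take (l - (k - j)) f) > 0" using f(5) that f(3) by simp
    then show ?thesis using rot[OF that(2)] False by simp
  qed
  ultimately show ?thesis
    unfolding last_minimum_def using f(1,3) by auto
qed

lemma cycle_lemma: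
  assumes "k \<ge> 1" "y \<ge> 0"
  shows "bij_betw (\<lambda>(f, j). drop j f @ take j f) (rooted_excursions y k) (bridges y k)"
  unfolding bij_betw_def
proof
  show "inj_on (\<lambda>(f, j). drop j f @ take j f) (rooted_excursions y k)"
  proof (rule inj_onI, clarify)
    fix f j f' j'
    assume A: "(f, j) \<in> rooted_excursions y k" "(f', j') \<in> rooted_excursions y k"
      and eq: "drop j f @ take j f = drop j' f' @ take j' f'"
    \<comment> \<open>The rotated list reveals its cut, since its last minimum lies at
      \<open>k - j\<close>.\<close>
    have "k - j = k - j'"
      using last_minimum_rotated_excursion[OF A(1)] last_minimum_rotated_excursion[OF A(2)]
        last_minimum_unique unfolding eq by blast
    moreover have len: "j < k" "j' < k" "length f = k" "length f' = k"
      using A by (auto simp: rooted_excursions_def excursions_def)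
    ultimately have "j = j'" by simp
    then have "drop j f = drop j f'" "take j f = take j f'"
      using eq len by (simp_all add: append_eq_append_conv)
    then show "f = f' \<and> j = j'" using \<open>j = j'\<close> by (metis append_take_drop_id)
  qed
next
  show "(\<lambda>(f, j). drop j f @ take j f) ` rooted_excursions y k = bridges y k"
  proof (intro equalityI subsetI)
    fix b assume "b \<in> (\<lambda>(f, j). drop j f @ take j f) ` rooted_excursions y k"
    then obtain f j where f: "(f, j) \<in> rooted_excursions y k" "b = drop j f @ take j f" by auto
    then have ex: "f \<in> excursions y k" by (simp add: rooted_excursions_def)
    then have br: "f \<in> bridges y k" using excursions_subset_bridges[OF assms(2)] by blast
    have "cyclic_steps y (take j f @ drop j f)" using br by (simp add: bridges_def)
    then have "cyclic_steps y b" unfolding f(2) by (subst cyclic_steps_append_commute)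
    moreover have "sum_list b = sum_list (take j f @ drop j f)" by (simp only: f(2) sum_list_append add.commute)
    ultimately show "b \<in> bridges y k" using br f(2) by (simp add: bridges_def)
  next
    fix b assume b: "b \<in> bridges y k"
    then have len: "length b = k" "sum_list b = 0" and "b \<noteq> []" using assms by (auto simp: bridges_def)
    from last_minimum_exists[OF \<open>b \<noteq> []\<close>] obtain p where p: "last_minimum b p" by blast
    then have p1: "1 \<le> p" "p \<le> k" using len by (auto simp: last_minimum_def)
    have pmin: "sum_list (take p b) \<le> sum_list (take l b)" "p < l \<Longrightarrow> sum_list (take p b) < sum_list (take l b)"
      if "1 \<le> l" "l \<le> k" for l
      using p that len by (auto simp: last_minimum_def)
    define f where "f = drop p b @ take p b"
    have rot: "sum_list (take l f) =
      (if l \<le> k - p then sum_list (take (p + l) b) else sum_list (take (l - (k - p)) b))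
        - sum_list (take p b)" if "l \<le> k" for l
      unfolding f_def using len p1 that by (intro sum_list_take_rotated) auto
    have "cyclic_steps y (take p b @ drop p b)" using b by (simp add: bridges_def)
    then have "cyclic_steps y f" unfolding f_def by (subst cyclic_steps_append_commute)
    moreover have "sum_list f = 0"
      using len(2) by (metis f_def append_take_drop_id add.commute sum_list_append)
    moreover have "sum_list (take l f) \<ge> 0" if "l \<le> k" for l
      using rot[OF that] pmin(1)[of "p + l"] pmin(1)[of "l - (k - p)"] that p1 by auto
    ultimately have "f \<in> excursions y k"
      using len by (simp add: excursions_def cyclic_steps_def f_def)
    moreover have "sum_list (take l f) > 0" if "1 \<le> l" "l \<le> k - p" for l
      using rot[of l] pmin(2)[of "p + l"] that p1 by auto
    ultimately have "(f, k - p) \<in> rooted_excursions y k"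
      using p1 by (auto simp: rooted_excursions_def)
    moreover have "b = drop (k - p) f @ take (k - p) f"
      using len p1 by (simp add: f_def)
    ultimately show "b \<in> (\<lambda>(f, j). drop j f @ take j f) ` rooted_excursions y k"
      by (intro image_eqI[of _ _ "(f, k - p)"]) auto
  qed
qed

section \<open>Cutting excursions at returns to zero\<close>

lemma append_excursions:
  assumes "e \<in> excursions y a" "f \<in> excursions y b" "y \<ge> 0"
  shows "e @ f \<in> excursions y (a + b)"
proof -
  have "last e - y \<le> hd f" if "e \<noteq> []" "f \<noteq> []"
    using excursion_ends[OF assms(1)] excursion_ends[OF assms(2)] that assms(3) by linarith
  moreover have "sum_list (take i (e @ f)) \<ge> 0" if "i \<le> a + b" for i
    using assms(1,2) that by (cases "i \<le> a") (auto simp: excursions_def)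
  ultimately show ?thesis
    using assms by (auto simp: excursions_def successively_append_iff)
qed

lemma excursion_split:
  assumes "e \<in> excursions y d" "a \<le> d" "sum_list (take a e) = 0"
  shows "take a e \<in> excursions y a" "drop a e \<in> excursions y (d - a)"
proof -
  have len: "length e = d" and pos: "\<And>i. i \<le> d \<Longrightarrow> sum_list (take i e) \<ge> 0"
    using assms(1) by (auto simp: excursions_def)
  have s: "successively (\<lambda>u v. u - y \<le> v) (take a e @ drop a e)" "sum_list (take a e @ drop a e) = 0"
    using assms(1) by (simp_all add: excursions_def)
  have "sum_list (take i (take a e)) \<ge> 0" if "i \<le> a" for i
    using pos[of i] that assms(2) by (simp add: min_def)
  then show "take a e \<in> excursions y a"
    using s len assms(2,3) unfolding successively_append_iff by (simp add: excursions_def)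
  have "sum_list (take i (drop a e)) \<ge> 0" if "i \<le> d - a" for i
    using pos[of "a + i"] that assms(2,3) by (simp add: sum_list_take_drop)
  moreover have "sum_list (drop a e) = 0" using s(2) assms(3) unfolding sum_list_append by simp
  ultimately show "drop a e \<in> excursions y (d - a)"
    using s len unfolding successively_append_iff by (simp add: excursions_def)
qed

text \<open>A marked position \<open>i\<close> is recovered from the last zero \<open>a <= i\<close>
  of the prefix sums: the part before \<open>a\<close> is an arbitrary excursion, the part after it
  is rooted at \<open>i - a\<close>. With the cycle lemma this is the combinatorial form of
  \<open>(exp K)' = exp K K'\<close>.\<close>

lemma marked_excursions_bij:
  assumes "y \<ge> 0"
  shows "bij_betw (\<lambda>(a, e, f, j). (e @ f, a + j))
    (SIGMA a:{..<d}. excursions y a \<times> rooted_excursions y (d - a)) (excursions y d \<times> {..<d})"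
    (is "bij_betw ?F ?A ?B")
  unfolding bij_betw_def
proof
  have last_zero: "length e = a" "sum_list (take a (e @ f)) = 0"
    "\<And>l. a < l \<Longrightarrow> l \<le> a + j \<Longrightarrow> sum_list (take l (e @ f)) > 0"
    if "(a, e, f, j) \<in> ?A" for a e f j
  proof -
    have e: "length e = a" "sum_list e = 0"
      and f: "\<And>l. 1 \<le> l \<Longrightarrow> l \<le> j \<Longrightarrow> sum_list (take l f) > 0"
      using that by (auto simp: excursions_def rooted_excursions_def)
    show "length e = a" "sum_list (take a (e @ f)) = 0" using e by auto
    show "sum_list (take l (e @ f)) > 0" if "a < l" "l \<le> a + j" for l
      using f[of "l - a"] e that by simp
  qed
  show "inj_on ?F ?A"
  proof (rule inj_onI)
    fix x x' assume x: "x \<in> ?A" "x' \<in> ?A" "?F x = ?F x'"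
    obtain a e f j a' e' f' j' where xx': "x = (a, e, f, j)" "x' = (a', e', f', j')"
      by (metis prod_cases4)
    have A: "(a, e, f, j) \<in> ?A" "(a', e', f', j') \<in> ?A"
      and eq: "e @ f = e' @ f'" "a + j = a' + j'"
      using x unfolding xx' by simp_all
    have "a = a'"
    proof (rule ccontr)
      assume "a \<noteq> a'"
      then consider "a < a'" | "a' < a" by linarith
      then show False
      proof cases
        case 1
        then show False using last_zero(3)[OF A(1), of a'] last_zero(2)[OF A(2)] eq by simp
      next
        case 2
        then show False using last_zero(3)[OF A(2), of a] last_zero(2)[OF A(1)] eq by simp
      qed
    qed
    then show "x = x'"
      using eq last_zero(1)[OF A(1)] last_zero(1)[OF A(2)] by (simp add: xx')
  qed
  show "?F ` ?A = ?B"
  proof (intro equalityI subsetI)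
    fix x assume "x \<in> ?F ` ?A"
    then obtain a e f j where x: "x = (e @ f, a + j)" "a < d" "e \<in> excursions y a"
      "(f, j) \<in> rooted_excursions y (d - a)"
      by (auto simp: image_iff)
    then show "x \<in> ?B"
      using append_excursions[of e y a f "d - a"] assms by (auto simp: rooted_excursions_def)
  next
    fix x assume "x \<in> ?B"
    then obtain e i where x: "x = (e, i)" "e \<in> excursions y d" "i < d" by auto
    define Z where "Z = {l. l \<le> i \<and> sum_list (take l e) = 0}"
    have "0 \<in> Z" "finite Z" by (auto simp: Z_def)
    then have a: "Max Z \<in> Z" by (intro Max_in) auto
    define a where "a = Max Z"
    have a: "a \<le> i" "sum_list (take a e) = 0" using a by (auto simp: Z_def a_def)
    have "sum_list (take l e) > 0" if "a < l" "l \<le> i" for l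
    proof -
      have "l \<notin> Z" using that(1) \<open>finite Z\<close> Max_ge leD unfolding a_def by blast
      then have "sum_list (take l e) \<noteq> 0" using that by (simp add: Z_def)
      moreover have "sum_list (take l e) \<ge> 0" using x that by (simp add: excursions_def)
      ultimately show ?thesis by simp
    qed
    then have "\<forall>l. 1 \<le> l \<and> l \<le> i - a \<longrightarrow> sum_list (take l (drop a e)) > 0"
      using a(2) by (auto simp: sum_list_take_drop)
    then have "(a, take a e, drop a e, i - a) \<in> ?A"
      using excursion_split[OF x(2) _ a(2)] a(1) x(3) by (simp add: rooted_excursions_def)
    moreover have "x = ?F (a, take a e, drop a e, i - a)" using a x by simp
    ultimately show "x \<in> ?F ` ?A" by blast
  qed
qed

lemma card_excursions_rec:
  "d * card (excursions (2 * int m) d)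
    = (\<Sum>a<d. card (excursions (2 * int m) a) * card (bridges (2 * int m) (d - a)))"
proof -
  let ?y = "2 * int m"
  have rooted: "finite (rooted_excursions ?y k)" "card (rooted_excursions ?y k) = card (bridges ?y k)"
    if "k \<ge> 1" for k
    using bij_betw_finite[OF cycle_lemma[OF that, of ?y]] bij_betw_same_card[OF cycle_lemma[OF that, of ?y]]
      finite_bridges by auto
  have "d * card (excursions ?y d) = card (excursions ?y d \<times> {..<d})"
    by (simp add: card_cartesian_product mult.commute)
  also have "\<dots> = card (SIGMA a:{..<d}. excursions ?y a \<times> rooted_excursions ?y (d - a))"
    by (rule bij_betw_same_card[OF marked_excursions_bij, symmetric]) simp
  also have "\<dots> = (\<Sum>a<d. card (excursions ?y a \<times> rooted_excursions ?y (d - a)))"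
    using rooted finite_excursions by (intro card_SigmaI) auto
  also have "\<dots> = (\<Sum>a<d. card (excursions ?y a) * card (bridges ?y (d - a)))"
    by (intro sum.cong) (auto simp: card_cartesian_product rooted)
  finally show ?thesis .
qed

theorem card_excursions: "real (card (excursions (2 * int m) d)) = poly (C_poly d) (2 * real m)"
proof (rule C_poly_unique)
  have "excursions (2 * int m) 0 = {[]}" by (auto simp: excursions_def)
  then show "real (card (excursions (2 * int m) 0)) = 1" by simp
next
  fix d :: nat
  have "real d * real (card (excursions (2 * int m) d))
      = (\<Sum>i<d. real (card (excursions (2 * int m) i)) * real (card (bridges (2 * int m) (d - i))))"
    using arg_cong[OF card_excursions_rec[of d m], of real] by simp
  also have "\<dots> = (\<Sum>i<d. real (card (excursions (2 * int m) i)) *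
      (real (d - i) * poly (fps_nth K_series (d - i)) (2 * real m)))"
    by (intro sum.cong) (auto simp: card_bridges)
  finally show "real d * real (card (excursions (2 * int m) d)) = \<dots>" .
qed

section \<open>An inequality description of the polytope\<close>

definition at_pos :: "nat \<Rightarrow> 'n::{finite,linorder}" where
  "at_pos k = sorted_list_of_set UNIV ! k"

lemma bij_betw_at_pos: "bij_betw at_pos {..<CARD('n)} (UNIV :: 'n::{finite,linorder} set)"
  unfolding at_pos_def by (rule bij_betw_nth) auto

lemma at_pos_less_iff:
  assumes "i < CARD('n)" "j < CARD('n)"
  shows "(at_pos i :: 'n::{finite,linorder}) < at_pos j \<longleftrightarrow> i < j"
proof -
  have less: "(at_pos i :: 'n) < at_pos j" if "i < j" "j < CARD('n)" for i j
    unfolding at_pos_def using that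
    by (intro sorted_wrt_nth_less[OF strict_sorted_list_of_set]) auto
  show ?thesis using less[of i j] less[of j i] assms
    by (metis less_asym linorder_neqE_nat less_irrefl)
qed

lemma obtain_pos:
  fixes x :: "'n::{finite,linorder}"
  obtains k where "k < CARD('n)" "x = at_pos k"
  using bij_betw_at_pos[where 'n = 'n] unfolding bij_betw_def by (metis UNIV_I imageE lessThan_iff)

text \<open>Coordinates are measured from \<open>c\<close> times the decreasing permutation.\<close>

definition defect :: "real \<Rightarrow> real ^ 'n::{finite,linorder} \<Rightarrow> nat \<Rightarrow> real" where
  "defect c v k = c * real (CARD('n) - k) - v $ at_pos k"

text \<open>In the coordinates of \<open>v\<close> the last condition reads
  \<open>v_{k+1} <= v_k + c\<close>, and the prefix conditions compare prefix sums with those of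
  \<open>c\<close> times the decreasing permutation.\<close>

definition dilate :: "real \<Rightarrow> (real ^ 'n::{finite,linorder}) set" where
  "dilate c = {v. (\<Sum>i<CARD('n). defect c v i) = 0 \<and>
     (\<forall>k\<le>CARD('n). (\<Sum>i<k. defect c v i) \<ge> 0) \<and>
     (\<forall>k. Suc k < CARD('n) \<longrightarrow> defect c v k - 2 * c \<le> defect c v (Suc k))}"

lemma vec_eq_at_posI:
  fixes v w :: "real ^ 'n::{finite,linorder}"
  assumes "\<And>k. k < CARD('n) \<Longrightarrow> v $ at_pos k = w $ at_pos k"
  shows "v = w"
  unfolding vec_eq_iff by (metis assms obtain_pos)

lemma vec_at_pos_exists:
  obtains v :: "real ^ 'n::{finite,linorder}" where "\<And>k. k < CARD('n) \<Longrightarrow> v $ at_pos k = f k"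
proof -
  have "inj_on (at_pos :: nat \<Rightarrow> 'n) {..<CARD('n)}" using bij_betw_at_pos[where 'n = 'n] by (simp add: bij_betw_def)
  then have "(\<chi> x. f (inv_into {..<CARD('n)} at_pos x)) $ (at_pos k :: 'n) = f k" if "k < CARD('n)" for k
    using that by (simp add: inv_into_f_f)
  then show ?thesis by (rule that)
qed

lemma defect_scaleR: "defect (s * c) (s *\<^sub>R v) k = s * defect c v k"
  by (simp add: defect_def algebra_simps)

text \<open>The factor 0 cannot be scaled back. Here the defects increase weakly from a nonnegative
  start and have total 0, so all vanish.\<close>

lemma dilate_0: "dilate 0 = {0 :: real ^ 'n::{finite,linorder}}"
proof (intro equalityI subsetI)
  fix v :: "(real, 'n) vec" assume v: "v \<in> dilate 0"
  have mono: "defect 0 v k \<le> defect 0 v (Suc k)" if "Suc k < CARD('n)" for k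
    using v that by (simp add: dilate_def)
  have "\<forall>k\<le>CARD('n). (\<Sum>i<k. defect 0 v i) \<ge> 0" using v by (simp add: dilate_def)
  moreover have "1 \<le> CARD('n)" by (simp add: Suc_le_eq)
  ultimately have "(\<Sum>i<1. defect 0 v i) \<ge> 0" by blast
  then have 0: "defect 0 v 0 \<ge> 0" by simp
  have nonneg: "defect 0 v k \<ge> 0" if "k < CARD('n)" for k
    using that
  proof (induction k)
    case (Suc k)
    then show ?case using mono[of k] by simp
  qed (rule 0)
  have "(\<Sum>i<CARD('n). defect 0 v i) = 0" using v by (simp add: dilate_def)
  then have "defect 0 v k = 0" if "k < CARD('n)" for k
    using sum_nonneg_eq_0_iff[of "{..<CARD('n)}" "defect 0 v"] nonneg that by auto
  then have "v = 0" by (intro vec_eq_at_posI) (simp add: defect_def)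
  then show "v \<in> {0}" by simp
qed (simp add: dilate_def defect_def)

lemma dilate_1_nonempty: "(dilate 1 :: (real ^ 'n::{finite,linorder}) set) \<noteq> {}"
proof -
  obtain v :: "(real, 'n) vec" where "\<And>k. k < CARD('n) \<Longrightarrow> v $ at_pos k = real (CARD('n) - k)"
    using vec_at_pos_exists[where 'n = 'n and f = "\<lambda>k. real (CARD('n) - k)"] by metis
  then have "defect 1 v k = 0" if "k < CARD('n)" for k using that by (simp add: defect_def)
  then have "v \<in> dilate 1" by (simp add: dilate_def)
  then show ?thesis by blast
qed

lemma scale_dilate_1: "(\<lambda>v. real m *\<^sub>R v) ` dilate 1 = (dilate (real m) :: (real ^ 'n::{finite,linorder}) set)"
proof (cases "m = 0")
  case True
  then show ?thesis using dilate_1_nonempty[where 'n = 'n] by (auto simp: dilate_0)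
next
  case False
  have scale: "s *\<^sub>R v \<in> dilate (s * c)" if "v \<in> dilate c" "s \<ge> 0" for s c and v :: "(real, 'n) vec"
  proof -
    have "s * defect c v k - 2 * (s * c) \<le> s * defect c v (Suc k)" if "Suc k < CARD('n)" for k
    proof -
      have "defect c v k - 2 * c \<le> defect c v (Suc k)" using \<open>v \<in> dilate c\<close> that by (simp add: dilate_def)
      then have "s * (defect c v k - 2 * c) \<le> s * defect c v (Suc k)" using \<open>s \<ge> 0\<close> by (rule mult_left_mono)
      then show ?thesis by (simp add: algebra_simps)
    qed
    then show ?thesis
      using that by (auto simp: dilate_def defect_scaleR simp flip: sum_distrib_left)
  qed
  show ?thesis
  proof (intro equalityI subsetI)
    fix x :: "(real, 'n) vec" assume "x \<in> (\<lambda>v. real m *\<^sub>R v) ` dilate 1"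
    then show "x \<in> dilate (real m)" using scale[of _ 1 "real m"] by auto
  next
    fix x :: "(real, 'n) vec" assume "x \<in> dilate (real m)"
    then have "(1 / real m) *\<^sub>R x \<in> dilate 1" using scale[of x "real m" "1 / real m"] False by simp
    moreover have "x = real m *\<^sub>R ((1 / real m) *\<^sub>R x)" using False by simp
    ultimately show "x \<in> (\<lambda>v. real m *\<^sub>R v) ` dilate 1" by blast
  qed
qed

text \<open>The floor is only a change of type: at lattice points the defects are integers.\<close>

lemma lattice_points_dilate_bij:
  "bij_betw (\<lambda>x. map (\<lambda>k. \<lfloor>defect (real m) x k\<rfloor>) [0..<CARD('n)])
     {x \<in> dilate (real m) :: (real ^ 'n::{finite,linorder}) set. \<forall>i. x $ i \<in> \<int>} (excursions (2 * int m) CARD('n))"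
  (is "bij_betw ?f ?A ?B")
  unfolding bij_betw_def
proof
  have floor: "of_int \<lfloor>defect (real m) x k\<rfloor> = defect (real m) x k" if "x \<in> ?A" for x :: "(real, 'n) vec" and k
  proof -
    have "defect (real m) x k \<in> \<int>" using that by (simp add: defect_def)
    then show ?thesis by (simp add: of_int_floor)
  qed
  show "inj_on ?f ?A"
  proof (rule inj_onI)
    fix x y assume xy: "x \<in> ?A" "y \<in> ?A" "?f x = ?f y"
    have "defect (real m) x k = defect (real m) y k" if "k < CARD('n)" for k
    proof -
      have "?f x ! k = ?f y ! k" by (simp only: xy(3))
      then have "\<lfloor>defect (real m) x k\<rfloor> = \<lfloor>defect (real m) y k\<rfloor>" using that by simp
      then show ?thesis by (metis floor[OF xy(1)] floor[OF xy(2)])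
    qed
    then show "x = y" by (intro vec_eq_at_posI) (simp add: defect_def)
  qed
  have key: "(\<forall>k\<le>CARD('n). (\<Sum>i<k. defect (real m) x i) = of_int (sum_list (take k l))) \<Longrightarrow>
      (\<And>k. k < CARD('n) \<Longrightarrow> defect (real m) x k = of_int (l ! k)) \<Longrightarrow> length l = CARD('n) \<Longrightarrow>
      x \<in> dilate (real m) \<longleftrightarrow> l \<in> excursions (2 * int m) CARD('n)" for x :: "(real, 'n) vec" and l
  proof -
    assume sums: "\<forall>k\<le>CARD('n). (\<Sum>i<k. defect (real m) x i) = of_int (sum_list (take k l))"
      and nth: "\<And>k. k < CARD('n) \<Longrightarrow> defect (real m) x k = of_int (l ! k)" and len: "length l = CARD('n)"
    have "defect (real m) x k - 2 * real m \<le> defect (real m) x (Suc k) \<longleftrightarrow> l ! k - 2 * int m \<le> l ! Suc k"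
      if "Suc k < CARD('n)" for k
    proof -
      have "defect (real m) x k - 2 * real m \<le> defect (real m) x (Suc k) \<longleftrightarrow>
          real_of_int (l ! k - 2 * int m) \<le> real_of_int (l ! Suc k)"
        using nth[of k] nth[of "Suc k"] that by simp
      then show ?thesis by (simp only: of_int_le_iff)
    qed
    moreover have "(\<forall>k\<le>CARD('n). (\<Sum>i<k. defect (real m) x i) \<ge> 0)
        \<longleftrightarrow> (\<forall>k\<le>CARD('n). sum_list (take k l) \<ge> 0)"
      using sums by simp
    moreover have "(\<Sum>i<CARD('n). defect (real m) x i) = 0 \<longleftrightarrow> sum_list l = 0"
      using sums len by simp
    ultimately show ?thesis
      unfolding dilate_def excursions_def successively_conv_nth mem_Collect_eq len by blast
  qed
  have mem: "x \<in> dilate (real m) \<longleftrightarrow> l \<in> excursions (2 * int m) CARD('n)"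
    if "\<And>k. k < CARD('n) \<Longrightarrow> defect (real m) x k = of_int (l ! k)" "length l = CARD('n)"
    for x :: "(real, 'n) vec" and l
  proof (rule key)
    show "\<forall>k\<le>CARD('n). (\<Sum>i<k. defect (real m) x i) = of_int (sum_list (take k l))"
      using that by (auto simp: sum_list_sum_nth atLeast0LessThan min_def intro!: sum.cong)
  qed (use that in auto)
  show "?f ` ?A = ?B"
  proof (intro equalityI subsetI)
    fix l assume "l \<in> ?f ` ?A"
    then obtain x where x: "x \<in> ?A" "l = ?f x" by blast
    then show "l \<in> ?B" using mem[of x l] floor[OF x(1)] by auto
  next
    fix l assume l: "l \<in> ?B"
    then have len: "length l = CARD('n)" by (simp add: excursions_def)
    obtain x :: "(real, 'n) vec" where x: "\<And>k. k < CARD('n) \<Longrightarrow> x $ at_pos k = real m * real (CARD('n) - k) - of_int (l ! k)"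
      using vec_at_pos_exists[where 'n = 'n and f = "\<lambda>k. real m * real (CARD('n) - k) - of_int (l ! k)"] by metis
    then have d: "defect (real m) x k = of_int (l ! k)" if "k < CARD('n)" for k
      using that by (simp add: defect_def)
    have "x \<in> dilate (real m)" using mem[OF d len] l by simp
    moreover have "x $ i \<in> \<int>" for i
      by (rule obtain_pos[of i]) (simp add: x)
    moreover have "l = ?f x" using len by (intro nth_equalityI) (simp_all add: d)
    ultimately show "l \<in> ?f ` ?A" by blast
  qed
qed

section \<open>The permutations satisfy the inequalities\<close>

lemma contains_pattern_length_3:
  "contains_pattern p [x, y, z] \<longleftrightarrow> (\<exists>i j k. i < j \<and> j < k \<and>
     (\<forall>a<3. \<forall>b<3. p ([i, j, k] ! a) < p ([i, j, k] ! b) \<longleftrightarrow> [x, y, z] ! a < [x, y, z] ! b))"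
proof -
  have len: "length xs = length [x, y, z] \<longleftrightarrow> (\<exists>i j k. xs = [i, j, k])" for xs :: "'a list"
    by (auto simp: length_Suc_conv)
  have sorted: "sorted_wrt (<) [i, j, k] \<longleftrightarrow> i < j \<and> j < k" for i j k :: 'a
    by (auto intro: less_trans)
  have "(\<exists>xs. length xs = length [x, y, z] \<and> sorted_wrt (<) xs \<and> Q xs)
      \<longleftrightarrow> (\<exists>i j k. i < j \<and> j < k \<and> Q [i, j, k])" for Q :: "'a list \<Rightarrow> bool"
    unfolding len by (metis sorted)
  then show ?thesis unfolding contains_pattern_def by (simp add: numeral_3_eq_3)
qed

lemma contains_132_iff:
  "contains_pattern p [1, 3, 2] \<longleftrightarrow> (\<exists>i j k. i < j \<and> j < k \<and> p i < p k \<and> p k < p j)"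
  unfolding contains_pattern_length_3 by (fastforce simp: numeral_3_eq_3 All_less_Suc)

lemma contains_213_iff:
  "contains_pattern p [2, 1, 3] \<longleftrightarrow> (\<exists>i j k. i < j \<and> j < k \<and> p j < p i \<and> p i < p k)"
  unfolding contains_pattern_length_3 by (fastforce simp: numeral_3_eq_3 All_less_Suc)

lemma sum_le_sum_largest:
  assumes "finite A" "card A = k" "A \<subseteq> {..d}"
  shows "\<Sum>A \<le> (\<Sum>i<k. d - i :: nat)"
  using assms
proof (induction k arbitrary: A d)
  case (Suc k)
  then have "A \<noteq> {}" by auto
  define M where "M = Max A"
  have M: "M \<in> A" "M \<le> d" using Suc \<open>A \<noteq> {}\<close> Max_in[of A] by (auto simp: M_def)
  have "A - {M} \<subseteq> {..d - 1}"
  proof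
    fix x assume x: "x \<in> A - {M}"
    then have "x \<le> M" "x \<noteq> M" using Suc.prems(1) by (simp_all add: M_def)
    then have "x < M" by simp
    then show "x \<in> {..d - 1}" using M by simp
  qed
  then have "\<Sum>(A - {M}) \<le> (\<Sum>i<k. (d - 1) - i)"
    using Suc M by (intro Suc.IH) auto
  moreover have "\<Sum>A = M + \<Sum>(A - {M})" using Suc M by (simp add: sum.remove)
  ultimately have "\<Sum>A \<le> d + (\<Sum>i<k. d - Suc i)" using M by simp
  then show ?case by (simp add: sum.lessThan_Suc_shift del: sum.lessThan_Suc)
qed simp

lemma avoiding_permutation_in_dilate:
  fixes p :: "'n::{finite,linorder} \<Rightarrow> nat"
  assumes "p \<in> avoiding_permutations {[1, 3, 2], [2, 1, 3]}"
  shows "(\<chi> i. real (p i)) \<in> dilate 1"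
proof -
  define d where "d = CARD('n)"
  define q where "q k = p (at_pos k)" for k
  have bij: "bij_betw p UNIV {1..d}"
    using assms by (simp add: avoiding_permutations_def is_permutation_def d_def)
  have bijq: "bij_betw q {..<d} {1..d}"
  proof -
    have "q = p \<circ> at_pos" by (simp add: fun_eq_iff q_def)
    then show ?thesis using bij_betw_trans[OF bij_betw_at_pos bij] by (simp add: d_def)
  qed
  have avoid: "\<not> contains_pattern p [1, 3, 2]" "\<not> contains_pattern p [2, 1, 3]"
    using assms by (auto simp: avoiding_permutations_def simp del: One_nat_def)
  have no132: "\<not> (q i < q k \<and> q k < q j)" if "i < j" "j < k" "k < d" for i j k
  proof -
    have "at_pos i < (at_pos j :: 'n)" "at_pos j < (at_pos k :: 'n)"
      using that by (simp_all add: at_pos_less_iff d_def)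
    then show ?thesis using avoid(1) unfolding contains_132_iff q_def by blast
  qed
  have no213: "\<not> (q j < q i \<and> q i < q k)" if "i < j" "j < k" "k < d" for i j k
  proof -
    have "at_pos i < (at_pos j :: 'n)" "at_pos j < (at_pos k :: 'n)"
      using that by (simp_all add: at_pos_less_iff d_def)
    then show ?thesis using avoid(2) unfolding contains_213_iff q_def by blast
  qed
  \<comment> \<open>If an ascent skipped the value \<open>q k + 1\<close>, that value would form 213
    when it stands to the left of the ascent and 132 when it stands to the right.\<close>
  have step: "q (Suc k) \<le> q k + 1" if "Suc k < d" for k
  proof (rule ccontr)
    assume "\<not> q (Suc k) \<le> q k + 1"
    then have lt: "q k + 1 < q (Suc k)" by simp
    moreover have "q (Suc k) \<in> {1..d}" using bijq that by (auto simp: bij_betw_def)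
    ultimately have "q k + 1 \<in> {1..d}" by simp
    then obtain t where t: "t < d" "q t = q k + 1"
      using bijq unfolding bij_betw_def by (metis imageE lessThan_iff)
    then have "t \<noteq> k" "t \<noteq> Suc k" using lt by auto
    then consider "t < k" | "Suc k < t" by linarith
    then show False
    proof cases
      case 1
      then show False using no213[of t k "Suc k"] that t lt by simp
    next
      case 2
      then show False using no132[of k "Suc k" t] that t lt by simp
    qed
  qed
  have le: "(\<Sum>i<k. q i) \<le> (\<Sum>i<k. d - i)" if "k \<le> d" for k
  proof -
    have inj: "inj_on q {..<k}" using bijq that by (auto simp: bij_betw_def intro: inj_on_subset)
    have "(\<Sum>i<k. q i) = \<Sum>(q ` {..<k})" by (simp add: sum.reindex[OF inj])
    also have "\<dots> \<le> (\<Sum>i<k. d - i)"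
      using bijq that by (intro sum_le_sum_largest) (auto simp: card_image[OF inj] bij_betw_def)
    finally show ?thesis .
  qed
  have total: "(\<Sum>i<d. q i) = (\<Sum>i<d. d - i)"
  proof -
    have "(\<Sum>i<d. q i) = \<Sum>{1..d}" by (rule sum.reindex_bij_betw[OF bijq])
    also have "\<dots> = (\<Sum>i<d. d - i)"
      by (rule sum.reindex_bij_witness[where i = "\<lambda>i. d - i" and j = "\<lambda>i. d - i"]) auto
    finally show ?thesis .
  qed
  have def: "defect 1 (\<chi> i. real (p i)) k = real (d - k) - real (q k)" for k
    by (simp add: defect_def q_def d_def)
  have sums: "(\<Sum>i<k. defect 1 (\<chi> i. real (p i)) i) = real (\<Sum>i<k. d - i) - real (\<Sum>i<k. q i)" for k
    by (simp add: def sum_subtractf)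
  have "(\<Sum>i<d. defect 1 (\<chi> i. real (p i)) i) = 0" unfolding sums total by simp
  moreover have "(\<Sum>i<k. defect 1 (\<chi> i. real (p i)) i) \<ge> 0" if "k \<le> d" for k
    unfolding sums diff_ge_0_iff_ge of_nat_le_iff by (rule le[OF that])
  moreover have "defect 1 (\<chi> i. real (p i)) k - 2 \<le> defect 1 (\<chi> i. real (p i)) (Suc k)" if "Suc k < d" for k
    using step[OF that] that unfolding def by (simp add: of_nat_diff)
  ultimately show ?thesis
    unfolding dilate_def by (simp flip: d_def)
qed

section \<open>Convexity and compactness of the inequality description\<close>

lemma convex_dilate_1: "convex (dilate 1)"
proof (rule convexI)
  fix x y :: "(real, 'a::{finite,linorder}) vec" and u v :: real
  assume xy: "x \<in> dilate 1" "y \<in> dilate 1" and uv: "0 \<le> u" "0 \<le> v" "u + v = 1"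
  have def: "defect 1 (u *\<^sub>R x + v *\<^sub>R y) k = u * defect 1 x k + v * defect 1 y k" for k
  proof -
    have "real (CARD('a) - k) = (u + v) * real (CARD('a) - k)" using uv by simp
    then show ?thesis by (simp add: defect_def algebra_simps)
  qed
  have "u * defect 1 x k + v * defect 1 y k - 2 \<le> u * defect 1 x (Suc k) + v * defect 1 y (Suc k)"
    if "Suc k < CARD('a)" for k
  proof -
    have "u * (defect 1 x k - 2) + v * (defect 1 y k - 2) \<le> u * defect 1 x (Suc k) + v * defect 1 y (Suc k)"
      using xy that uv by (intro add_mono mult_left_mono) (auto simp: dilate_def)
    moreover have "u * 2 + v * 2 = 2" using uv by simp
    ultimately show ?thesis by (simp add: algebra_simps)
  qed
  then show "u *\<^sub>R x + v *\<^sub>R y \<in> dilate 1"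
    using xy uv by (simp add: dilate_def def sum.distrib flip: sum_distrib_left)
qed

text \<open>The first defect is nonnegative and each step loses at most 2; read backwards from the
  last defect, which is not positive, the same bound limits the defects from above.\<close>

lemma defect_bound:
  fixes v :: "real ^ 'n::{finite,linorder}"
  assumes "v \<in> dilate 1" "k < CARD('n)"
  shows "\<bar>defect 1 v k\<bar> \<le> 2 * real CARD('n)"
proof -
  define d Y where "d = CARD('n)" and "Y = defect 1 v"
  have sums: "\<And>k. k \<le> d \<Longrightarrow> (\<Sum>i<k. Y i) \<ge> 0" and tot: "(\<Sum>i<d. Y i) = 0"
    and step: "\<And>k. Suc k < d \<Longrightarrow> Y k - 2 \<le> Y (Suc k)"
    using assms(1) by (auto simp: dilate_def d_def Y_def)
  have k: "k < d" using assms by (simp add: d_def)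
  have "Y k \<ge> - 2 * real k"
    using k
  proof (induction k)
    case 0
    then show ?case using sums[of 1] by simp
  next
    case (Suc k)
    then show ?case using step[of k] by simp
  qed
  moreover have "Y k \<le> 2 * real (d - 1 - k)"
  proof -
    have "k \<le> d - 1" using k by simp
    then show ?thesis
    proof (induction rule: inc_induct)
      case base
      have "(\<Sum>i<Suc (d - 1). Y i) = (\<Sum>i<d - 1. Y i) + Y (d - 1)" by simp
      moreover have "Suc (d - 1) = d" using k by simp
      ultimately show ?case using tot sums[of "d - 1"] by simp
    next
      case (step n)
      have "real (d - 1 - n) = real (d - 1 - Suc n) + 1" using step by (simp add: of_nat_diff)
      moreover have "Suc n < d" using step by simp
      ultimately show ?case using step \<open>\<And>k. Suc k < d \<Longrightarrow> Y k - 2 \<le> Y (Suc k)\<close>[of n] by simp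
    qed
  qed
  moreover have "real (d - 1 - k) \<le> real d" "real k \<le> real d" using k by auto
  ultimately show ?thesis unfolding d_def[symmetric] Y_def[symmetric] by linarith
qed

lemma compact_dilate_1: "compact (dilate 1 :: (real ^ 'n::{finite,linorder}) set)"
proof -
  have "closed (dilate 1 :: (real, 'n) vec set)"
    unfolding dilate_def defect_def
    by (intro closed_Collect_conj closed_Collect_all closed_Collect_imp closed_Collect_eq closed_Collect_le
        open_Collect_const continuous_intros)
  moreover have "bounded (dilate 1 :: (real, 'n) vec set)"
  proof (rule bounded_subset[OF bounded_cbox])
    let ?b = "3 * real CARD('n)"
    show "(dilate 1 :: (real, 'n) vec set) \<subseteq> cbox (\<chi> i. - ?b) (\<chi> i. ?b)"
    proof
      fix v :: "(real, 'n) vec" assume v: "v \<in> dilate 1"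
      have "\<bar>v $ x\<bar> \<le> ?b" for x
      proof (rule obtain_pos[of x])
        fix k assume k: "k < CARD('n)" "x = at_pos k"
        have "\<bar>v $ at_pos k\<bar> \<le> real (CARD('n) - k) + \<bar>defect 1 v k\<bar>" by (simp add: defect_def)
        also have "\<dots> \<le> ?b" using defect_bound[OF v k(1)] by simp
        finally show ?thesis by (simp add: k)
      qed
      then show "v \<in> cbox (\<chi> i. - ?b) (\<chi> i. ?b)" by (auto simp: mem_box_cart abs_le_iff minus_le_iff)
    qed
  qed
  ultimately show ?thesis by (simp add: compact_eq_bounded_closed)
qed

section \<open>Extreme points\<close>

text \<open>If the second difference at a nonzero prefix sum exceeds \<open>-2\<close>, the point can be moved both
  ways along a tent function supported between the neighbouring zeros.\<close>

definition tent :: "nat \<Rightarrow> nat \<Rightarrow> nat \<Rightarrow> nat \<Rightarrow> real" where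
  "tent a k b l = (if l \<le> a \<or> b \<le> l then 0
     else if l \<le> k then (real l - real a) / (real k - real a)
     else (real b - real l) / (real b - real k))"

lemma tent_bounds:
  assumes "a < k" "k < b"
  shows "0 \<le> tent a k b l" "tent a k b l \<le> 1"
  using assms by (auto simp: tent_def divide_simps)

lemma tent_rise: "a < k \<Longrightarrow> k < b \<Longrightarrow> a \<le> l \<Longrightarrow> l \<le> k \<Longrightarrow> tent a k b l = (real l - real a) / (real k - real a)"
  by (auto simp: tent_def)

lemma tent_fall: "a < k \<Longrightarrow> k < b \<Longrightarrow> k \<le> l \<Longrightarrow> l \<le> b \<Longrightarrow> tent a k b l = (real b - real l) / (real b - real k)"
  by (auto simp: tent_def)

lemma tent_second_difference:
  assumes "a < k" "k < b" "Suc l \<notin> {a, k, b}"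
  shows "tent a k b (Suc (Suc l)) - 2 * tent a k b (Suc l) + tent a k b l = 0"
proof -
  consider "Suc l < a" | "a < Suc l" "Suc l < k" | "k < Suc l" "Suc l < b" | "b < Suc l"
    using assms(3) by force
  then show ?thesis
  proof cases
    case 2
    then show ?thesis using assms(1,2) by (simp add: tent_rise diff_divide_distrib add_divide_distrib)
  next
    case 3
    then show ?thesis using assms(1,2) by (simp add: tent_fall diff_divide_distrib add_divide_distrib)
  qed (use assms(1,2) in \<open>auto simp: tent_def\<close>)
qed

lemma extreme_point_tight:
  fixes v :: "real ^ 'n::{finite,linorder}"
  assumes "v extreme_point_of dilate 1" "Suc k < CARD('n)" "(\<Sum>i<Suc k. defect 1 v i) \<noteq> 0"
  shows "defect 1 v (Suc k) = defect 1 v k - 2"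
proof (rule ccontr)
  define d Y S where "d = CARD('n)" and "Y = defect 1 v" and "S l = (\<Sum>i<l. Y i)" for l
  have v: "v \<in> dilate 1" using assms(1) by (simp add: extreme_point_of_def)
  then have pos: "\<And>l. l \<le> d \<Longrightarrow> S l \<ge> 0" and tot: "S d = 0"
    and step: "\<And>l. Suc l < d \<Longrightarrow> Y l - 2 \<le> Y (Suc l)"
    by (auto simp: dilate_def d_def Y_def S_def)
  have k: "Suc k < d" using assms by (simp add: d_def)
  assume "defect 1 v (Suc k) \<noteq> defect 1 v k - 2"
  then have slack: "Y (Suc k) - Y k + 2 > 0" using step[OF k] by (simp add: Y_def)
  have Sk: "S (Suc k) \<noteq> 0" using assms(3) by (simp add: S_def Y_def)
  define A B where "A = {l. l < Suc k \<and> S l = 0}" and "B = {l. Suc k < l \<and> l \<le> d \<and> S l = 0}"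
  have "0 \<in> A" "finite A" "d \<in> B" "finite B" using k tot by (auto simp: A_def B_def S_def)
  then have "Max A \<in> A" "Min B \<in> B" by (metis Max_in empty_iff, metis Min_in empty_iff)
  define a b where "a = Max A" and "b = Min B"
  have a: "a < Suc k" "S a = 0" using \<open>Max A \<in> A\<close> by (auto simp: A_def a_def)
  have b: "Suc k < b" "b \<le> d" "S b = 0" using \<open>Min B \<in> B\<close> by (auto simp: B_def b_def)
  have Spos: "S l > 0" if "a < l" "l < b" for l
  proof -
    have "l \<notin> A" using that(1) \<open>finite A\<close> Max_ge leD unfolding a_def by blast
    moreover have "l \<notin> B" using that(2) \<open>finite B\<close> Min_le leD unfolding b_def by blast
    ultimately have "S l \<noteq> 0" using that b Sk unfolding A_def B_def
      by (metis (mono_tags, lifting) linorder_neqE_nat mem_Collect_eq less_imp_le order.trans)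
    then show ?thesis using pos[of l] that b by simp
  qed
  define f where "f = tent a (Suc k) b"
  define W where "W l = f (Suc l) - f l" for l
  have f01: "0 \<le> f l" "f l \<le> 1" for l using tent_bounds[OF a(1) b(1)] by (auto simp: f_def)
  have f0: "f 0 = 0" "f d = 0" using b by (auto simp: f_def tent_def)
  have fnz: "a < l \<and> l < b" if "f l \<noteq> 0" for l using that by (auto simp: f_def tent_def split: if_splits)
  have fk: "f (Suc k) = 1" using a(1) b(1) by (simp add: f_def tent_def)
  have sumW: "(\<Sum>i<l. W i) = f l" for l
    unfolding W_def sum_lessThan_telescope using f0 by simp
  obtain w :: "(real, 'n) vec" where w: "\<And>l. l < d \<Longrightarrow> w $ at_pos l = W l"
    using vec_at_pos_exists[where 'n = 'n and f = W] unfolding d_def by metis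
  \<comment> \<open>What limits the perturbation: the prefix sums under the tent, the slack at its
    peak, and 1 for the kinks at \<open>a\<close> and \<open>b\<close>, where a vanishing prefix sum
    forces a slack of at least 2.\<close>
  define E where "E = insert 1 (insert (Y (Suc k) - Y k + 2) (S ` {l. a < l \<and> l < b}))"
  define \<epsilon> where "\<epsilon> = Min E / 2"
  have finE: "finite E" by (auto simp: E_def intro: finite_subset[of _ "{..<b}"])
  have "E \<noteq> {}" by (simp add: E_def)
  then have "Min E > 0" using slack Spos finE by (subst Min_gr_iff) (auto simp: E_def)
  then have \<epsilon>: "\<epsilon> > 0" by (simp add: \<epsilon>_def)
  have \<epsilon>E: "2 * \<epsilon> \<le> e" if "e \<in> E" for e using Min_le[OF finE that] by (simp add: \<epsilon>_def)
  have mem: "v + t *\<^sub>R w \<in> dilate 1" if t: "\<bar>t\<bar> \<le> \<epsilon>" for t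
  proof -
    have def: "defect 1 (v + t *\<^sub>R w) l = Y l - t * W l" if "l < d" for l
      using w[OF that] by (simp add: defect_def Y_def)
    have sums: "(\<Sum>i<l. defect 1 (v + t *\<^sub>R w) i) = S l - t * f l" if "l \<le> d" for l
    proof -
      have "(\<Sum>i<l. defect 1 (v + t *\<^sub>R w) i) = (\<Sum>i<l. Y i - t * W i)"
        using that by (intro sum.cong) (auto simp: def)
      also have "\<dots> = S l - t * f l"
        by (simp add: sum_subtractf S_def sumW flip: sum_distrib_left)
      finally show ?thesis .
    qed
    have nonneg: "S l - t * f l \<ge> 0" if "l \<le> d" for l
    proof (cases "f l = 0")
      case False
      then have "S l \<in> E" using fnz[OF False] by (auto simp: E_def)
      have "t * f l \<le> \<bar>t\<bar> * 1" using f01[of l] by (intro mult_mono) auto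
      also have "\<dots> \<le> S l" using t \<epsilon>E[OF \<open>S l \<in> E\<close>] \<epsilon> by simp
      finally show ?thesis by simp
    qed (use pos that in simp)
    have steps: "Y l - t * W l - 2 \<le> Y (Suc l) - t * W (Suc l)" if l: "Suc l < d" for l
    proof -
      define \<Delta> where "\<Delta> = W (Suc l) - W l"
      have \<Delta>: "\<Delta> = f (Suc (Suc l)) - 2 * f (Suc l) + f l" by (simp add: \<Delta>_def W_def)
      have "\<bar>\<Delta>\<bar> \<le> 2"
        unfolding \<Delta> using f01[of "Suc (Suc l)"] f01[of "Suc l"] f01[of l] by (simp add: abs_le_iff)
      then have "\<bar>t\<bar> * \<bar>\<Delta>\<bar> \<le> \<epsilon> * 2" using t \<epsilon> by (intro mult_mono) auto
      then have t\<Delta>: "t * \<Delta> \<le> 2 * \<epsilon>" using abs_ge_self[of "t * \<Delta>"] by (simp add: abs_mult)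
      have "t * \<Delta> \<le> Y (Suc l) - Y l + 2"
      proof (cases "Suc l \<in> {a, Suc k, b}")
        case False
        then have "\<Delta> = 0" unfolding \<Delta> f_def using a(1) b(1) by (intro tent_second_difference) auto
        then show ?thesis using step[OF l] by simp
      next
        case True
        show ?thesis
        proof (cases "l = k")
          case True
          then have "2 * \<epsilon> \<le> Y (Suc l) - Y l + 2" by (intro \<epsilon>E) (simp add: E_def)
          then show ?thesis using t\<Delta> by simp
        next
          case False
          then have "S (Suc l) = 0" using True a b by auto
          then have "Y (Suc l) \<ge> 0" "Y l \<le> 0"
            using pos[of "Suc (Suc l)"] pos[of l] l by (simp_all add: S_def)
          moreover have "2 * \<epsilon> \<le> 1" by (rule \<epsilon>E) (simp add: E_def)
          ultimately show ?thesis using t\<Delta> by simp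
        qed
      qed
      then show ?thesis by (simp add: \<Delta>_def algebra_simps)
    qed
    have "(\<Sum>i<d. defect 1 (v + t *\<^sub>R w) i) = 0"
      unfolding sums[OF order.refl] tot f0 by simp
    moreover have "(\<Sum>i<l. defect 1 (v + t *\<^sub>R w) i) \<ge> 0" if "l \<le> d" for l
      unfolding sums[OF that] by (rule nonneg[OF that])
    moreover have "defect 1 (v + t *\<^sub>R w) l - 2 * 1 \<le> defect 1 (v + t *\<^sub>R w) (Suc l)" if "Suc l < d" for l
      using steps[OF that] def[of l] def[of "Suc l"] that by simp
    ultimately show ?thesis unfolding dilate_def d_def[symmetric] by blast
  qed
  have "w \<noteq> 0"
  proof
    assume "w = 0"
    then have "W l = 0" if "l < d" for l using w[OF that] by simp
    then have "(\<Sum>i<Suc k. W i) = 0" using k by (intro sum.neutral) auto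
    then show False unfolding sumW fk by simp
  qed
  then have "v + (- \<epsilon>) *\<^sub>R w \<noteq> v + \<epsilon> *\<^sub>R w"
    unfolding add_left_cancel scaleR_cancel_right using \<epsilon> by simp
  moreover have "midpoint (v + (- \<epsilon>) *\<^sub>R w) (v + \<epsilon> *\<^sub>R w) = v"
    by (simp add: midpoint_def flip: scaleR_add_left)
  ultimately have "v \<in> open_segment (v + (- \<epsilon>) *\<^sub>R w) (v + \<epsilon> *\<^sub>R w)"
    using midpoint_in_open_segment by metis
  moreover have "v + (- \<epsilon>) *\<^sub>R w \<in> dilate 1" "v + \<epsilon> *\<^sub>R w \<in> dilate 1" using \<epsilon> by (auto intro!: mem simp del: scaleR_minus_left)
  ultimately show False using assms(1) by (auto simp: extreme_point_of_def)
qed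

text \<open>Tight steps form an arithmetic progression of difference -2, and its vanishing total
  determines the first term.\<close>

lemma tight_block:
  fixes Y :: "nat \<Rightarrow> real"
  assumes "(\<Sum>i<a. Y i) = 0" "(\<Sum>i<b. Y i) = 0"
    and "\<And>l. a \<le> l \<Longrightarrow> Suc l < b \<Longrightarrow> Y (Suc l) = Y l - 2"
    and i: "a \<le> i" "i < b"
  shows "Y i = real a + real b - 1 - 2 * real i"
proof -
  have Y: "Y (a + j) = Y a - 2 * real j" if "a + j < b" for j
    using that by (induction j) (auto simp: assms(3))
  have "(\<Sum>i<a + n. Y i) = real n * (Y a - (real n - 1))" if "a + n \<le> b" for n
    using that
  proof (induction n)
    case (Suc n)
    have "(\<Sum>i<a + Suc n. Y i) = (\<Sum>i<a + n. Y i) + Y (a + n)" by simp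
    then show ?case using Suc Y[of n] by (simp add: algebra_simps)
  qed (simp add: assms(1))
  from this[of "b - a"] have "0 = real (b - a) * (Y a - (real (b - a) - 1))"
    using i assms(2) by simp
  then have "Y a = real (b - a) - 1" using i by simp
  moreover have "Y i = Y a - 2 * real (i - a)" using Y[of "i - a"] i by simp
  ultimately show ?thesis using i by (simp add: of_nat_diff)
qed

text \<open>Between consecutive zeros \<open>a < b\<close> of the prefix sums an extreme point is the increasing run
  with values \<open>d - b + 1, \<dots>, d - a\<close>.\<close>

lemma extreme_point_permutation:
  fixes v :: "real ^ 'n::{finite,linorder}"
  assumes "v extreme_point_of dilate 1"
  obtains p where "p \<in> avoiding_permutations {[1, 3, 2], [2, 1, 3]}" "v = (\<chi> i. real (p i))"
proof -
  define d Y where "d = CARD('n)" and "Y = defect 1 v"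
  define Z where "Z = {l. l \<le> d \<and> (\<Sum>i<l. Y i) = 0}"
  have v: "v \<in> dilate 1" using assms by (simp add: extreme_point_of_def)
  have Z: "0 \<in> Z" "d \<in> Z" "finite Z" using v by (auto simp: Z_def dilate_def d_def Y_def)
  define a b where "a i = Max {l \<in> Z. l \<le> i}" and "b i = Min {l \<in> Z. i < l}" for i
  have a: "a i \<in> Z" "a i \<le> i" "\<And>l. l \<in> Z \<Longrightarrow> l \<le> i \<Longrightarrow> l \<le> a i" for i
  proof -
    have fin: "finite {l \<in> Z. l \<le> i}" using Z by simp
    have "a i \<in> {l \<in> Z. l \<le> i}" unfolding a_def using Z by (intro Max_in fin) auto
    then show "a i \<in> Z" "a i \<le> i" by auto
    show "\<And>l. l \<in> Z \<Longrightarrow> l \<le> i \<Longrightarrow> l \<le> a i" unfolding a_def by (intro Max_ge fin) auto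
  qed
  have b: "b i \<in> Z" "i < b i" "\<And>l. l \<in> Z \<Longrightarrow> i < l \<Longrightarrow> b i \<le> l" if "i < d" for i
  proof -
    have fin: "finite {l \<in> Z. i < l}" using Z by simp
    have "b i \<in> {l \<in> Z. i < l}" unfolding b_def using Z that by (intro Min_in fin) auto
    then show "b i \<in> Z" "i < b i" by auto
    show "\<And>l. l \<in> Z \<Longrightarrow> i < l \<Longrightarrow> b i \<le> l" unfolding b_def by (intro Min_le fin) auto
  qed
  have bd: "b i \<le> d" if "i < d" for i using b(1)[OF that] by (simp add: Z_def)
  have Yi: "Y i = real (a i) + real (b i) - 1 - 2 * real i" if i: "i < d" for i
  proof (rule tight_block)
    show "(\<Sum>i<a i. Y i) = 0" "(\<Sum>i<b i. Y i) = 0" using a(1)[of i] b(1)[OF i] by (auto simp: Z_def)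
    fix l assume l: "a i \<le> l" "Suc l < b i"
    then have "Suc l < d" using bd[OF i] by simp
    have "Suc l \<notin> Z" using a(3)[of "Suc l" i] b(3)[OF i, of "Suc l"] l by force
    then have "(\<Sum>i<Suc l. defect 1 v i) \<noteq> 0" using \<open>Suc l < d\<close> unfolding Z_def Y_def by auto
    then show "Y (Suc l) = Y l - 2"
      using extreme_point_tight[OF assms] \<open>Suc l < d\<close> by (simp add: Y_def d_def)
  qed (use a(2)[of i] b(2)[OF i] in auto)
  \<comment> \<open>This is \<open>d - i - Y i\<close>, written so that the truncated subtraction is
    exact for \<open>i < d\<close>.\<close>
  define q where "q i = d + 1 + i - (a i + b i)" for i
  have q_eq: "q i + a i + b i = d + 1 + i" if "i < d" for i
    using a(2)[of i] bd[OF that] by (simp add: q_def)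
  have q_range: "1 \<le> q i" "q i \<le> d" if "i < d" for i
    using q_eq[OF that] a(2)[of i] bd[OF that] b(2)[OF that] by linarith+
  have q_desc: "q j < q i" if "i < j" "j < d" "z \<in> Z" "i < z" "z \<le> j" for i j z
    using q_eq[of i] q_eq[of j] a(2)[of i] a(3)[of z j] b(2)[of j] b(3)[of i z] that by linarith
  have q_asc: "q i < q j" if "i < j" "j < d" "\<forall>z\<in>Z. \<not> (i < z \<and> z \<le> j)" for i j
  proof -
    have i: "i < d" using that by simp
    have "a j \<le> i" using that(3) a(1,2)[of j] by (meson not_less)
    then have "a i = a j"
      using a(3)[of "a i" j] a(3)[of "a j" i] a(1,2)[of i] a(1)[of j] that(1) by force
    moreover have "j < b i" using that(3) b(1,2)[OF i] by (meson not_less)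
    then have "b i = b j"
      using b(3)[OF i, of "b j"] b(3)[OF that(2), of "b i"] b(1)[OF i] b(1,2)[OF that(2)] that(1) by force
    ultimately show ?thesis using q_eq[of i] q_eq[of j] that by linarith
  qed
  have q_iff: "q i < q j \<longleftrightarrow> (\<forall>z\<in>Z. \<not> (i < z \<and> z \<le> j))" if "i < j" "j < d" for i j
    using q_desc[OF that] q_asc[OF that] by (metis less_asym)
  define pos where "pos = inv_into {..<d} (at_pos :: nat \<Rightarrow> 'n)"
  have bij_pos: "bij_betw pos UNIV {..<d}"
    unfolding pos_def d_def by (rule bij_betw_inv_into[OF bij_betw_at_pos])
  have pos_d: "pos x < d" for x using bij_pos by (auto simp: bij_betw_def)
  have at_pos_pos: "at_pos (pos x) = x" for x
    unfolding pos_def d_def by (rule bij_betw_inv_into_right[OF bij_betw_at_pos]) simp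
  have pos_less: "pos x < pos y \<longleftrightarrow> x < y" for x y
    using at_pos_less_iff[of "pos x" "pos y", where 'n = 'n] pos_d by (simp add: at_pos_pos d_def)
  define p where "p x = q (pos x)" for x
  have "inj_on q {..<d}"
  proof (rule linorder_inj_onI')
    fix i j assume "i \<in> {..<d}" "j \<in> {..<d}" "i < j"
    then show "q i \<noteq> q j" using q_desc[of i j] q_asc[of i j] by (metis lessThan_iff less_irrefl)
  qed
  moreover have "q ` {..<d} \<subseteq> {1..d}" using q_range by auto
  ultimately have "q ` {..<d} = {1..d}"
    by (intro card_subset_eq) (auto simp: card_image)
  then have "bij_betw q {..<d} {1..d}" using \<open>inj_on q {..<d}\<close> by (simp add: bij_betw_def)
  then have "bij_betw (q \<circ> pos) UNIV {1..d}" using bij_pos by (rule bij_betw_trans[rotated])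
  moreover have "q \<circ> pos = p" by (simp add: fun_eq_iff p_def)
  ultimately have perm: "is_permutation p" by (simp add: is_permutation_def d_def)
  have run: "p x < p y \<longleftrightarrow> (\<forall>z\<in>Z. \<not> (pos x < z \<and> z \<le> pos y))" if "x < y" for x y
    unfolding p_def by (rule q_iff) (use that pos_less pos_d in auto)
  \<comment> \<open>In both patterns the first entry lies below the last, so the outer positions
    share a run; the middle one is then in it too, and the run increases.\<close>
  have "\<not> contains_pattern p [1, 3, 2]"
    unfolding contains_132_iff
  proof clarify
    fix x y z assume *: "x < y" "y < z" "p x < p z" "p z < p y"
    then have "\<forall>u\<in>Z. \<not> (pos x < u \<and> u \<le> pos z)" using run[of x z] by (meson less_trans)
    moreover have "pos x < pos y" using * pos_less by simp
    ultimately have "p y < p z" using run[of y z] * by (meson less_trans)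
    with * show False by simp
  qed
  moreover have "\<not> contains_pattern p [2, 1, 3]"
    unfolding contains_213_iff
  proof clarify
    fix x y z assume *: "x < y" "y < z" "p y < p x" "p x < p z"
    then have "\<forall>u\<in>Z. \<not> (pos x < u \<and> u \<le> pos z)" using run[of x z] by (meson less_trans)
    moreover have "pos y < pos z" using * pos_less by simp
    ultimately have "p x < p y" using run[of x y] * by (meson less_imp_le order.trans)
    with * show False by simp
  qed
  ultimately have "p \<in> avoiding_permutations {[1, 3, 2], [2, 1, 3]}"
    using perm by (simp add: avoiding_permutations_def)
  moreover have "v $ x = real (p x)" for x
  proof -
    have "Y (pos x) = real (d - pos x) - v $ x" by (simp add: Y_def defect_def at_pos_pos d_def)
    moreover have "real (q (pos x)) + real (a (pos x)) + real (b (pos x)) = real d + 1 + real (pos x)"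
      using q_eq[OF pos_d, of x] by (metis of_nat_1 of_nat_add)
    ultimately show ?thesis using Yi[OF pos_d, of x] pos_d[of x] by (simp add: p_def of_nat_diff)
  qed
  then have "v = (\<chi> i. real (p i))" by (simp add: vec_eq_iff)
  ultimately show ?thesis using that by blast
qed

text \<open>By Krein-Milman it is enough that each extreme point of the inequality description is an
  admissible permutation; the permutations themselves need not be shown extreme.\<close>

theorem pattern_polytope_eq_dilate:
  "pattern_polytope {[1, 3, 2], [2, 1, 3]} = (dilate 1 :: (real ^ 'n::{finite,linorder}) set)"
proof (rule antisym)
  show "pattern_polytope {[1, 3, 2], [2, 1, 3]} \<subseteq> (dilate 1 :: (real, 'n) vec set)"
    unfolding pattern_polytope_def
    by (rule hull_minimal) (auto intro: avoiding_permutation_in_dilate convex_dilate_1 simp del: One_nat_def)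
  have "(dilate 1 :: (real, 'n) vec set) = convex hull {v. v extreme_point_of dilate 1}"
    by (rule Krein_Milman_Minkowski[OF compact_dilate_1 convex_dilate_1])
  also have "\<dots> \<subseteq> pattern_polytope {[1, 3, 2], [2, 1, 3]}"
    unfolding pattern_polytope_def
  proof (rule hull_mono, rule subsetI)
    fix v :: "(real, 'n) vec" assume "v \<in> {v. v extreme_point_of dilate 1}"
    then have "v extreme_point_of dilate 1" by simp
    from extreme_point_permutation[OF this] show
      "v \<in> (\<lambda>p. \<chi> i. real (p i)) ` avoiding_permutations {[1, 3, 2], [2, 1, 3]}" by blast
  qed
  finally show "(dilate 1 :: (real, 'n) vec set) \<subseteq> pattern_polytope {[1, 3, 2], [2, 1, 3]}" .
qed

theorem lattice_count_pattern_polytope: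
  "lattice_count (pattern_polytope {[1, 3, 2], [2, 1, 3]} :: (real ^ 'n::{finite,linorder}) set) m
    = card (excursions (2 * int m) CARD('n))"
  unfolding lattice_count_def pattern_polytope_eq_dilate scale_dilate_1
  by (rule bij_betw_same_card[OF lattice_points_dilate_bij])

theorem corollary6p2:
  fixes d :: nat
  assumes "d = CARD('n::{finite,linorder})"
    and "d \<ge> 4"
    and "eulerian_coord d 0 \<ge> 0"
    and "eulerian_coord d (d - 1) \<ge> 0"
    and "\<forall>r. 1 \<le> r \<and> r \<le> d - 2 \<longrightarrow> repaired_tail d r (2 - sqrt 3) \<ge> 0"
  shows "only_real_negative_zeros
           (hstar_poly (pattern_polytope {[1, 3, 2], [2, 1, 3]} :: (real ^ 'n::{finite,linorder}) set))"
proof -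
  define n where "n = d - 2"
  define a where "a = eulerian_coord d"
  have d: "d = Suc (Suc n)" and n: "n \<ge> 1" using assms(2) by (auto simp: n_def)
  \<comment> \<open>At \<open>x = 0\<close> only the term \<open>j = 0\<close> survives, so
    \<open>a 0\<close> is the number of excursions at \<open>m = 0\<close>. The constant list 0 is
    one, which gives the strict positivity needed for the pole at 1.\<close>
  have "a 0 = poly (C_poly d) (2 * 0)"
    unfolding poly_C_poly_eulerian_coord[OF d] a_def
    by (subst sum.remove[of _ 0]) auto
  also have "\<dots> = real (card (excursions (2 * int 0) d))"
    unfolding card_excursions by simp
  also have "excursions (2 * int 0) d \<noteq> {}"
  proof -
    have "replicate d 0 \<in> excursions (2 * int 0) d"
      by (simp add: excursions_def successively_conv_nth sum_list_replicate)
    then show ?thesis by blast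
  qed
  then have "real (card (excursions (2 * int 0) d)) > 0"
    using finite_excursions[of 0 d] by (simp add: card_gt_0_iff)
  finally have a0: "a 0 > 0" .
  show ?thesis
  proof (rule only_real_negative_zeros_hstar_poly[where a = a and n = n])
    show "CARD('n) = n + 2" using assms(1) d by simp
    show "a (Suc n) \<ge> 0" using assms(4) by (simp add: a_def d)
    show "tail_sum (2 - sqrt 3) a n r \<ge> 0" if "1 \<le> r" "r \<le> n" for r
      using assms(5) that by (simp add: tail_sum_def a_def repaired_tail_def n_def)
    show "real (lattice_count (pattern_polytope {[1, 3, 2], [2, 1, 3]} :: (real, 'n) vec set) m)
        = (\<Sum>j\<le>Suc n. a j * (real m ^ j * (real m + 1) ^ (Suc n - j)))" for m
      unfolding lattice_count_pattern_polytope card_excursions assms(1)[symmetric]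
        poly_C_poly_eulerian_coord[OF d] a_def ..
  qed (fact n a0)+
qed

end
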